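(* Let $X$ be an infinite dimensional complex Banach space, let $F\in L(X)$ and let $\sigma_{*}\in\{\sigma_{bf},\sigma_{ubf},\sigma_{lbf},\sigma_{d},\sigma_{ld},\sigma_{rd}\}$. The following statements are equivalent: (i) $F\in\mathcal{F}_{0}(X)$, i.e. $F$ is a power finite rank operator; (ii) $\sigma_{*}(T)=\sigma_{*}(T+F)$ for every generalized Drazin-Riesz invertible operator $T\in\mathrm{comm}_{w}(F)$; (iii) $\sigma_{*}(T)=\sigma_{*}(T+F)$ for every $T\in\mathrm{comm}(F)$.
   Context: $L(X)$ is the algebra of bounded linear operators on $X$. $\mathcal{F}_{0}(X)$ is the class of power finite rank operators: $F\in L(X)$ such that $\dim\mathcal{R}(F^{m})<\infty$ for some integer $m\geq 1$. $\mathrm{comm}(A)$ is the set of elements of $L(X)$ commuting with $A$; $\mathrm{comm}_{l}(A)=\{B: AB\in\mathrm{comm}(A)\text{ and }BA\in\mathrm{comm}(B)\}$; $\mathrm{comm}_{r}(A)=\{B: AB\in\mathrm{comm}(B)\text{ and }BA\in\mathrm{comm}(A)\}$; $\mathrm{comm}_{w}(A)=\mathrm{comm}_{l}(A)\cap\mathrm{comm}_{r}(A)$. An operator is Riesz if $T-\lambda I$ is Fredholm for all $\lambda\neq0$. $T$ is generalized Drazin-Riesz invertible if $X=M\oplus N$ for some closed $T$-invariant subspaces $M,N$ with $T_M$ invertible and $T_N$ Riesz ($T_M$ denotes the restriction of $T$ to $M$; $M$ or $N$ may be $\{0\}$). For $T\in L(X)$: $\mathcal{N}(T)$, $\mathcal{R}(T)$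 are kernel and range, $\alpha(T)=\dim\mathcal{N}(T)$, $\beta(T)=\mathrm{codim}\,\mathcal{R}(T)$; $p(T)=\inf\{n\in\mathbb{N}:\mathcal{N}(T^{n})=\mathcal{N}(T^{n+1})\}$, $q(T)=\inf\{n\in\mathbb{N}:\mathcal{R}(T^{n})=\mathcal{R}(T^{n+1})\}$ ($\mathbb{N}$ includes $0$, $\inf\emptyset=\infty$). $T_{[n]}$ is the restriction of $T$ to $\mathcal{R}(T^{n})$, as a map $\mathcal{R}(T^n)\to\mathcal{R}(T^n)$; $p_{e}(T)=\inf\{n:\alpha(T_{[n]})<\infty\}$, $q_{e}(T)=\inf\{n:\beta(T_{[n]})<\infty\}$, $m_{T}=\inf\{n:\min\{\alpha(T_{[n]}),\beta(T_{[n]})\}<\infty\}$. $T$ is upper semi-B-Fredholm if $p_{e}(T)<\infty$ and $\mathcal{R}(T^{p_{e}(T)+1})$ is closed; lower semi-B-Fredholm if $q_{e}(T)<\infty$ and $\mathcal{R}(T^{q_{e}(T)})$ is closed; B-Fredholm if both. $T$ is left Drazin invertible if it is upper semi-B-Fredholm with $p(T_{[m_T]})<\infty$; right Drazin invertible if it is lower semi-B-Fredholm with $q(T_{[m_T]})<\infty$; Drazin invertible if $m_T<\infty$ and $p(T_{[m_T]})=q(T_{[m_T]})<\infty$ (equivalently $p(T)=q(T)<\infty$). The spectra $\sigma_{bf},\sigma_{ubf},\sigma_{lbf},\sigma_{d},\sigma_{ld},\sigma_{rd}$ of $T$ are the sets of $\lambda\in\mathbb{C}$ such that $T-\lambda I$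 is not, respectively, B-Fredholm, upper semi-B-Fredholm, lower semi-B-Fredholm, Drazin invertible, left Drazin invertible, right Drazin invertible. *)

theory Defs
  imports "HOL-Analysis.Analysis"
begin

class complex_banach = banach +
  fixes scaleC :: "complex \<Rightarrow> 'a \<Rightarrow> 'a"  (infixr "*\<^sub>C" 75)
  assumes scaleC_add_right: "a *\<^sub>C (x + y) = a *\<^sub>C x + a *\<^sub>C y"
    and scaleC_add_left: "(a + b) *\<^sub>C x = a *\<^sub>C x + b *\<^sub>C x"
    and scaleC_scaleC: "a *\<^sub>C (b *\<^sub>C x) = (a * b) *\<^sub>C x"
    and scaleC_one: "1 *\<^sub>C x = x"
    and scaleR_scaleC: "r *\<^sub>R x = complex_of_real r *\<^sub>C x"
    and norm_scaleC: "norm (a *\<^sub>C x) = cmod a * norm x"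

global_interpretation complex_vector: vector_space "scaleC :: complex \<Rightarrow> 'a \<Rightarrow> 'a::complex_banach"
  by unfold_locales (simp_all add: scaleC_add_right scaleC_add_left scaleC_scaleC scaleC_one)

text \<open>The library's \<open>dim\<close> is 0 on infinite-dimensional spaces, hence the explicit case distinction.\<close>

definition edim :: "'a::complex_banach set \<Rightarrow> enat" where
  "edim V = (if \<exists>B. finite B \<and> V \<subseteq> complex_vector.span B
             then enat (complex_vector.dim V) else \<infinity>)"

text \<open>The dimension of the quotient \<open>V/U\<close> for subspaces \<open>U \<subseteq> V\<close>: the least number of vectors of \<open>V\<close>
  whose classes generate \<open>V/U\<close> (\<open>\<infinity>\<close>, the infimum of the empty set, if no finite set does).\<close>

definition ecodim :: "'a::complex_banach set \<Rightarrow> 'a set \<Rightarrow> enat" where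
  "ecodim V U = Inf {enat (card B) |B. finite B \<and> B \<subseteq> V \<and> V \<subseteq> complex_vector.span (U \<union> B)}"

text \<open>\<open>bounded_op_on M S\<close> says that (the restriction to \<open>M\<close> of) \<open>S\<close> is a bounded linear operator on the
  subspace \<open>M\<close>; values of \<open>S\<close> outside \<open>M\<close> are irrelevant.\<close>

definition bounded_op_on :: "'a::complex_banach set \<Rightarrow> ('a \<Rightarrow> 'a) \<Rightarrow> bool" where
  "bounded_op_on M S \<longleftrightarrow> S ` M \<subseteq> M
     \<and> (\<forall>x\<in>M. \<forall>y\<in>M. S (x + y) = S x + S y)
     \<and> (\<forall>c. \<forall>x\<in>M. S (c *\<^sub>C x) = c *\<^sub>C S x)
     \<and> (\<exists>K. \<forall>x\<in>M. norm (S x) \<le> K * norm x)"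

definition bounded_ops :: "('a::complex_banach \<Rightarrow> 'a) set" where
  "bounded_ops = {T. bounded_linear T \<and> (\<forall>c x. T (c *\<^sub>C x) = c *\<^sub>C T x)}"

definition power_finite_rank :: "('a::complex_banach \<Rightarrow> 'a) set" where
  "power_finite_rank = {F \<in> bounded_ops. \<exists>m\<ge>1. edim (range (F ^^ m)) < \<infinity>}"

definition comm :: "('a::complex_banach \<Rightarrow> 'a) \<Rightarrow> ('a \<Rightarrow> 'a) set" where
  "comm A = {B \<in> bounded_ops. A \<circ> B = B \<circ> A}"

definition comm_l :: "('a::complex_banach \<Rightarrow> 'a) \<Rightarrow> ('a \<Rightarrow> 'a) set" where
  "comm_l A = {B \<in> bounded_ops. A \<circ> B \<in> comm A \<and> B \<circ> A \<in> comm B}"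

definition comm_r :: "('a::complex_banach \<Rightarrow> 'a) \<Rightarrow> ('a \<Rightarrow> 'a) set" where
  "comm_r A = {B \<in> bounded_ops. A \<circ> B \<in> comm B \<and> B \<circ> A \<in> comm A}"

definition comm_w :: "('a::complex_banach \<Rightarrow> 'a) \<Rightarrow> ('a \<Rightarrow> 'a) set" where
  "comm_w A = comm_l A \<inter> comm_r A"

definition op_add :: "('a::complex_banach \<Rightarrow> 'a) \<Rightarrow> ('a \<Rightarrow> 'a) \<Rightarrow> 'a \<Rightarrow> 'a" where
  "op_add T S = (\<lambda>x. T x + S x)"

definition op_shift :: "('a::complex_banach \<Rightarrow> 'a) \<Rightarrow> complex \<Rightarrow> 'a \<Rightarrow> 'a" where
  "op_shift T c = (\<lambda>x. T x - c *\<^sub>C x)"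

text \<open>The restriction \<open>T\<^sub>M\<close> of \<open>T\<close> to an invariant subspace \<open>M\<close>, seen as an operator on \<open>M\<close>, is encoded
  by the pair \<open>M\<close>, \<open>T\<close>; the operator \<open>T\<close> itself is the case \<open>M = UNIV\<close>.\<close>

definition alpha_on :: "'a::complex_banach set \<Rightarrow> ('a \<Rightarrow> 'a) \<Rightarrow> enat" where
  "alpha_on M T = edim {x \<in> M. T x = 0}"

definition beta_on :: "'a::complex_banach set \<Rightarrow> ('a \<Rightarrow> 'a) \<Rightarrow> enat" where
  "beta_on M T = ecodim M (T ` M)"

definition ascent_on :: "'a::complex_banach set \<Rightarrow> ('a \<Rightarrow> 'a) \<Rightarrow> enat" where
  "ascent_on M T = Inf {enat n |n. {x \<in> M. (T ^^ n) x = 0} = {x \<in> M. (T ^^ (n + 1)) x = 0}}"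

definition descent_on :: "'a::complex_banach set \<Rightarrow> ('a \<Rightarrow> 'a) \<Rightarrow> enat" where
  "descent_on M T = Inf {enat n |n. (T ^^ n) ` M = (T ^^ (n + 1)) ` M}"

text \<open>On a Banach space, finiteness of the codimension of the range forces the range to be closed,
  so closedness is not a separate requirement here.\<close>

definition fredholm_on :: "'a::complex_banach set \<Rightarrow> ('a \<Rightarrow> 'a) \<Rightarrow> bool" where
  "fredholm_on M T \<longleftrightarrow> alpha_on M T < \<infinity> \<and> beta_on M T < \<infinity>"

definition riesz_on :: "'a::complex_banach set \<Rightarrow> ('a \<Rightarrow> 'a) \<Rightarrow> bool" where
  "riesz_on M T \<longleftrightarrow> (\<forall>c. c \<noteq> 0 \<longrightarrow> fredholm_on M (op_shift T c))"

definition invertible_on :: "'a::complex_banach set \<Rightarrow> ('a \<Rightarrow> 'a) \<Rightarrow> bool" where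
  "invertible_on M T \<longleftrightarrow> (\<exists>S. bounded_op_on M S \<and> (\<forall>x\<in>M. S (T x) = x \<and> T (S x) = x))"

definition gen_drazin_riesz :: "('a::complex_banach \<Rightarrow> 'a) \<Rightarrow> bool" where
  "gen_drazin_riesz T \<longleftrightarrow> (\<exists>M N.
      complex_vector.subspace M \<and> complex_vector.subspace N \<and> closed M \<and> closed N
      \<and> M \<inter> N = {0} \<and> (\<forall>x. \<exists>m\<in>M. \<exists>n\<in>N. x = m + n)
      \<and> T ` M \<subseteq> M \<and> T ` N \<subseteq> N
      \<and> invertible_on M T \<and> riesz_on N T)"

definition p_e :: "('a::complex_banach \<Rightarrow> 'a) \<Rightarrow> enat" where
  "p_e T = Inf {enat n |n. alpha_on (range (T ^^ n)) T < \<infinity>}"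

definition q_e :: "('a::complex_banach \<Rightarrow> 'a) \<Rightarrow> enat" where
  "q_e T = Inf {enat n |n. beta_on (range (T ^^ n)) T < \<infinity>}"

definition m_deg :: "('a::complex_banach \<Rightarrow> 'a) \<Rightarrow> enat" where
  "m_deg T = Inf {enat n |n. min (alpha_on (range (T ^^ n)) T) (beta_on (range (T ^^ n)) T) < \<infinity>}"

definition upper_semi_b_fredholm :: "('a::complex_banach \<Rightarrow> 'a) \<Rightarrow> bool" where
  "upper_semi_b_fredholm T \<longleftrightarrow> (\<exists>n. p_e T = enat n \<and> closed (range (T ^^ (n + 1))))"

definition lower_semi_b_fredholm :: "('a::complex_banach \<Rightarrow> 'a) \<Rightarrow> bool" where
  "lower_semi_b_fredholm T \<longleftrightarrow> (\<exists>n. q_e T = enat n \<and> closed (range (T ^^ n)))"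

definition b_fredholm :: "('a::complex_banach \<Rightarrow> 'a) \<Rightarrow> bool" where
  "b_fredholm T \<longleftrightarrow> upper_semi_b_fredholm T \<and> lower_semi_b_fredholm T"

text \<open>An upper or lower semi-B-Fredholm operator has \<open>m_deg T \<le> p_e T\<close> resp. \<open>m_deg T \<le> q_e T\<close> finite,
  so the condition \<open>m_deg T = enat m\<close> below merely names its value.\<close>

definition left_drazin_invertible :: "('a::complex_banach \<Rightarrow> 'a) \<Rightarrow> bool" where
  "left_drazin_invertible T \<longleftrightarrow> upper_semi_b_fredholm T
     \<and> (\<exists>m. m_deg T = enat m \<and> ascent_on (range (T ^^ m)) T < \<infinity>)"

definition right_drazin_invertible :: "('a::complex_banach \<Rightarrow> 'a) \<Rightarrow> bool" where
  "right_drazin_invertible T \<longleftrightarrow> lower_semi_b_fredholm T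
     \<and> (\<exists>m. m_deg T = enat m \<and> descent_on (range (T ^^ m)) T < \<infinity>)"

definition drazin_invertible :: "('a::complex_banach \<Rightarrow> 'a) \<Rightarrow> bool" where
  "drazin_invertible T \<longleftrightarrow> (\<exists>m. m_deg T = enat m
     \<and> ascent_on (range (T ^^ m)) T = descent_on (range (T ^^ m)) T
     \<and> descent_on (range (T ^^ m)) T < \<infinity>)"

definition sigma_bf :: "('a::complex_banach \<Rightarrow> 'a) \<Rightarrow> complex set" where
  "sigma_bf T = {c. \<not> b_fredholm (op_shift T c)}"

definition sigma_ubf :: "('a::complex_banach \<Rightarrow> 'a) \<Rightarrow> complex set" where
  "sigma_ubf T = {c. \<not> upper_semi_b_fredholm (op_shift T c)}"

definition sigma_lbf :: "('a::complex_banach \<Rightarrow> 'a) \<Rightarrow> complex set" where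
  "sigma_lbf T = {c. \<not> lower_semi_b_fredholm (op_shift T c)}"

definition sigma_d :: "('a::complex_banach \<Rightarrow> 'a) \<Rightarrow> complex set" where
  "sigma_d T = {c. \<not> drazin_invertible (op_shift T c)}"

definition sigma_ld :: "('a::complex_banach \<Rightarrow> 'a) \<Rightarrow> complex set" where
  "sigma_ld T = {c. \<not> left_drazin_invertible (op_shift T c)}"

definition sigma_rd :: "('a::complex_banach \<Rightarrow> 'a) \<Rightarrow> complex set" where
  "sigma_rd T = {c. \<not> right_drazin_invertible (op_shift T c)}"

end

theory Submission
  imports Defs "HOL-Complex_Analysis.Cauchy_Integral_Formula"
begin

text \<open>
  For a bounded operator \<open>A\<close> write \<open>V\<^sub>j = A\<^sup>j X\<close>. The six notions behind the spectra are conjunctions of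
  four properties of this decreasing chain (\<open>semi_upper\<close>, \<open>semi_lower\<close>, \<open>finite_ascent\<close>,
  \<open>finite_descent\<close>): for some \<open>k\<close> the space \<open>ker A \<inter> V\<^sub>k\<close> is finite-dimensional with \<open>V\<^sub>k\<^sub>+\<^sub>1\<close>
  closed, or \<open>V\<^sub>k / V\<^sub>k\<^sub>+\<^sub>1\<close> is finite-dimensional with \<open>V\<^sub>k\<close> closed, or \<open>ker A \<inter> V\<^sub>k\<close> vanishes, or
  \<open>V\<^sub>k = V\<^sub>k\<^sub>+\<^sub>1\<close>. Each property holds for all large indices once it holds for one, so that it can be
  compared along chains that are merely cofinal in each other.

  Suppose that \<open>F\<close> is power finite rank and commutes weakly with \<open>T\<close>. The Fitting decomposition of
  \<open>F\<close> splits off a finite-dimensional invariant subspace, on which nothing can happen, and leaves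
  a subspace on which \<open>F\<close> is nilpotent. The commutator \<open>C = TF - FT\<close> is annihilated by \<open>T\<close> and \<open>F\<close>
  from both sides; hence \<open>T - c\<close> acts as the scalar \<open>-c\<close> modulo \<open>ker C\<close>, and for \<open>c \<noteq> 0\<close> one may
  pass to \<open>ker C\<close>, where \<open>T\<close> and \<open>F\<close> commute (\<open>same_semi_type_reduction\<close>). There the geometric sum
  \<open>B = \<Sum> S\<^sup>i F\<^sup>p\<^sup>-\<^sup>1\<^sup>-\<^sup>i\<close> satisfies \<open>(S - F) B = B (S - F) = S\<^sup>p\<close>, so that \<open>A = T - c\<close> and \<open>S = A + F\<close>
  divide powers of each other. For \<open>c = 0\<close> weak commutation is already enough for this identity,
  because words of length at least three in \<open>T\<close> and \<open>F\<close> may be permuted. Two operators which divide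
  powers of each other have the same four properties (\<open>same_semi_type_if_divides_power\<close>). The delicate
  point is that ranges stay closed; it rests on the fact that an operator range is closed as soon as
  its sum with, and its intersection with, some closed subspace are closed
  (\<open>closed_image_if_closed_sum\<close>, a consequence of the open mapping theorem).

  Conversely, suppose that the spectrum is unchanged by adding \<open>F\<close> to any invertible operator in the
  commutant of \<open>F\<close>; an invertible operator is generalized Drazin-Riesz invertible. For the identity
  this says that the spectrum of \<open>F\<close> is empty. At a limit of points of the resolvent set the
  corresponding shift of \<open>F\<close> then has finite ascent and descent, so that the point is at most
  an isolated point of the ordinary spectrum. By connectedness of the plane, the ordinary spectrum of \<open>F\<close> is a finite set of
  poles, and by Liouville's theorem nothing is left of the space beyond their generalized
  eigenspaces. If \<open>F\<close> were not power finite rank, some pole \<open>l \<noteq> 0\<close> would have an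
  infinite-dimensional generalized eigenspace, on which \<open>Q = F - l\<close> is nilpotent. With the
  Hahn-Banach theorem one finds there a sequence of nonzero, mutually orthogonal projections \<open>P\<^sub>n\<close>
  commuting with \<open>Q\<close>. For \<open>T = \<Sum> \<epsilon>\<^sub>n P\<^sub>n\<close> with rapidly decreasing \<open>\<epsilon>\<^sub>n\<close>, no positive power of
  \<open>T + Q\<close> has closed range (\<open>nonclosed_perturbation\<close>), although \<open>T - l\<close> is invertible, and
  \<open>(T - l) + F = T + Q\<close>: the point \<open>0\<close> lies in the spectrum of the sum but not in that of \<open>T - l\<close>.
\<close>

section \<open>Bounded operators and complex subspaces\<close>

abbreviation csubspace :: "'a::complex_banach set \<Rightarrow> bool" where
  "csubspace \<equiv> complex_vector.subspace"

abbreviation cspan :: "'a::complex_banach set \<Rightarrow> 'a set" where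
  "cspan \<equiv> complex_vector.span"

lemma set_plusI: "c = a + b \<Longrightarrow> a \<in> A \<Longrightarrow> b \<in> B \<Longrightarrow> c \<in> A + B"
  by (auto simp: set_plus_def)

lemma set_plusE:
  assumes "c \<in> A + B"
  obtains a b where "a \<in> A" "b \<in> B" "c = a + b"
  using assms by (auto simp: set_plus_def)

lemma bounded_ops_bounded_linear: "T \<in> bounded_ops \<Longrightarrow> bounded_linear T"
  by (simp add: bounded_ops_def)

lemma bounded_ops_scaleC: "T \<in> bounded_ops \<Longrightarrow> T (c *\<^sub>C x) = c *\<^sub>C T x"
  by (simp add: bounded_ops_def)

lemma bounded_ops_add: "T \<in> bounded_ops \<Longrightarrow> T (x + y) = T x + T y"
  by (simp add: bounded_ops_def linear_simps)

lemma bounded_ops_diff: "T \<in> bounded_ops \<Longrightarrow> T (x - y) = T x - T y"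
  by (simp add: bounded_ops_def linear_simps)

lemma bounded_ops_minus: "T \<in> bounded_ops \<Longrightarrow> T (- x) = - T x"
  by (simp add: bounded_ops_def linear_simps)

lemma bounded_ops_zero: "T \<in> bounded_ops \<Longrightarrow> T 0 = 0"
  by (simp add: bounded_ops_def linear_simps)

lemma bounded_ops_sum: "T \<in> bounded_ops \<Longrightarrow> T (\<Sum>i\<in>I. f i) = (\<Sum>i\<in>I. T (f i))"
  using bounded_ops_bounded_linear bounded_linear.linear linear_sum by blast

lemmas bounded_ops_simps = bounded_ops_scaleC bounded_ops_add bounded_ops_diff
  bounded_ops_minus bounded_ops_zero bounded_ops_sum

lemma bounded_ops_linear: "T \<in> bounded_ops \<Longrightarrow> Vector_Spaces.linear scaleC scaleC T"
  by (simp add: Vector_Spaces.linear_iff complex_vector.vector_space_axioms bounded_ops_simps)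

lemma bounded_ops_continuous: "T \<in> bounded_ops \<Longrightarrow> continuous_on S T"
  using bounded_ops_bounded_linear linear_continuous_on by blast

lemma bounded_linear_scaleC: "bounded_linear (\<lambda>x::'a::complex_banach. c *\<^sub>C x)"
proof (rule bounded_linear_intro[where K = "cmod c"])
  show "c *\<^sub>C (r *\<^sub>R x) = r *\<^sub>R (c *\<^sub>C x)" for r and x :: 'a
    by (simp add: scaleR_scaleC scaleC_scaleC mult.commute)
qed (simp_all add: scaleC_add_right norm_scaleC mult.commute)

lemma bounded_ops_compose:
  assumes "T \<in> bounded_ops" "S \<in> bounded_ops"
  shows "(\<lambda>x. T (S x)) \<in> bounded_ops"
  using assms bounded_linear_compose[of T S] by (simp add: bounded_ops_def)

lemma bounded_ops_op_add:
  assumes "T \<in> bounded_ops" "S \<in> bounded_ops"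
  shows "op_add T S \<in> bounded_ops"
  using assms bounded_linear_add[of T S] by (simp add: bounded_ops_def op_add_def scaleC_add_right)

lemma bounded_ops_scale:
  assumes "T \<in> bounded_ops"
  shows "(\<lambda>x. c *\<^sub>C T x) \<in> bounded_ops"
  using assms bounded_linear_compose[OF bounded_linear_scaleC, of T]
  by (simp add: bounded_ops_def scaleC_scaleC mult.commute)

lemma bounded_ops_ident: "(\<lambda>x. x) \<in> bounded_ops"
  by (simp add: bounded_ops_def bounded_linear_ident)

lemma bounded_ops_null: "(\<lambda>x. 0) \<in> bounded_ops"
  by (simp add: bounded_ops_def bounded_linear_zero)

lemma bounded_ops_uminus:
  assumes "T \<in> bounded_ops"
  shows "(\<lambda>x. - T x) \<in> bounded_ops"
  using bounded_ops_scale[OF assms, of "-1"] by simp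

lemma bounded_ops_sub:
  assumes "T \<in> bounded_ops" "S \<in> bounded_ops"
  shows "(\<lambda>x. T x - S x) \<in> bounded_ops"
  using bounded_ops_op_add[OF assms(1) bounded_ops_uminus[OF assms(2)]] by (simp add: op_add_def)

lemma bounded_ops_op_shift:
  assumes "T \<in> bounded_ops"
  shows "op_shift T c \<in> bounded_ops"
  using bounded_ops_sub[OF assms bounded_ops_scale[OF bounded_ops_ident, of c]]
  by (simp add: op_shift_def)

lemma bounded_ops_funpow:
  assumes "T \<in> bounded_ops"
  shows "T ^^ n \<in> bounded_ops"
proof (induction n)
  case 0
  then show ?case using bounded_ops_ident by (simp add: id_def)
next
  case (Suc n)
  then show ?case using bounded_ops_compose[OF assms Suc] by (simp add: comp_def)
qed

lemma bounded_ops_finite_sum: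
  assumes "\<And>i. i \<in> I \<Longrightarrow> T i \<in> bounded_ops"
  shows "(\<lambda>x. \<Sum>i\<in>I. T i x) \<in> bounded_ops"
  using assms
proof (induction I rule: infinite_finite_induct)
  case (insert i I)
  have "op_add (T i) (\<lambda>x. \<Sum>i\<in>I. T i x) \<in> bounded_ops"
    using insert by (intro bounded_ops_op_add) auto
  then show ?case using insert by (simp add: op_add_def)
qed (auto simp: bounded_ops_null)

lemma csubspace_image:
  assumes "T \<in> bounded_ops" "csubspace U"
  shows "csubspace (T ` U)"
proof -
  interpret Vector_Spaces.linear scaleC scaleC T using bounded_ops_linear[OF assms(1)] .
  show ?thesis using subspace_image[OF assms(2)] .
qed

lemma csubspace_preimage:
  "T \<in> bounded_ops \<Longrightarrow> csubspace U \<Longrightarrow> csubspace W \<Longrightarrow> csubspace {x \<in> U. T x \<in> W}"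
  by (auto simp: complex_vector.subspace_def bounded_ops_simps)

lemma csubspace_kernel: "T \<in> bounded_ops \<Longrightarrow> csubspace U \<Longrightarrow> csubspace {x \<in> U. T x = 0}"
  by (auto simp: complex_vector.subspace_def bounded_ops_simps)

lemma csubspace_plus: "csubspace U \<Longrightarrow> csubspace W \<Longrightarrow> csubspace (U + W)"
  using complex_vector.subspace_sums[of U W] unfolding set_plus_def Bex_def
  by (rule back_subst[where P = csubspace]) auto

lemma csubspace_real: "csubspace U \<Longrightarrow> subspace U"
  by (auto simp: complex_vector.subspace_def real_vector.subspace_def scaleR_scaleC)

lemma closed_preimage:
  "T \<in> bounded_ops \<Longrightarrow> closed U \<Longrightarrow> closed W \<Longrightarrow> closed {x \<in> U. T x \<in> W}"
  using continuous_closed_preimage[of U T W] bounded_ops_continuous[of T U]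
  by (simp add: vimage_def Int_def conj_commute)

lemma closed_kernel: "T \<in> bounded_ops \<Longrightarrow> closed U \<Longrightarrow> closed {x \<in> U. T x = 0}"
  using closed_preimage[of T U "{0}"] by simp

section \<open>Finite-dimensional subspaces\<close>

definition fin_dim :: "'a::complex_banach set \<Rightarrow> bool" where
  "fin_dim V \<longleftrightarrow> (\<exists>B. finite B \<and> V \<subseteq> cspan B)"

lemma edim_finite_iff: "edim V < \<infinity> \<longleftrightarrow> fin_dim V"
  by (simp add: edim_def fin_dim_def)

lemma fin_dim_subset: "fin_dim W \<Longrightarrow> V \<subseteq> W \<Longrightarrow> fin_dim V"
  unfolding fin_dim_def by blast

lemma fin_dim_span: "finite B \<Longrightarrow> fin_dim (cspan B)"
  unfolding fin_dim_def by blast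

lemma fin_dim_zero: "fin_dim {0}"
  using fin_dim_span[of "{}"] by simp

lemma fin_dim_image:
  assumes "T \<in> bounded_ops" "fin_dim V"
  shows "fin_dim (T ` V)"
proof -
  interpret Vector_Spaces.linear scaleC scaleC T using bounded_ops_linear[OF assms(1)] .
  obtain B where "finite B" "V \<subseteq> cspan B" using assms(2) unfolding fin_dim_def by blast
  then have "T ` V \<subseteq> cspan (T ` B)" using span_image[of B] by blast
  then show ?thesis using \<open>finite B\<close> unfolding fin_dim_def by blast
qed

lemma fin_dim_plus:
  assumes "fin_dim V" "fin_dim W"
  shows "fin_dim (V + W)"
proof -
  obtain B C where *: "finite B" "V \<subseteq> cspan B" "finite C" "W \<subseteq> cspan C"
    using assms unfolding fin_dim_def by blast
  have "V + W \<subseteq> cspan (B \<union> C)"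
    using * complex_vector.span_mono[of B "B \<union> C"] complex_vector.span_mono[of C "B \<union> C"]
    by (auto simp: set_plus_def intro!: complex_vector.span_add)
  then show ?thesis using * unfolding fin_dim_def by blast
qed

lemma finite_independent_fin_dim:
  assumes "fin_dim V" "B \<subseteq> V" "complex_vector.independent B"
  shows "finite B"
  using assms complex_vector.independent_span_bound unfolding fin_dim_def by blast

lemma fin_dim_finite_basis:
  assumes "fin_dim V"
  obtains B where "finite B" "B \<subseteq> V" "V \<subseteq> cspan B" "complex_vector.independent B" "card B = complex_vector.dim V"
  using complex_vector.basis_exists[of V] finite_independent_fin_dim[OF assms] by metis

lemma fin_dim_equal:
  assumes "fin_dim W" "csubspace U" "csubspace W" "U \<subseteq> W" "complex_vector.dim W \<le> complex_vector.dim U"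
  shows "U = W"
proof -
  obtain B where B: "finite B" "B \<subseteq> U" "U \<subseteq> cspan B" "complex_vector.independent B" "card B = complex_vector.dim U"
    using fin_dim_finite_basis[OF fin_dim_subset[OF assms(1,4)]] .
  obtain C where C: "B \<subseteq> C" "C \<subseteq> W" "complex_vector.independent C" "W \<subseteq> cspan C"
    using complex_vector.maximal_independent_subset_extend[of B W] B assms by blast
  have "card C = complex_vector.dim W" "finite C"
    using C complex_vector.basis_card_eq_dim finite_independent_fin_dim[OF assms(1)] by blast+
  then have "B = C" using B C assms by (metis card_seteq)
  then have "W \<subseteq> cspan U" using C B complex_vector.span_mono by blast
  then show ?thesis using assms complex_vector.span_minimal[of U U] by blast
qed

lemma fin_dim_dim_mono:
  assumes "fin_dim W" "U \<subseteq> W"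
  shows "complex_vector.dim U \<le> complex_vector.dim W"
proof -
  obtain B where B: "finite B" "B \<subseteq> W" "W \<subseteq> cspan B" "card B = complex_vector.dim W"
    using fin_dim_finite_basis[OF assms(1)] by metis
  then show ?thesis using assms(2) complex_vector.dim_le_card[of U B] by (metis order_trans)
qed

lemma decreasing_chain_stable:
  assumes "fin_dim (W k)" "\<And>j. csubspace (W j)" "\<And>j. W (Suc j) \<subseteq> W j"
  obtains d where "k \<le> d" "\<And>j. d \<le> j \<Longrightarrow> W j = W d"
proof -
  have anti: "W j \<subseteq> W i" if "i \<le> j" for i j
    using that assms(3) lift_Suc_antimono_le by blast
  define S where "S = (\<lambda>n. \<exists>j\<ge>k. complex_vector.dim (W j) = n)"
  have "\<exists>n. S n" unfolding S_def by blast
  then have "S (LEAST n. S n)" by (metis LeastI)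
  then obtain d where d: "d \<ge> k" "complex_vector.dim (W d) = (LEAST n. S n)" unfolding S_def by blast
  have "W j = W d" if "d \<le> j" for j
  proof (rule fin_dim_equal)
    show "complex_vector.dim (W d) \<le> complex_vector.dim (W j)"
      unfolding d(2) S_def using d that by (intro Least_le exI[of _ j]) auto
    show "fin_dim (W d)" using anti[OF d(1)] assms(1) fin_dim_subset by blast
  qed (use assms anti that in auto)
  then show ?thesis using d that by blast
qed

text \<open>The common bound \<open>E\<close> is essential: unlike a decreasing chain, an increasing one may grow forever
although each of its members is finite-dimensional.\<close>

lemma increasing_chain_stable:
  assumes "fin_dim E" "\<And>j. csubspace (W j)" "\<And>j. W j \<subseteq> W (Suc j)" "\<And>j. W j \<subseteq> E"
  obtains d where "\<And>j. d \<le> j \<Longrightarrow> W j = W d"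
proof -
  have mono: "W i \<subseteq> W j" if "i \<le> j" for i j
    using that assms(3) lift_Suc_mono_le by blast
  define S where "S = range (\<lambda>j. complex_vector.dim (W j))"
  have "S \<subseteq> {.. complex_vector.dim E}" unfolding S_def using fin_dim_dim_mono assms by blast
  then have fS: "finite S" using finite_subset by blast
  have "Max S \<in> S" using Max_in[OF fS] unfolding S_def by blast
  then obtain d where d: "complex_vector.dim (W d) = Max S" unfolding S_def by auto
  have "W d = W j" if "d \<le> j" for j
  proof (rule fin_dim_equal)
    show "complex_vector.dim (W j) \<le> complex_vector.dim (W d)"
      unfolding d by (rule Max_ge[OF fS]) (auto simp: S_def)
    show "fin_dim (W j)" using assms fin_dim_subset by blast
  qed (use assms mono that in auto)
  then show ?thesis using that by metis
qed

lemma subspace_image_lift: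
  assumes "T \<in> bounded_ops" "csubspace V" "fin_dim (T ` V)"
  obtains E where "csubspace E" "E \<subseteq> V" "fin_dim E" "T ` E = T ` V"
proof -
  obtain B where B: "finite B" "B \<subseteq> T ` V" "T ` V \<subseteq> cspan B"
    using fin_dim_finite_basis[OF assms(3)] by metis
  obtain C where C: "C \<subseteq> V" "finite C" "B = T ` C" using B finite_subset_image by metis
  interpret Vector_Spaces.linear scaleC scaleC T using bounded_ops_linear[OF assms(1)] .
  have "cspan C \<subseteq> V" using C assms(2) complex_vector.span_minimal by blast
  moreover have "T ` cspan C = T ` V"
    using B C span_image[of C] calculation by auto
  ultimately show ?thesis using that[of "cspan C"] fin_dim_span[OF C(2)] by simp
qed

text \<open>Preimages in \<open>V\<close> of a spanning set of the image span a subspace \<open>E\<close>, and every vector of \<open>V\<close> has the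
same image as some vector of \<open>E\<close>.\<close>

lemma kernel_complement:
  assumes "T \<in> bounded_ops" "csubspace V" "fin_dim (T ` V)"
  obtains E where "csubspace E" "E \<subseteq> V" "fin_dim E" "V = {x \<in> V. T x = 0} + E"
proof -
  obtain E where E: "csubspace E" "E \<subseteq> V" "fin_dim E" "T ` E = T ` V"
    using subspace_image_lift[OF assms] .
  have "V \<subseteq> {x \<in> V. T x = 0} + E"
  proof
    fix x assume x: "x \<in> V"
    then obtain e where e: "e \<in> E" "T x = T e" using E by blast
    then have "x - e \<in> {x \<in> V. T x = 0}"
      using x E assms(1,2) by (auto simp: bounded_ops_simps intro: complex_vector.subspace_diff)
    then show "x \<in> {x \<in> V. T x = 0} + E" using e(1) by (intro set_plusI[of x "x - e" e]) auto
  qed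
  moreover have "{x \<in> V. T x = 0} + E \<subseteq> V"
    using E assms(2) by (auto simp: set_plus_def intro: complex_vector.subspace_add)
  ultimately show ?thesis using that E by blast
qed

lemma fin_dim_from_kernel_image:
  assumes "T \<in> bounded_ops" "csubspace V" "fin_dim (T ` V)" "fin_dim {x \<in> V. T x = 0}"
  shows "fin_dim V"
  using kernel_complement[OF assms(1-3)] fin_dim_plus[OF assms(4)] by metis

text \<open>For \<open>b \<notin> V\<close> the coefficient of \<open>b\<close> in \<open>v + c b\<close> is bounded by the norm divided by the distance of
\<open>b\<close> from \<open>V\<close>. Along a convergent sequence the coefficients are therefore Cauchy, and the components in
\<open>V\<close> converge as well.\<close>

lemma closed_add_line:
  assumes V: "csubspace V" "closed V"
  shows "closed (V + cspan {b})"
proof (cases "b \<in> V")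
  case True
  have "V + cspan {b} = V"
  proof
    have "cspan {b} \<subseteq> V" using True V complex_vector.span_minimal by blast
    then show "V + cspan {b} \<subseteq> V" using V by (auto simp: set_plus_def intro: complex_vector.subspace_add)
    show "V \<subseteq> V + cspan {b}"
      using complex_vector.span_zero by (auto intro!: set_plusI[of _ _ 0])
  qed
  then show ?thesis using V by simp
next
  case False
  define \<delta> where "\<delta> = infdist b V"
  have ne: "V \<noteq> {}" using V complex_vector.subspace_0 by blast
  have pos: "\<delta> > 0" unfolding \<delta>_def using False V ne by (metis in_closed_iff_infdist_zero infdist_nonneg less_eq_real_def)
  have lower: "cmod c * \<delta> \<le> norm (v + c *\<^sub>C b)" if "v \<in> V" for v c
  proof (cases "c = 0")
    case False
    have "- (inverse c *\<^sub>C v) \<in> V" using that V complex_vector.subspace_scale complex_vector.subspace_neg by blast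
    then have "\<delta> \<le> dist b (- (inverse c *\<^sub>C v))" unfolding \<delta>_def by (rule infdist_le)
    also have "\<dots> = norm (inverse c *\<^sub>C (v + c *\<^sub>C b))"
      using False by (simp add: dist_norm scaleC_add_right scaleC_scaleC scaleC_one add.commute)
    also have "\<dots> = inverse (cmod c) * norm (v + c *\<^sub>C b)" by (simp add: norm_scaleC norm_inverse)
    finally show ?thesis using False by (simp add: field_simps)
  qed simp
  show ?thesis
  proof (unfold closed_sequential_limits, intro allI impI, elim conjE)
    fix x l assume x: "\<forall>n. x n \<in> V + cspan {b}" and l: "x \<longlonglongrightarrow> l"
    have "\<exists>v c. v \<in> V \<and> x n = v + c *\<^sub>C b" for n
      using x[rule_format, of n] by (auto simp: set_plus_def complex_vector.span_singleton)
    then obtain v c where vc: "\<And>n. v n \<in> V" "\<And>n. x n = v n + c n *\<^sub>C b" by metis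
    have "Cauchy x" using l LIMSEQ_imp_Cauchy by blast
    have "Cauchy c"
    proof (rule metric_CauchyI)
      fix e :: real assume "e > 0"
      then have "e * \<delta> > 0" using pos by simp
      then obtain N where N: "\<And>m n. m \<ge> N \<Longrightarrow> n \<ge> N \<Longrightarrow> dist (x m) (x n) < e * \<delta>"
        using \<open>Cauchy x\<close> metric_CauchyD by blast
      have "dist (c m) (c n) < e" if "m \<ge> N" "n \<ge> N" for m n
      proof -
        have "cmod (c m - c n) * \<delta> \<le> norm ((v m - v n) + (c m - c n) *\<^sub>C b)"
          using lower[of "v m - v n"] vc V complex_vector.subspace_diff by blast
        also have "\<dots> = dist (x m) (x n)"
          by (simp add: dist_norm vc complex_vector.scale_left_diff_distrib algebra_simps)
        also have "\<dots> < e * \<delta>" using N that by blast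
        finally show ?thesis using pos by (simp add: dist_norm)
      qed
      then show "\<exists>M. \<forall>m\<ge>M. \<forall>n\<ge>M. dist (c m) (c n) < e" by blast
    qed
    then obtain c0 where c0: "c \<longlonglongrightarrow> c0" using Cauchy_convergent convergent_def by blast
    have "(\<lambda>n. c n *\<^sub>C b) \<longlonglongrightarrow> c0 *\<^sub>C b"
    proof (rule Lim_null[THEN iffD2], rule tendsto_norm_zero_cancel)
      have "(\<lambda>n. cmod (c n - c0) * norm b) \<longlonglongrightarrow> 0"
        using c0 by (intro tendsto_mult_left_zero tendsto_norm_zero) (simp add: LIM_zero)
      then show "(\<lambda>n. norm (c n *\<^sub>C b - c0 *\<^sub>C b)) \<longlonglongrightarrow> 0"
        by (simp add: norm_scaleC complex_vector.scale_left_diff_distrib[symmetric])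
    qed
    then have "(\<lambda>n. x n - c n *\<^sub>C b) \<longlonglongrightarrow> l - c0 *\<^sub>C b" using l tendsto_diff by blast
    then have "v \<longlonglongrightarrow> l - c0 *\<^sub>C b" by (simp add: vc)
    then have "l - c0 *\<^sub>C b \<in> V" using V vc closed_sequentially by blast
    then show "l \<in> V + cspan {b}"
      by (rule set_plusI[of _ "l - c0 *\<^sub>C b" "c0 *\<^sub>C b", rotated])
        (auto simp: complex_vector.span_base complex_vector.span_scale)
  qed
qed

lemma closed_add_span:
  assumes V: "csubspace V" "closed V" and B: "finite B"
  shows "closed (V + cspan B)"
  using B
proof induction
  case empty
  have "V + {0} = V" by (simp add: set_plus_def)
  then show ?case using V by simp
next
  case (insert b B)
  have "cspan (insert b B) = cspan B + cspan {b}"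
    using complex_vector.span_Un[of B "{b}"] by (auto simp: set_plus_def)
  then have "V + cspan (insert b B) = (V + cspan B) + cspan {b}" by (simp add: add.assoc)
  then show ?case using closed_add_line[OF csubspace_plus[OF V(1) complex_vector.subspace_span] insert.IH] by simp
qed

lemma csubspace_fin_dim_span:
  assumes "csubspace E" "fin_dim E"
  obtains B where "finite B" "E = cspan B"
  using fin_dim_finite_basis[OF assms(2)] complex_vector.span_minimal assms(1)
  by (metis subset_antisym)

lemma closed_add_fin_dim:
  assumes "csubspace V" "closed V" "csubspace E" "fin_dim E"
  shows "closed (V + E)"
  using closed_add_span[OF assms(1,2)] csubspace_fin_dim_span[OF assms(3,4)] by metis

lemma closed_fin_dim:
  assumes "csubspace E" "fin_dim E"
  shows "closed E"
proof -
  have "{0} + E = E" by (simp add: set_plus_def)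
  then show ?thesis using closed_add_fin_dim[of "{0}" E] assms by simp
qed

section \<open>Open mappings and closed operator ranges\<close>

text \<open>The Baire half of the open mapping theorem: one of the closures of the images of balls has an
interior point in the closed, hence complete, image, and by symmetry \<open>0\<close> may be taken as the centre. The
conclusion is in the scaled form from which successive approximation starts.\<close>

lemma open_mapping_approx:
  fixes f :: "'b::banach \<Rightarrow> 'c::banach"
  assumes f: "bounded_linear f" and D: "subspace D" and cW: "closed (f ` D)"
  obtains C where "C > 0" "\<And>y. y \<in> f ` D \<Longrightarrow> \<exists>x\<in>D. norm x \<le> C * norm y \<and> norm (y - f x) \<le> norm y / 2"
proof -
  define W where "W = f ` D"
  define K where "K = (\<lambda>n::nat. closure (f ` (D \<inter> cball 0 (real n))))"
  have lin: "linear f" using f bounded_linear.linear by blast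
  have subW: "subspace W" unfolding W_def using lin D linear_subspace_image by blast
  have KW: "K n \<subseteq> W" for n
    unfolding K_def W_def using cW by (intro closure_minimal) auto
  have KU: "W \<subseteq> \<Union>(range K)"
  proof
    fix y assume "y \<in> W"
    then obtain x where x: "x \<in> D" "y = f x" unfolding W_def by blast
    obtain n where "norm x \<le> real n" using real_arch_simple by blast
    then have "y \<in> f ` (D \<inter> cball 0 (real n))" using x by simp
    then have "y \<in> K n" unfolding K_def by (rule subsetD[OF closure_subset])
    then show "y \<in> \<Union>(range K)" by blast
  qed
  have "\<exists>n. top_of_set W interior_of (K n) \<noteq> {}"
  proof (rule ccontr)
    assume "\<nexists>n. top_of_set W interior_of (K n) \<noteq> {}"
    then have emp: "\<And>n. top_of_set W interior_of (K n) = {}" by blast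
    have "top_of_set W interior_of \<Union>(range K) = {}"
    proof (rule Baire_category_alt)
      show "completely_metrizable_space (top_of_set W)
          \<or> locally_compact_space (top_of_set W) \<and> regular_space (top_of_set W)"
        using completely_metrizable_space_closedin[OF completely_metrizable_space_euclidean] cW
        unfolding W_def closed_closedin by blast
      show "closedin (top_of_set W) T \<and> top_of_set W interior_of T = {}" if T: "T \<in> range K" for T
      proof -
        obtain n where n: "T = K n" using T by blast
        have "closed (K n)" unfolding K_def by simp
        then have "closedin (top_of_set W) (K n)" using KW closed_subset by blast
        then show ?thesis using emp n by simp
      qed
    qed simp
    moreover have "\<Union>(range K) = topspace (top_of_set W)" using KU KW by auto
    ultimately have "W = {}" using interior_of_topspace[of "top_of_set W"] by simp
    then show False using subW subspace_0 by blast
  qed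
  then obtain n x0 where x0: "x0 \<in> top_of_set W interior_of (K n)" by blast
  then obtain U where U: "openin (top_of_set W) U" "x0 \<in> U" "U \<subseteq> K n"
    by (auto simp: interior_of_def)
  then obtain e where e: "e > 0" "\<And>y. y \<in> W \<Longrightarrow> dist y x0 < e \<Longrightarrow> y \<in> U" "x0 \<in> W"
    unfolding openin_euclidean_subtopology_iff by blast
  have imD: "\<exists>u. u \<in> D \<and> norm u \<le> real n \<and> dist (f u) y < \<delta>" if "y \<in> K n" "\<delta> > 0" for y \<delta>
    using that unfolding K_def closure_approachable by force
  have approx: "\<exists>x\<in>D. norm x \<le> 2 * real n \<and> norm (y - f x) < \<delta>"
    if y: "y \<in> W" "norm y < e" and \<delta>: "\<delta> > 0" for y \<delta>
  proof -
    have "y + x0 \<in> K n" using e(2)[of "y + x0"] y subW subspace_add e(3) U(3) by (auto simp: dist_norm)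
    then obtain u where u: "u \<in> D" "norm u \<le> real n" "dist (f u) (y + x0) < \<delta> / 2"
      using imD[OF _ half_gt_zero[OF \<delta>]] by blast
    have "x0 \<in> K n" using U by blast
    then obtain v where v: "v \<in> D" "norm v \<le> real n" "dist (f v) x0 < \<delta> / 2"
      using imD[OF _ half_gt_zero[OF \<delta>]] by blast
    have "u - v \<in> D" using u v D subspace_diff by blast
    moreover have "norm (u - v) \<le> 2 * real n" using u v norm_triangle_ineq4[of u v] by linarith
    moreover have "norm (y - f (u - v)) < \<delta>"
    proof -
      have "y - f (u - v) = (y + x0 - f u) + (f v - x0)" using lin by (simp add: linear_diff)
      then have "norm (y - f (u - v)) \<le> dist (f u) (y + x0) + dist (f v) x0"
        unfolding \<open>y - f (u - v) = _\<close> dist_norm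
        using norm_triangle_ineq[of "y + x0 - f u" "f v - x0"] norm_minus_commute[of "f u" "y + x0"] by argo
      then show ?thesis using u v by linarith
    qed
    ultimately show ?thesis by blast
  qed
  have "\<exists>x\<in>D. norm x \<le> (4 * real n / e + 1) * norm y \<and> norm (y - f x) \<le> norm y / 2" if y: "y \<in> W" for y
  proof (cases "y = 0")
    case True
    then show ?thesis using D subspace_0 lin by (intro bexI[of _ 0]) (auto simp: linear_0)
  next
    case False
    \<comment> \<open>Rescaled to norm \<open>e / 2\<close>, the vector lies well inside the neighbourhood where \<open>approx\<close> applies.\<close>
    define t where "t = e / (2 * norm y)"
    have t: "t > 0" using False e by (simp add: t_def)
    have "t *\<^sub>R y \<in> W" using y subW subspace_scale by blast
    moreover have "norm (t *\<^sub>R y) < e" using False e by (simp add: t_def)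
    ultimately obtain x where x: "x \<in> D" "norm x \<le> 2 * real n" "norm (t *\<^sub>R y - f x) < e / 4"
      using approx[of "t *\<^sub>R y" "e/4"] e by auto
    have "y - f (inverse t *\<^sub>R x) = inverse t *\<^sub>R (t *\<^sub>R y - f x)"
      using t lin by (simp add: linear_scale scaleR_diff_right)
    then have "norm (y - f (inverse t *\<^sub>R x)) \<le> inverse t * (e / 4)"
      using x(3) t by (simp add: mult_left_mono)
    also have "\<dots> = norm y / 2" using False e by (simp add: t_def field_simps)
    finally have 1: "norm (y - f (inverse t *\<^sub>R x)) \<le> norm y / 2" .
    have "norm (inverse t *\<^sub>R x) \<le> inverse t * (2 * real n)" using x(2) t by (simp add: mult_left_mono)
    also have "\<dots> = 4 * real n / e * norm y" using False e by (simp add: t_def field_simps)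
    also have "\<dots> \<le> (4 * real n / e + 1) * norm y" by (simp add: algebra_simps)
    finally show ?thesis using 1 x(1) D subspace_scale by blast
  qed
  moreover have "4 * real n / e + 1 > 0" using e by (simp add: add_nonneg_pos)
  ultimately show ?thesis using that unfolding W_def by blast
qed

text \<open>Applying the approximate solution repeatedly to the remaining errors, which are halved in every step,
yields an absolutely convergent series of solutions. Only the closed subspace \<open>D\<close> of the domain
is used, which avoids types for subspaces and their quotients.\<close>

theorem open_mapping_bound:
  fixes f :: "'b::banach \<Rightarrow> 'c::banach"
  assumes f: "bounded_linear f" and D: "subspace D" "closed D" and cW: "closed (f ` D)"
  obtains C where "C > 0" "\<And>y. y \<in> f ` D \<Longrightarrow> \<exists>x\<in>D. f x = y \<and> norm x \<le> C * norm y"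
proof -
  interpret f: bounded_linear f by fact
  obtain C where C: "C > 0"
      "\<And>y. y \<in> f ` D \<Longrightarrow> \<exists>x\<in>D. norm x \<le> C * norm y \<and> norm (y - f x) \<le> norm y / 2"
    using open_mapping_approx[OF f D(1) cW] by metis
  then obtain g where g: "\<And>y. y \<in> f ` D \<Longrightarrow> g y \<in> D \<and> norm (g y) \<le> C * norm y \<and> norm (y - f (g y)) \<le> norm y / 2"
    by metis
  have subW: "subspace (f ` D)" using D f.linear linear_subspace_image by blast
  have "\<exists>x\<in>D. f x = y \<and> norm x \<le> (C * 2) * norm y" if y: "y \<in> f ` D" for y
  proof -
    define r where "r = (\<lambda>k. ((\<lambda>y. y - f (g y)) ^^ k) y)"
    define x where "x = (\<lambda>k. g (r k))"
    have r0: "r 0 = y" and rS: "\<And>k. r (Suc k) = r k - f (x k)" by (simp_all add: r_def x_def)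
    have rW: "r k \<in> f ` D \<and> norm (r k) \<le> norm y * (1/2)^k" for k
    proof (induction k)
      case 0 then show ?case using y by (simp add: r0)
    next
      case (Suc k)
      then have "r (Suc k) \<in> f ` D" unfolding rS x_def using g subW subspace_diff by blast
      moreover have "norm (r (Suc k)) \<le> norm (r k) / 2" unfolding rS x_def using g Suc by blast
      ultimately show ?case using Suc by simp
    qed
    have xD: "x k \<in> D" for k unfolding x_def using g rW by blast
    have xn: "norm (x k) \<le> C * norm y * (1/2)^k" for k
    proof -
      have "norm (x k) \<le> C * norm (r k)" unfolding x_def using g rW by blast
      also have "\<dots> \<le> C * (norm y * (1/2)^k)" using rW C by (simp add: mult_left_mono)
      finally show ?thesis by simp
    qed
    have sg: "summable (\<lambda>k. C * norm y * (1/2::real)^k)" by (intro summable_mult summable_geometric) simp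
    have sn: "summable (\<lambda>k. norm (x k))" using xn by (intro summable_comparison_test[OF _ sg]) simp
    then have sx: "summable x" using summable_norm_cancel by blast
    have "norm (suminf x) \<le> (\<Sum>k. norm (x k))" using sn summable_norm by blast
    also have "\<dots> \<le> (\<Sum>k. C * norm y * (1/2)^k)" using xn sn sg by (intro suminf_le) auto
    also have "\<dots> = C * norm y * 2" using suminf_mult[of "\<lambda>k. (1/2::real)^k" "C * norm y"] suminf_geometric[of "1/2::real"]
      by (simp add: summable_geometric)
    finally have n: "norm (suminf x) \<le> C * 2 * norm y" by (simp add: mult_ac)
    have lim: "(\<lambda>n. \<Sum>k<n. x k) \<longlonglongrightarrow> suminf x" using sx summable_LIMSEQ by blast
    have "(\<Sum>k<n. x k) \<in> D" for n by (intro subspace_sum[OF D(1)] xD)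
    then have sD: "suminf x \<in> D" by (rule closed_sequentially[OF D(2) _ lim])
    have feq: "f (\<Sum>k<n. x k) = y - r n" for n
      by (induction n) (simp_all add: r0 rS f.add f.zero)
    have "r \<longlonglongrightarrow> 0"
    proof (rule Lim_null_comparison)
      show "\<forall>\<^sub>F k in sequentially. norm (r k) \<le> norm y * (1/2)^k" using rW by simp
      show "(\<lambda>k. norm y * (1/2::real)^k) \<longlonglongrightarrow> 0" by (intro tendsto_mult_right_zero LIMSEQ_power_zero) simp
    qed
    then have "(\<lambda>n. f (\<Sum>k<n. x k)) \<longlonglongrightarrow> y"
      unfolding feq using tendsto_diff[OF tendsto_const[of y], of r 0] by simp
    moreover have "(\<lambda>n. f (\<Sum>k<n. x k)) \<longlonglongrightarrow> f (suminf x)" by (rule f.tendsto[OF lim])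
    ultimately have "f (suminf x) = y" using LIMSEQ_unique by blast
    then show ?thesis using sD n by blast
  qed
  then show ?thesis using that[of "C * 2"] C by auto
qed

text \<open>The open mapping theorem for \<open>(u, w) \<mapsto> A u + w\<close> on \<open>D \<times> K\<close>. With this map, a quotient modulo \<open>K\<close> need
not be formed.\<close>

lemma sum_decomposition_bound:
  assumes A: "A \<in> bounded_ops" and D: "csubspace D" "closed D" and K: "csubspace K" "closed K"
    and cl: "closed (A ` D + K)"
  obtains C where "C > 0"
    "\<And>y. y \<in> A ` D + K \<Longrightarrow> \<exists>u\<in>D. \<exists>w\<in>K. y = A u + w \<and> norm u \<le> C * norm y \<and> norm w \<le> C * norm y"
proof -
  define f where "f = (\<lambda>p. A (fst p) + snd p)"
  have f: "bounded_linear f" unfolding f_def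
    using bounded_linear_compose[OF bounded_ops_bounded_linear[OF A] bounded_linear_fst]
    by (intro bounded_linear_add bounded_linear_snd)
  have im: "f ` (D \<times> K) = A ` D + K" by (force simp: f_def set_plus_def)
  have "subspace (D \<times> K)"
    using D K csubspace_real subspace_Times by blast
  moreover have "closed (D \<times> K)" using D K closed_Times by blast
  ultimately obtain C where C: "C > 0" "\<And>y. y \<in> A ` D + K \<Longrightarrow> \<exists>p\<in>D \<times> K. f p = y \<and> norm p \<le> C * norm y"
    using open_mapping_bound[OF f] cl im by metis
  have "\<exists>u\<in>D. \<exists>w\<in>K. y = A u + w \<and> norm u \<le> C * norm y \<and> norm w \<le> C * norm y" if y: "y \<in> A ` D + K" for y
  proof -
    obtain u w where "u \<in> D" "w \<in> K" "f (u, w) = y" "norm (u, w) \<le> C * norm y"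
      using C(2)[OF y] by blast
    moreover have "norm u \<le> norm (u, w)" "norm w \<le> norm (u, w)"
      by (rule norm_fst_le, rule norm_snd_le)
    moreover have "y = A u + w" using \<open>f (u, w) = y\<close> by (simp add: f_def)
    ultimately show ?thesis by (intro bexI[of _ u] bexI[of _ w]) auto
  qed
  then show ?thesis using that C by blast
qed

text \<open>A limit of vectors of \<open>A D\<close> can be written as \<open>A x0 + k\<close> with \<open>k \<in> K\<close>. The differences from the limit
have small components in \<open>K\<close>, so \<open>k\<close> is a limit of vectors of \<open>A D \<inter> K\<close> and lies in \<open>A D\<close>
itself. Most closed range statements below are instances of this observation, with \<open>K\<close> a kernel or
a finite-dimensional space.\<close>

lemma closed_image_if_closed_sum:
  assumes A: "A \<in> bounded_ops" and D: "csubspace D" "closed D" and K: "csubspace K" "closed K"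
    and cl: "closed (A ` D + K)" and int: "closed (A ` D \<inter> K)"
  shows "closed (A ` D)"
proof (unfold closed_sequential_limits, intro allI impI, elim conjE)
  fix y l assume y: "\<forall>n. y n \<in> A ` D" and l: "y \<longlonglongrightarrow> l"
  obtain C where C: "C > 0"
    "\<And>y. y \<in> A ` D + K \<Longrightarrow> \<exists>u\<in>D. \<exists>w\<in>K. y = A u + w \<and> norm u \<le> C * norm y \<and> norm w \<le> C * norm y"
    using sum_decomposition_bound[OF assms(1-6)] by metis
  have "\<forall>n. \<exists>x. x \<in> D \<and> y n = A x" using y by blast
  then obtain x where x: "\<And>n. x n \<in> D" "\<And>n. y n = A (x n)" by metis
  have incl: "A ` D \<subseteq> A ` D + K" using complex_vector.subspace_0[OF K(1)] by (auto intro!: set_plusI[of _ _ 0])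
  then have "l \<in> A ` D + K" using y by (intro closed_sequentially[OF cl _ l]) blast
  then obtain x0 k where xk: "x0 \<in> D" "k \<in> K" "l = A x0 + k" by (auto elim: set_plusE)
  have sub: "csubspace (A ` D + K)" using A D K csubspace_image csubspace_plus by blast
  have "y n - l \<in> A ` D + K" for n
    using complex_vector.subspace_diff[OF sub] incl y \<open>l \<in> A ` D + K\<close> by blast
  then have "\<exists>u\<in>D. \<exists>w\<in>K. y n - l = A u + w \<and> norm u \<le> C * norm (y n - l) \<and> norm w \<le> C * norm (y n - l)" for n
    using C(2) by blast
  then obtain u w where uw: "\<And>n. u n \<in> D" "\<And>n. w n \<in> K" "\<And>n. y n - l = A (u n) + w n"
      "\<And>n. norm (w n) \<le> C * norm (y n - l)" by metis
  have eq: "A (x n - x0 - u n) = k + w n" for n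
    using uw(3)[of n] x(2)[of n] xk(3) A by (simp add: bounded_ops_simps algebra_simps)
  have "k + w n \<in> A ` D \<inter> K" for n
    unfolding Int_iff
    by (metis eq imageI D(1) K(1) x(1) uw(1,2) xk(1,2) complex_vector.subspace_diff complex_vector.subspace_add)
  moreover have "w \<longlonglongrightarrow> 0"
  proof (rule Lim_null_comparison)
    show "\<forall>\<^sub>F n in sequentially. norm (w n) \<le> C * norm (y n - l)" using uw by simp
    show "(\<lambda>n. C * norm (y n - l)) \<longlonglongrightarrow> 0"
      using l by (intro tendsto_mult_right_zero tendsto_norm_zero) (simp add: LIM_zero)
  qed
  then have lk: "(\<lambda>n. k + w n) \<longlonglongrightarrow> k" using tendsto_add[OF tendsto_const[of k], of w 0] by simp
  ultimately have "k \<in> A ` D \<inter> K" by (intro closed_sequentially[OF int _ lk])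
  then show "l \<in> A ` D"
    using xk complex_vector.subspace_add[OF csubspace_image[OF A D(1)]] by blast
qed

lemma closed_image_if_fin_dim_Int:
  assumes A: "A \<in> bounded_ops" and D: "csubspace D" "closed D" and K: "csubspace K" "closed K"
    and cl: "closed (A ` D + K)" and int: "fin_dim (A ` D \<inter> K)"
  shows "closed (A ` D)"
  using closed_image_if_closed_sum[OF assms(1-6)] closed_fin_dim[OF _ int] complex_vector.subspace_inter
    csubspace_image[OF A D(1)] K(1) by blast

lemma closed_image_if_fin_codim:
  assumes A: "A \<in> bounded_ops" and D: "csubspace D" "closed D" and E: "csubspace E" "fin_dim E"
    and cl: "closed (A ` D + E)"
  shows "closed (A ` D)"
  using closed_image_if_fin_dim_Int[OF A D E(1) closed_fin_dim[OF E] cl] E fin_dim_subset by blast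

text \<open>On \<open>D\<close> the operator \<open>A\<close> is upper semi-Fredholm. Solutions of \<open>A u = y\<close> depend boundedly on \<open>y\<close> up to the
finite-dimensional kernel \<open>E\<close>, and \<open>W + E\<close> is still closed.\<close>

lemma closed_image_closed_subspace:
  assumes A: "A \<in> bounded_ops" and D: "csubspace D" "closed D" "closed (A ` D)"
    and ker: "fin_dim {x \<in> D. A x = 0}" and W: "csubspace W" "closed W" "W \<subseteq> D"
  shows "closed (A ` W)"
proof (unfold closed_sequential_limits, intro allI impI, elim conjE)
  fix y l assume y: "\<forall>n. y n \<in> A ` W" and l: "y \<longlonglongrightarrow> l"
  define E where "E = {x \<in> D. A x = 0}"
  have E: "csubspace E" "fin_dim E" unfolding E_def using csubspace_kernel[OF A D(1)] ker by auto
  have cWE: "closed (W + E)" using closed_add_fin_dim[OF W(1,2) E] .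
  obtain C where C: "C > 0" "\<And>y. y \<in> A ` D \<Longrightarrow> \<exists>x\<in>D. A x = y \<and> norm x \<le> C * norm y"
    using open_mapping_bound[OF bounded_ops_bounded_linear[OF A] csubspace_real[OF D(1)] D(2,3)] by metis
  have "\<forall>n. y n \<in> A ` D" using y W(3) by blast
  then have lD: "l \<in> A ` D" by (intro closed_sequentially[OF D(3) _ l]) blast
  then obtain x0 where x0: "x0 \<in> D" "l = A x0" by blast
  have "\<forall>n. \<exists>w. w \<in> W \<and> y n = A w" using y by blast
  then obtain w where w: "\<And>n. w n \<in> W" "\<And>n. y n = A (w n)" by metis
  have "y n - l \<in> A ` D" for n
    using complex_vector.subspace_diff[OF csubspace_image[OF A D(1)] _ lD] w W(3) by blast
  then have "\<forall>n. \<exists>u. u \<in> D \<and> A u = y n - l \<and> norm u \<le> C * norm (y n - l)" using C(2) by blast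
  then obtain u where u: "\<And>n. u n \<in> D" "\<And>n. A (u n) = y n - l" "\<And>n. norm (u n) \<le> C * norm (y n - l)"
    by metis
  have "x0 + u n \<in> W + E" for n
  proof (rule set_plusI[of _ "w n" "x0 + u n - w n"])
    have "x0 + u n - w n \<in> D"
      using x0 u(1) w(1) W(3) by (auto intro!: complex_vector.subspace_diff complex_vector.subspace_add D(1))
    then show "x0 + u n - w n \<in> E" unfolding E_def using x0(2) u(2) w(2) A by (simp add: bounded_ops_simps)
  qed (use w in auto)
  moreover have "u \<longlonglongrightarrow> 0"
  proof (rule Lim_null_comparison)
    show "\<forall>\<^sub>F n in sequentially. norm (u n) \<le> C * norm (y n - l)" using u by simp
    show "(\<lambda>n. C * norm (y n - l)) \<longlonglongrightarrow> 0"
      using l by (intro tendsto_mult_right_zero tendsto_norm_zero) (simp add: LIM_zero)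
  qed
  then have lim: "(\<lambda>n. x0 + u n) \<longlonglongrightarrow> x0" using tendsto_add[OF tendsto_const[of x0], of u 0] by simp
  ultimately have "x0 \<in> W + E" by (intro closed_sequentially[OF cWE _ lim])
  then obtain a e where ae: "a \<in> W" "e \<in> E" "x0 = a + e" by (rule set_plusE)
  then have "l = A a" using x0 A by (simp add: E_def bounded_ops_simps)
  then show "l \<in> A ` W" using ae by blast
qed

section \<open>Finite codimension\<close>

text \<open>For \<open>U \<subseteq> V\<close> this is finiteness of the dimension of \<open>V / U\<close>. Without requiring \<open>U \<subseteq> V\<close>, nor
\<open>E \<subseteq> V\<close>, the relation is transitive and monotone without side conditions.\<close>

definition fin_codim :: "'a::complex_banach set \<Rightarrow> 'a set \<Rightarrow> bool" where
  "fin_codim V U \<longleftrightarrow> (\<exists>E. csubspace E \<and> fin_dim E \<and> V \<subseteq> U + E)"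

lemma fin_codim_superset: "csubspace U \<Longrightarrow> V \<subseteq> U \<Longrightarrow> fin_codim V U"
  unfolding fin_codim_def
  by (rule exI[of _ "{0}"]) (auto simp: fin_dim_zero complex_vector.subspace_single_0 set_plus_def)

lemma fin_codim_trans:
  assumes "fin_codim V U" "fin_codim U W"
  shows "fin_codim V W"
proof -
  obtain E E' where E: "csubspace E" "fin_dim E" "V \<subseteq> U + E" "csubspace E'" "fin_dim E'" "U \<subseteq> W + E'"
    using assms unfolding fin_codim_def by blast
  have "V \<subseteq> (W + E') + E" using E(3,6) set_plus_mono2[of U "W + E'" E E] by blast
  then have "V \<subseteq> W + (E' + E)" by (simp add: add.assoc)
  then show ?thesis
    unfolding fin_codim_def using E csubspace_plus[of E' E] fin_dim_plus[of E' E] by blast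
qed

lemma fin_codim_subset: "fin_codim V U \<Longrightarrow> V' \<subseteq> V \<Longrightarrow> fin_codim V' U"
  unfolding fin_codim_def by blast

lemma fin_codim_image:
  assumes "fin_codim V U" "A \<in> bounded_ops"
  shows "fin_codim (A ` V) (A ` U)"
proof -
  obtain E where E: "csubspace E" "fin_dim E" "V \<subseteq> U + E" using assms unfolding fin_codim_def by blast
  have "A ` V \<subseteq> A ` U + A ` E"
  proof
    fix y assume "y \<in> A ` V"
    then obtain x where "x \<in> V" "y = A x" by blast
    moreover then obtain u e where "u \<in> U" "e \<in> E" "x = u + e" using E(3) by (meson set_plusE subsetD)
    ultimately show "y \<in> A ` U + A ` E"
      using assms(2) by (intro set_plusI[of _ "A u" "A e"]) (auto simp: bounded_ops_simps)
  qed
  then show ?thesis unfolding fin_codim_def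
    using E csubspace_image[OF assms(2)] fin_dim_image[OF assms(2)] by blast
qed

lemma fin_codim_complement:
  assumes "fin_codim V U" "csubspace U" "csubspace V" "U \<subseteq> V"
  obtains E where "csubspace E" "fin_dim E" "V = U + E"
proof -
  obtain E where E: "csubspace E" "fin_dim E" "V \<subseteq> U + E" using assms unfolding fin_codim_def by blast
  have "V \<subseteq> U + (E \<inter> V)"
  proof
    fix v assume v: "v \<in> V"
    then obtain u e where ue: "u \<in> U" "e \<in> E" "v = u + e" using E(3) by (meson set_plusE subsetD)
    then have "e = v - u" by simp
    then have "e \<in> V" using v ue assms complex_vector.subspace_diff by blast
    then show "v \<in> U + (E \<inter> V)" using ue by (intro set_plusI[of _ u e]) auto
  qed
  moreover have "U + (E \<inter> V) \<subseteq> V"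
    using assms(3,4) by (auto simp: set_plus_def intro!: complex_vector.subspace_add)
  moreover have "csubspace (E \<inter> V)" using E assms complex_vector.subspace_inter by blast
  moreover have "fin_dim (E \<inter> V)" using E(2) fin_dim_subset by blast
  ultimately show ?thesis using that by blast
qed

lemma cspan_Un_csubspace:
  assumes "csubspace U"
  shows "cspan (U \<union> B) = U + cspan B"
proof -
  have "cspan U = U" using assms by (simp add: complex_vector.span_eq_iff)
  then show ?thesis unfolding complex_vector.span_Un by (simp only:) (auto simp: set_plus_def)
qed

lemma ecodim_finite_iff:
  assumes "csubspace U" "csubspace V" "U \<subseteq> V"
  shows "ecodim V U < \<infinity> \<longleftrightarrow> fin_codim V U"
proof
  assume "ecodim V U < \<infinity>"
  then have "{enat (card B) |B. finite B \<and> B \<subseteq> V \<and> V \<subseteq> cspan (U \<union> B)} \<noteq> {}"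
    unfolding ecodim_def by (metis (lifting) Inf_enat_def less_irrefl)
  then obtain B where B: "finite B" "V \<subseteq> cspan (U \<union> B)" by blast
  have "cspan (U \<union> B) = U + cspan B"
    by (rule cspan_Un_csubspace[OF assms(1)])
  then show "fin_codim V U" unfolding fin_codim_def using B fin_dim_span by (metis complex_vector.subspace_span)
next
  assume "fin_codim V U"
  then obtain E where E: "csubspace E" "fin_dim E" "V = U + E"
    using fin_codim_complement assms by metis
  obtain B where B: "finite B" "E = cspan B" using csubspace_fin_dim_span[OF E(1,2)] .
  have "cspan (U \<union> B) = U + cspan B"
    by (rule cspan_Un_csubspace[OF assms(1)])
  moreover have "B \<subseteq> V"
  proof
    fix b assume "b \<in> B"
    then show "b \<in> V" unfolding E(3)
      using complex_vector.subspace_0[OF assms(1)] B complex_vector.span_base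
      by (intro set_plusI[of _ 0 b]) auto
  qed
  ultimately have "enat (card B) \<in> {enat (card B) |B. finite B \<and> B \<subseteq> V \<and> V \<subseteq> cspan (U \<union> B)}"
    using B E by blast
  then have "ecodim V U \<le> enat (card B)" unfolding ecodim_def by (rule Inf_lower)
  then show "ecodim V U < \<infinity>" using enat_ord_simps(4) le_less_trans by blast
qed

section \<open>Ranges of the powers of an operator\<close>

definition semi_upper :: "'a::complex_banach set \<Rightarrow> ('a \<Rightarrow> 'a) \<Rightarrow> bool" where
  "semi_upper M A \<longleftrightarrow> (\<exists>k. fin_dim {x \<in> (A ^^ k) ` M. A x = 0} \<and> closed ((A ^^ Suc k) ` M))"

definition semi_lower :: "'a::complex_banach set \<Rightarrow> ('a \<Rightarrow> 'a) \<Rightarrow> bool" where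
  "semi_lower M A \<longleftrightarrow> (\<exists>k. fin_codim ((A ^^ k) ` M) ((A ^^ Suc k) ` M) \<and> closed ((A ^^ k) ` M))"

definition finite_ascent :: "'a::complex_banach set \<Rightarrow> ('a \<Rightarrow> 'a) \<Rightarrow> bool" where
  "finite_ascent M A \<longleftrightarrow> (\<exists>k. \<forall>x \<in> (A ^^ k) ` M. A x = 0 \<longrightarrow> x = 0)"

definition finite_descent :: "'a::complex_banach set \<Rightarrow> ('a \<Rightarrow> 'a) \<Rightarrow> bool" where
  "finite_descent M A \<longleftrightarrow> (\<exists>k. (A ^^ k) ` M = (A ^^ Suc k) ` M)"

locale invariant_operator =
  fixes M :: "'a::complex_banach set" and A :: "'a \<Rightarrow> 'a"
  assumes bounded: "A \<in> bounded_ops" and csub_M: "csubspace M" and closed_M: "closed M"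
    and invariant: "x \<in> M \<Longrightarrow> A x \<in> M"
begin

abbreviation V :: "nat \<Rightarrow> 'a set" where
  "V j \<equiv> (A ^^ j) ` M"

lemma pow_bounded: "A ^^ j \<in> bounded_ops"
  by (rule bounded_ops_funpow[OF bounded])

lemma pow_invariant: "x \<in> M \<Longrightarrow> (A ^^ j) x \<in> M"
  by (induction j) (auto simp: invariant)

lemma csub_V: "csubspace (V j)"
  by (rule csubspace_image[OF pow_bounded csub_M])

lemma pow_image_V: "(A ^^ i) ` V j = V (i + j)"
  by (simp add: funpow_add image_comp)

lemma image_V: "A ` V j = V (Suc j)"
  by (simp add: image_comp)

lemma V_sub_M: "V j \<subseteq> M"
  using pow_invariant by blast

lemma V_Suc: "V (Suc j) \<subseteq> V j"
proof -
  have "V (Suc j) = (A ^^ j) ` (A ` M)" by (simp only: funpow_Suc_right image_comp)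
  then show ?thesis using invariant by (auto simp del: funpow.simps)
qed

lemma V_antimono: "i \<le> j \<Longrightarrow> V j \<subseteq> V i"
  using lift_Suc_antimono_le[of V, OF V_Suc] by blast

lemma kernel_antimono: "i \<le> j \<Longrightarrow> {x \<in> V j. A x = 0} \<subseteq> {x \<in> V i. A x = 0}"
  using V_antimono by blast

text \<open>Closedness of a range can thus be carried over to preimages: if \<open>V (i + j)\<close> is closed, so is the sum
on the left, by continuity.\<close>

lemma V_plus_kernel: "V j + {x \<in> M. (A ^^ i) x = 0} = {x \<in> M. (A ^^ i) x \<in> V (i + j)}"
proof (intro equalityI subsetI)
  fix x assume "x \<in> V j + {x \<in> M. (A ^^ i) x = 0}"
  then obtain a b where ab: "a \<in> V j" "b \<in> M" "(A ^^ i) b = 0" "x = a + b" by (rule set_plusE) blast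
  then have "(A ^^ i) x = (A ^^ i) a" by (simp add: bounded_ops_simps[OF pow_bounded])
  moreover have "(A ^^ i) a \<in> V (i + j)" using ab(1) pow_image_V[of i j] by blast
  moreover have "x \<in> M" using ab V_sub_M complex_vector.subspace_add[OF csub_M] by blast
  ultimately show "x \<in> {x \<in> M. (A ^^ i) x \<in> V (i + j)}" by simp
next
  fix x assume x: "x \<in> {x \<in> M. (A ^^ i) x \<in> V (i + j)}"
  then obtain a where a: "a \<in> V j" "(A ^^ i) x = (A ^^ i) a" using pow_image_V[of i j] by auto
  then have "x - a \<in> {x \<in> M. (A ^^ i) x = 0}"
    using x V_sub_M complex_vector.subspace_diff[OF csub_M] by (auto simp: bounded_ops_simps[OF pow_bounded])
  then show "x \<in> V j + {x \<in> M. (A ^^ i) x = 0}" using a by (intro set_plusI[of _ a "x - a"]) auto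
qed

lemma closed_V_down:
  assumes "closed (V (Suc j))" "fin_dim {x \<in> V j. A x = 0}"
  shows "closed (V j)"
proof (rule closed_image_if_fin_dim_Int[OF pow_bounded csub_M closed_M])
  show "csubspace {x \<in> M. A x = 0}" "closed {x \<in> M. A x = 0}"
    using csubspace_kernel closed_kernel bounded csub_M closed_M by blast+
  show "closed (V j + {x \<in> M. A x = 0})"
    using V_plus_kernel[of j 1] closed_preimage[OF bounded closed_M assms(1)] by simp
  show "fin_dim (V j \<inter> {x \<in> M. A x = 0})" using assms(2) by (rule fin_dim_subset) blast
qed

lemma closed_V_up:
  assumes "closed (V j)" "closed (V (Suc j))" "fin_dim {x \<in> V j. A x = 0}"
  shows "closed (V (Suc (Suc j)))"
  using closed_image_closed_subspace[OF bounded csub_V assms(1) _ assms(3) csub_V assms(2) V_Suc] assms(2)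
  unfolding image_V by blast

text \<open>Closedness of \<open>V (Suc k)\<close> passes to \<open>V k\<close> by \<open>closed_V_down\<close>, and from these two spaces to all later
ranges by \<open>closed_V_up\<close>; the kernels only shrink.\<close>

lemma semi_upper_iff:
  "semi_upper M A \<longleftrightarrow> (\<exists>k. \<forall>j\<ge>k. fin_dim {x \<in> V j. A x = 0} \<and> closed (V j))"
proof
  assume "semi_upper M A"
  then obtain k where k: "fin_dim {x \<in> V k. A x = 0}" "closed (V (Suc k))" unfolding semi_upper_def by blast
  have fd: "fin_dim {x \<in> V j. A x = 0}" if "k \<le> j" for j
    using fin_dim_subset[OF k(1) kernel_antimono[OF that]] .
  have "closed (V (k + i)) \<and> closed (V (Suc (k + i)))" for i
  proof (induction i)
    case 0
    then show ?case using k closed_V_down by simp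
  next
    case (Suc i)
    then show ?case using closed_V_up[of "k + i"] fd[of "k + i"] by simp
  qed
  then have "closed (V j)" if "k \<le> j" for j using that by (metis le_Suc_ex)
  then show "\<exists>k. \<forall>j\<ge>k. fin_dim {x \<in> V j. A x = 0} \<and> closed (V j)" using fd by blast
next
  assume "\<exists>k. \<forall>j\<ge>k. fin_dim {x \<in> V j. A x = 0} \<and> closed (V j)"
  then show "semi_upper M A" unfolding semi_upper_def by (metis le_SucI order_refl)
qed

lemma fin_codim_V_Suc:
  assumes "fin_codim (V k) (V (Suc k))" "k \<le> j"
  shows "fin_codim (V j) (V (Suc j))"
proof -
  have "fin_codim ((A ^^ (j - k)) ` V k) ((A ^^ (j - k)) ` V (Suc k))"
    using fin_codim_image[OF assms(1) pow_bounded] .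
  then show ?thesis using assms(2) unfolding pow_image_V by simp
qed

lemma fin_codim_V:
  assumes "fin_codim (V k) (V (Suc k))" "k \<le> j"
  shows "fin_codim (V k) (V j)"
  using assms(2)
proof (induction j rule: dec_induct)
  case base
  then show ?case using fin_codim_superset[OF csub_V] by blast
next
  case (step j)
  then show ?case using fin_codim_trans fin_codim_V_Suc[OF assms(1)] by blast
qed

text \<open>Adding a finite-dimensional space preserves closedness, and an operator range with a
finite-dimensional complement in a closed space is closed.\<close>

lemma closed_V_fin_codim:
  assumes "fin_codim (V i) (V j)" "i \<le> j"
  shows "closed (V i) \<longleftrightarrow> closed (V j)"
proof -
  obtain E where E: "csubspace E" "fin_dim E" "V i = V j + E"
    using fin_codim_complement[OF assms(1) csub_V csub_V V_antimono[OF assms(2)]] by metis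
  then show ?thesis
    using closed_image_if_fin_codim[OF pow_bounded csub_M closed_M E(1,2), of j]
      closed_add_fin_dim[OF csub_V _ E(1,2), of j] by auto
qed

lemma semi_lower_iff:
  "semi_lower M A \<longleftrightarrow> (\<exists>k. \<forall>j\<ge>k. fin_codim (V k) (V j) \<and> closed (V j))"
proof
  assume "semi_lower M A"
  then obtain k where "fin_codim (V k) (V (Suc k))" "closed (V k)" unfolding semi_lower_def by blast
  then show "\<exists>k. \<forall>j\<ge>k. fin_codim (V k) (V j) \<and> closed (V j)"
    using fin_codim_V closed_V_fin_codim by blast
next
  assume "\<exists>k. \<forall>j\<ge>k. fin_codim (V k) (V j) \<and> closed (V j)"
  then show "semi_lower M A" unfolding semi_lower_def by (metis le_SucI order_refl)
qed

lemma kernel_trivial_pow: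
  assumes "\<forall>x \<in> V k. A x = 0 \<longrightarrow> x = 0" "x \<in> V k" "(A ^^ i) x = 0"
  shows "x = 0"
  using assms(3)
proof (induction i)
  case (Suc i)
  have "(A ^^ i) x \<in> V k" using assms(2) pow_image_V[of i k] V_antimono[of k "i + k"] by (metis imageI le_add2 subsetD)
  moreover have "A ((A ^^ i) x) = 0" using Suc.prems by simp
  ultimately have "(A ^^ i) x = 0" using assms(1) by blast
  then show ?case by (rule Suc.IH)
qed simp

lemma fin_dim_kernel_pow:
  assumes "fin_dim {x \<in> V k. A x = 0}"
  shows "fin_dim {x \<in> V k. (A ^^ i) x = 0}"
proof (induction i)
  case 0
  then show ?case using fin_dim_zero fin_dim_subset by (metis (mono_tags, lifting) funpow_0 mem_Collect_eq singletonI subsetI)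
next
  case (Suc i)
  let ?K = "{x \<in> V k. (A ^^ Suc i) x = 0}"
  have inV: "(A ^^ i) x \<in> V k" if "x \<in> V k" for x
    using that pow_image_V[of i k] V_antimono[of k "i + k"] by (metis imageI le_add2 subsetD)
  show ?case
  proof (rule fin_dim_from_kernel_image[OF pow_bounded[of i]])
    show "csubspace ?K" by (rule csubspace_kernel[OF pow_bounded csub_V])
    show "fin_dim ((A ^^ i) ` ?K)" using inV by (intro fin_dim_subset[OF assms]) auto
    show "fin_dim {x \<in> ?K. (A ^^ i) x = 0}" by (rule fin_dim_subset[OF Suc]) auto
  qed
qed

lemma descent_stable:
  assumes "V k = V (Suc k)" "k \<le> j"
  shows "V j = V k"
  using assms(2)
proof (induction j rule: dec_induct)
  case (step j)
  then have "V (Suc j) = V (Suc k)" using image_V by metis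
  then show ?case using assms(1) by simp
qed simp

lemma ascent_descent_decomposition:
  assumes "\<forall>x \<in> V k. A x = 0 \<longrightarrow> x = 0" "V k = V (Suc k)"
  shows "V k + {x \<in> M. (A ^^ k) x = 0} = M" "V k \<inter> {x \<in> M. (A ^^ k) x = 0} = {0}"
proof -
  show "V k + {x \<in> M. (A ^^ k) x = 0} = M"
    unfolding V_plus_kernel using descent_stable[OF assms(2), of "k + k"] pow_invariant by auto
  show "V k \<inter> {x \<in> M. (A ^^ k) x = 0} = {0}"
    using kernel_trivial_pow[OF assms(1)] complex_vector.subspace_0[OF csub_V] complex_vector.subspace_0[OF csub_M]
      bounded_ops_zero[OF pow_bounded] by blast
qed

text \<open>The range \<open>V k\<close> has the closed complement \<open>ker A\<^sup>k\<close> in \<open>M\<close>.\<close>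

lemma closed_V_ascent_descent:
  assumes "\<forall>x \<in> V k. A x = 0 \<longrightarrow> x = 0" "V k = V (Suc k)"
  shows "closed (V k)"
proof (rule closed_image_if_fin_dim_Int[OF pow_bounded csub_M closed_M])
  show "csubspace {x \<in> M. (A ^^ k) x = 0}" "closed {x \<in> M. (A ^^ k) x = 0}"
    using csubspace_kernel closed_kernel pow_bounded csub_M closed_M by blast+
  show "closed (V k + {x \<in> M. (A ^^ k) x = 0})"
    using ascent_descent_decomposition[OF assms] closed_M by simp
  show "fin_dim (V k \<inter> {x \<in> M. (A ^^ k) x = 0})"
    using ascent_descent_decomposition[OF assms] fin_dim_zero by simp
qed

lemma ascent_descent_common:
  assumes "finite_ascent M A" "finite_descent M A"
  obtains k where "\<And>j. k \<le> j \<Longrightarrow> V j = V k" "\<forall>x \<in> V k. A x = 0 \<longrightarrow> x = 0"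
proof -
  obtain a where a: "\<forall>x \<in> V a. A x = 0 \<longrightarrow> x = 0"
    using assms(1) unfolding finite_ascent_def ..
  obtain d where d: "V d = V (Suc d)"
    using assms(2) unfolding finite_descent_def ..
  show ?thesis
  proof
    show "V j = V (a + d)" if "a + d \<le> j" for j
      using that descent_stable[OF d, of j] descent_stable[OF d, of "a + d"] by simp
    show "\<forall>x \<in> V (a + d). A x = 0 \<longrightarrow> x = 0" using a V_antimono[OF le_add1[of a d]] by blast
  qed
qed

lemma ascent_descent_imp_semi:
  assumes "finite_ascent M A" "finite_descent M A"
  shows "semi_upper M A" "semi_lower M A"
proof -
  obtain k where k: "\<And>j. k \<le> j \<Longrightarrow> V j = V k" "\<forall>x \<in> V k. A x = 0 \<longrightarrow> x = 0"
    using ascent_descent_common[OF assms] by metis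
  have eq: "V k = V (Suc k)" using k(1)[of "Suc k"] by simp
  have cl: "closed (V k)" using closed_V_ascent_descent[OF k(2) eq] .
  have "{x \<in> V k. A x = 0} \<subseteq> {0}" using k(2) by blast
  then show "semi_upper M A" unfolding semi_upper_def
    using cl eq fin_dim_subset[OF fin_dim_zero] by metis
  show "semi_lower M A" unfolding semi_lower_def
    using cl eq fin_codim_superset[OF csub_V] by (metis order_refl)
qed

lemma semi_lower_iff_Suc:
  "semi_lower M A \<longleftrightarrow> (\<exists>k. \<forall>j\<ge>k. fin_codim (V j) (V (Suc j)) \<and> closed (V j))"
proof
  assume "semi_lower M A"
  then obtain k where k: "fin_codim (V k) (V (Suc k))" "closed (V k)" unfolding semi_lower_def by blast
  then have "fin_codim (V j) (V (Suc j)) \<and> closed (V j)" if "k \<le> j" for j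
    using that fin_codim_V_Suc fin_codim_V closed_V_fin_codim by blast
  then show "\<exists>k. \<forall>j\<ge>k. fin_codim (V j) (V (Suc j)) \<and> closed (V j)" by blast
qed (unfold semi_lower_def, blast)

lemma finite_ascent_iff:
  "finite_ascent M A \<longleftrightarrow> (\<exists>k. \<forall>j\<ge>k. \<forall>x \<in> V j. A x = 0 \<longrightarrow> x = 0)"
  unfolding finite_ascent_def using V_antimono by (meson order_refl subsetD)

lemma finite_descent_iff:
  "finite_descent M A \<longleftrightarrow> (\<exists>k. \<forall>j\<ge>k. V j = V (Suc j))"
proof
  assume "finite_descent M A"
  then obtain k where k: "V k = V (Suc k)" unfolding finite_descent_def ..
  have "V j = V (Suc j)" if "k \<le> j" for j
    using descent_stable[OF k that] descent_stable[OF k, of "Suc j"] that by simp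
  then show "\<exists>k. \<forall>j\<ge>k. V j = V (Suc j)" by blast
qed (unfold finite_descent_def, blast)

end

section \<open>The B-Fredholm and Drazin classes in terms of ranges\<close>

lemma Inf_enat_Collect: "Inf {enat n |n. P n} = (if \<exists>n. P n then enat (LEAST n. P n) else \<infinity>)"
proof (cases "\<exists>n. P n")
  case True
  have "Inf {enat n |n. P n} = enat (LEAST n. P n)"
  proof (rule Inf_eqI)
    show "enat (LEAST n. P n) \<le> i" if "i \<in> {enat n |n. P n}" for i using that by (auto intro: Least_le)
    show "y \<le> enat (LEAST n. P n)" if "\<And>i. i \<in> {enat n |n. P n} \<Longrightarrow> y \<le> i" for y
      using that LeastI_ex[OF True] by blast
  qed
  then show ?thesis using True by simp
next
  case False
  then have "{enat n |n. P n} = {}" by simp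
  then show ?thesis using False by (simp add: Inf_enat_def)
qed

lemma Inf_enat_Collect_finite: "Inf {enat n |n. P n} < \<infinity> \<longleftrightarrow> (\<exists>n. P n)"
  by (simp add: Inf_enat_Collect)

lemma invariant_operator_UNIV: "T \<in> bounded_ops \<Longrightarrow> invariant_operator UNIV T"
  by unfold_locales (auto simp: complex_vector.subspace_UNIV)

context
  fixes T :: "'a::complex_banach \<Rightarrow> 'a"
  assumes T: "T \<in> bounded_ops"
begin

interpretation invariant_operator UNIV T
  by (rule invariant_operator_UNIV[OF T])

lemma alpha_range_finite_iff: "alpha_on (range (T ^^ n)) T < \<infinity> \<longleftrightarrow> fin_dim {x \<in> V n. T x = 0}"
  unfolding alpha_on_def by (rule edim_finite_iff)

lemma beta_range_finite_iff: "beta_on (range (T ^^ n)) T < \<infinity> \<longleftrightarrow> fin_codim (V n) (V (Suc n))"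
  unfolding beta_on_def image_V by (rule ecodim_finite_iff[OF csub_V csub_V V_Suc])

text \<open>The definition of the class fixes the least admissible index; a larger index suffices, since
closedness descends from \<open>V (Suc j)\<close> to \<open>V j\<close> as long as \<open>ker T \<inter> V j\<close> is finite-dimensional.\<close>

lemma upper_semi_b_fredholm_iff: "upper_semi_b_fredholm T \<longleftrightarrow> semi_upper UNIV T"
proof
  assume "upper_semi_b_fredholm T"
  then obtain n where n: "p_e T = enat n" "closed (V (n + 1))" unfolding upper_semi_b_fredholm_def by blast
  then have "alpha_on (range (T ^^ n)) T < \<infinity>"
    unfolding p_e_def Inf_enat_Collect by (metis (mono_tags, lifting) LeastI_ex enat.distinct(1) enat.inject)
  then show "semi_upper UNIV T"
    unfolding semi_upper_def alpha_range_finite_iff using n(2) by auto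
next
  assume "semi_upper UNIV T"
  then obtain k where k: "\<And>j. k \<le> j \<Longrightarrow> fin_dim {x \<in> V j. T x = 0} \<and> closed (V j)"
    unfolding semi_upper_iff by blast
  let ?P = "\<lambda>n. fin_dim {x \<in> V n. T x = 0}"
  define p where "p = (LEAST n. ?P n)"
  have "?P k" using k by blast
  then have p: "?P p" "p \<le> k" unfolding p_def by (rule LeastI, rule Least_le)
  have fd: "fin_dim {x \<in> V j. T x = 0}" if "p \<le> j" for j
    by (rule fin_dim_subset[OF p(1) kernel_antimono[OF that]])
  have "closed (V (Suc p))"
  proof -
    have "Suc p \<le> Suc k" using p by simp
    then show ?thesis
    proof (induction rule: inc_induct)
      case base
      show ?case by (rule k[THEN conjunct2], rule le_SucI, rule order_refl)
    next
      case (step j)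
      then have "p \<le> j" by simp
      then show ?case using closed_V_down[OF step.IH] fd by blast
    qed
  qed
  moreover have "p_e T = enat p"
    unfolding p_e_def alpha_range_finite_iff Inf_enat_Collect p_def using \<open>?P k\<close> by auto
  ultimately show "upper_semi_b_fredholm T" unfolding upper_semi_b_fredholm_def by simp
qed

lemma lower_semi_b_fredholm_iff: "lower_semi_b_fredholm T \<longleftrightarrow> semi_lower UNIV T"
proof
  assume "lower_semi_b_fredholm T"
  then obtain n where n: "q_e T = enat n" "closed (V n)" unfolding lower_semi_b_fredholm_def by blast
  then have "beta_on (range (T ^^ n)) T < \<infinity>"
    unfolding q_e_def Inf_enat_Collect by (metis (mono_tags, lifting) LeastI_ex enat.distinct(1) enat.inject)
  then show "semi_lower UNIV T"
    unfolding semi_lower_def beta_range_finite_iff using n(2) by blast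
next
  assume "semi_lower UNIV T"
  then obtain k where k: "fin_codim (V k) (V (Suc k))" "closed (V k)"
    unfolding semi_lower_def by blast
  let ?P = "\<lambda>n. fin_codim (V n) (V (Suc n))"
  define q where "q = (LEAST n. ?P n)"
  have q: "?P q" "q \<le> k" unfolding q_def using k(1) by (rule LeastI, rule Least_le)
  have "closed (V q)" using closed_V_fin_codim[OF fin_codim_V[OF q] q(2)] k(2) by blast
  moreover have "q_e T = enat q"
    unfolding q_e_def beta_range_finite_iff Inf_enat_Collect q_def using k(1) by auto
  ultimately show "lower_semi_b_fredholm T" unfolding lower_semi_b_fredholm_def by simp
qed

lemma ascent_condition_iff:
  "{x \<in> V m. (T ^^ n) x = 0} = {x \<in> V m. (T ^^ (n + 1)) x = 0} \<longleftrightarrow> (\<forall>x \<in> V (n + m). T x = 0 \<longrightarrow> x = 0)"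
proof -
  have "(\<forall>x \<in> V (n + m). T x = 0 \<longrightarrow> x = 0) \<longleftrightarrow> (\<forall>x \<in> V m. (T ^^ (n + 1)) x = 0 \<longrightarrow> (T ^^ n) x = 0)"
    unfolding pow_image_V[symmetric] by simp
  also have "\<dots> \<longleftrightarrow> {x \<in> V m. (T ^^ n) x = 0} = {x \<in> V m. (T ^^ (n + 1)) x = 0}"
    using bounded_ops_zero[OF T] by auto
  finally show ?thesis by blast
qed

lemma descent_condition_iff:
  "(T ^^ n) ` V m = (T ^^ (n + 1)) ` V m \<longleftrightarrow> V (n + m) = V (Suc (n + m))"
  unfolding pow_image_V by simp

lemma ascent_range_finite_iff: "ascent_on (V m) T < \<infinity> \<longleftrightarrow> finite_ascent UNIV T"
  unfolding ascent_on_def Inf_enat_Collect_finite ascent_condition_iff finite_ascent_iff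
  using V_antimono by (metis finite_ascent_def finite_ascent_iff le_add1)

lemma descent_range_finite_iff: "descent_on (V m) T < \<infinity> \<longleftrightarrow> finite_descent UNIV T"
  unfolding descent_on_def Inf_enat_Collect_finite descent_condition_iff
  by (metis finite_descent_def finite_descent_iff le_add1)

text \<open>On a vector space, ascent and descent agree if both are finite. Here even the conditions at each
single index \<open>n\<close> are equivalent: if \<open>T\<close> is injective on \<open>V (n + m)\<close>, then so is \<open>T\<^sup>k\<close>, which maps
\<open>V (n + m)\<close> and \<open>V (Suc (n + m))\<close> onto the same stable range. Conversely, on a stable range \<open>T\<close> is injective because the ascent is finite.\<close>

lemma ascent_range_eq_descent_range:
  assumes "finite_ascent UNIV T" "finite_descent UNIV T"
  shows "ascent_on (V m) T = descent_on (V m) T"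
proof -
  let ?Pa = "\<lambda>n. \<forall>x \<in> V (n + m). T x = 0 \<longrightarrow> x = 0" and ?Pd = "\<lambda>n. V (n + m) = V (Suc (n + m))"
  obtain k where k: "\<And>j. k \<le> j \<Longrightarrow> V j = V k" "\<forall>x \<in> V k. T x = 0 \<longrightarrow> x = 0"
    using ascent_descent_common[OF assms] by metis
  have "V (k + m) = V k" "V (Suc (k + m)) = V k" by (rule k(1), simp)+
  then have ex: "?Pa k" "?Pd k" using k(2) by (simp_all only:)
  have "?Pa n \<longleftrightarrow> ?Pd n" for n
  proof
    assume a: "?Pa n"
    show "?Pd n"
    proof (rule antisym[OF _ V_Suc], rule subsetI)
      fix x assume x: "x \<in> V (n + m)"
      have "(T ^^ k) x \<in> V (k + (n + m))" using x pow_image_V[of k "n + m"] by blast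
      also have "\<dots> = V (k + Suc (n + m))" using k(1)[of "k + (n + m)"] k(1)[of "k + Suc (n + m)"] by simp
      finally obtain y where y: "y \<in> V (Suc (n + m))" "(T ^^ k) x = (T ^^ k) y"
        unfolding pow_image_V[symmetric] by blast
      then have "x - y \<in> V (n + m)" using V_Suc[of "n + m"] x complex_vector.subspace_diff[OF csub_V] by blast
      moreover have "(T ^^ k) (x - y) = 0" using y(2) by (simp add: bounded_ops_simps[OF pow_bounded])
      ultimately have "x - y = 0" by (rule kernel_trivial_pow[OF a])
      then show "x \<in> V (Suc (n + m))" using y by simp
    qed
  next
    assume d: "?Pd n"
    have "V (n + m) = V (n + m + k)" using descent_stable[OF d, of "n + m + k"] by simp
    also have "\<dots> = V k" by (rule k(1)) simp
    finally show "?Pa n" using k(2) by (simp only:)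
  qed
  then show ?thesis
    unfolding ascent_on_def descent_on_def ascent_condition_iff descent_condition_iff by (simp only:)
qed

text \<open>This provides the index of the restriction whose ascent and descent enter the definitions of the
three Drazin classes.\<close>

lemma m_deg_finite:
  assumes "semi_upper UNIV T \<or> semi_lower UNIV T"
  obtains m where "m_deg T = enat m"
proof -
  have "\<exists>n. fin_dim {x \<in> V n. T x = 0} \<or> fin_codim (V n) (V (Suc n))"
    using assms unfolding semi_upper_def semi_lower_def by blast
  then have "\<exists>n. min (alpha_on (range (T ^^ n)) T) (beta_on (range (T ^^ n)) T) < \<infinity>"
    unfolding min_less_iff_disj alpha_range_finite_iff beta_range_finite_iff .
  then show ?thesis using that unfolding m_deg_def Inf_enat_Collect by simp
qed

lemma left_drazin_invertible_iff:
  "left_drazin_invertible T \<longleftrightarrow> semi_upper UNIV T \<and> finite_ascent UNIV T"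
  unfolding left_drazin_invertible_def upper_semi_b_fredholm_iff ascent_range_finite_iff
  using m_deg_finite by metis

lemma right_drazin_invertible_iff:
  "right_drazin_invertible T \<longleftrightarrow> semi_lower UNIV T \<and> finite_descent UNIV T"
  unfolding right_drazin_invertible_def lower_semi_b_fredholm_iff descent_range_finite_iff
  using m_deg_finite by metis

lemma drazin_invertible_iff:
  "drazin_invertible T \<longleftrightarrow> finite_ascent UNIV T \<and> finite_descent UNIV T"
proof
  assume "drazin_invertible T"
  then show "finite_ascent UNIV T \<and> finite_descent UNIV T"
    unfolding drazin_invertible_def using ascent_range_finite_iff descent_range_finite_iff by metis
next
  assume ad: "finite_ascent UNIV T \<and> finite_descent UNIV T"
  then obtain m where "m_deg T = enat m" using m_deg_finite ascent_descent_imp_semi by metis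
  then show "drazin_invertible T"
    unfolding drazin_invertible_def
    using ad ascent_range_eq_descent_range[of m] descent_range_finite_iff[of m] by metis
qed

lemma b_fredholm_iff: "b_fredholm T \<longleftrightarrow> semi_upper UNIV T \<and> semi_lower UNIV T"
  unfolding b_fredholm_def upper_semi_b_fredholm_iff lower_semi_b_fredholm_iff ..

end

section \<open>Operators that divide powers of each other\<close>

definition same_semi_type :: "'a::complex_banach set \<Rightarrow> ('a \<Rightarrow> 'a) \<Rightarrow> 'a set \<Rightarrow> ('a \<Rightarrow> 'a) \<Rightarrow> bool" where
  "same_semi_type M A N S \<longleftrightarrow> (semi_upper M A \<longleftrightarrow> semi_upper N S) \<and> (semi_lower M A \<longleftrightarrow> semi_lower N S)
     \<and> (finite_ascent M A \<longleftrightarrow> finite_ascent N S) \<and> (finite_descent M A \<longleftrightarrow> finite_descent N S)"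

text \<open>The quotient \<open>B\<close> is the same on both sides, which makes \<open>S\<^sup>p = A B = B A\<close> commute with \<open>A\<close>. The operator
\<open>S\<close> itself need not commute with \<open>A\<close>; thus weakly commuting pairs are covered.\<close>

definition divides_power :: "'a::complex_banach set \<Rightarrow> ('a \<Rightarrow> 'a) \<Rightarrow> ('a \<Rightarrow> 'a) \<Rightarrow> bool" where
  "divides_power M A S \<longleftrightarrow> (\<exists>p\<ge>1. \<exists>B\<in>bounded_ops. \<forall>x\<in>M. B x \<in> M \<and> A (B x) = (S ^^ p) x \<and> B (A x) = (S ^^ p) x)"

locale dividing_pair = A: invariant_operator M A + S: invariant_operator M S
  for M :: "'a::complex_banach set" and A S :: "'a \<Rightarrow> 'a" +
  fixes p :: nat and B :: "'a \<Rightarrow> 'a"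
  assumes p: "1 \<le> p" and B: "B \<in> bounded_ops"
    and B_in: "\<And>x. x \<in> M \<Longrightarrow> B x \<in> M"
    and AB: "\<And>x. x \<in> M \<Longrightarrow> A (B x) = (S ^^ p) x"
    and BA: "\<And>x. x \<in> M \<Longrightarrow> B (A x) = (S ^^ p) x"
begin

lemma pow_commute: "x \<in> M \<Longrightarrow> A ((S ^^ (p * n)) x) = (S ^^ (p * n)) (A x)"
proof (induction n arbitrary: x)
  case (Suc n)
  have one: "A ((S ^^ p) y) = (S ^^ p) (A y)" if "y \<in> M" for y
    using that AB[of "A y"] BA[of y] A.invariant by metis
  have "A ((S ^^ (p * Suc n)) x) = A ((S ^^ p) ((S ^^ (p * n)) x))" by (simp add: funpow_add)
  also have "\<dots> = (S ^^ p) ((S ^^ (p * n)) (A x))" using one S.pow_invariant Suc by simp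
  finally show ?case by (simp add: funpow_add)
qed simp

lemma pow_pow_commute: "x \<in> M \<Longrightarrow> (A ^^ i) ((S ^^ (p * n)) x) = (S ^^ (p * n)) ((A ^^ i) x)"
  by (induction i) (auto simp: pow_commute A.pow_invariant)

lemma range_pow: "(S ^^ (p * n)) ` M \<subseteq> (A ^^ n) ` M"
proof (induction n)
  case (Suc n)
  show ?case
  proof
    fix y assume "y \<in> (S ^^ (p * Suc n)) ` M"
    then obtain x where x: "x \<in> M" "y = (S ^^ (p * 1)) ((S ^^ (p * n)) x)" by (auto simp: funpow_add)
    obtain z where z: "z \<in> M" "(S ^^ (p * n)) x = (A ^^ n) z" using Suc x(1) by blast
    have "y = (A ^^ n) ((S ^^ p) z)" unfolding x(2) z(2) using pow_pow_commute[OF z(1), of n 1] by simp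
    also have "\<dots> = (A ^^ Suc n) (B z)" using AB[OF z(1)] by (simp add: funpow_swap1)
    finally show "y \<in> (A ^^ Suc n) ` M" using B_in[OF z(1)] by blast
  qed
qed simp

lemma kernel_pow: "x \<in> M \<Longrightarrow> (A ^^ n) x = 0 \<Longrightarrow> (S ^^ (p * n)) x = 0"
proof (induction n arbitrary: x)
  case (Suc n)
  have "(A ^^ n) ((S ^^ p) x) = (A ^^ n) (A (B x))" using AB Suc by simp
  also have "\<dots> = 0"
  proof -
    have comm: "(A ^^ i) (B y) = B ((A ^^ i) y)" if "y \<in> M" for i y
      using that by (induction i) (auto simp: AB BA A.pow_invariant)
    have "(A ^^ n) (A (B x)) = (A ^^ Suc n) (B x)" by (simp add: funpow_swap1)
    also have "\<dots> = B ((A ^^ Suc n) x)" by (rule comm[OF Suc.prems(1)])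
    finally show ?thesis using Suc.prems(2) bounded_ops_zero[OF B] by simp
  qed
  finally have "(S ^^ (p * n)) ((S ^^ p) x) = 0" using Suc S.pow_invariant by blast
  then show ?case by (simp add: funpow_add funpow_swap1 add.commute[of p])
qed simp

end

locale mutually_dividing = dividing_pair M A S p B for M :: "'a::complex_banach set" and A S p B +
  fixes q B'
  assumes rev: "dividing_pair M S A q B'"
begin

sublocale rev: dividing_pair M S A q B'
  by (rule rev)

text \<open>The kernel of \<open>S\<close> lies in that of \<open>A\<^sup>q\<close>, and the range of \<open>S\<^sup>p\<^sup>k\<close> lies in that of \<open>A\<^sup>k\<close>, where \<open>A\<^sup>q\<close> is
injective for large \<open>k\<close>.\<close>

lemma finite_ascent_transfer: "finite_ascent M A \<Longrightarrow> finite_ascent M S"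
proof -
  assume "finite_ascent M A"
  then obtain k where k: "\<forall>x \<in> A.V k. A x = 0 \<longrightarrow> x = 0" unfolding finite_ascent_def ..
  have "x = 0" if "x \<in> S.V (p * k)" "S x = 0" for x
  proof (rule A.kernel_trivial_pow[OF k])
    show "x \<in> A.V k" using that range_pow by blast
    show "(A ^^ q) x = 0" using rev.BA[of x] that S.V_sub_M bounded_ops_zero[OF rev.B] by force
  qed
  then show ?thesis unfolding finite_ascent_def by blast
qed

lemma finite_descent_transfer: "finite_descent M A \<Longrightarrow> finite_descent M S"
proof -
  assume "finite_descent M A"
  then obtain k where k: "A.V k = A.V (Suc k)" unfolding finite_descent_def ..
  have "S.V (p * k) \<subseteq> A.V k" by (rule range_pow)
  also have "\<dots> = A.V (q * Suc (p * k))"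
    using A.descent_stable[OF k, of "q * Suc (p * k)"] rev.p p
    by (metis Suc_le_mono le_Suc_eq le_add1 mult.commute mult_le_mono mult_1 order_trans)
  also have "\<dots> \<subseteq> S.V (Suc (p * k))" by (rule rev.range_pow)
  finally show ?thesis unfolding finite_descent_def using S.V_Suc by blast
qed

text \<open>The ranges of powers of \<open>A\<close> and \<open>S\<close> are interlaced, so finite codimension is transferred, and the
range of \<open>S\<close> is closed since it has finite codimension in a closed range of \<open>A\<close>.\<close>

lemma semi_lower_transfer: "semi_lower M A \<Longrightarrow> semi_lower M S"
proof -
  assume "semi_lower M A"
  then obtain k where k: "\<And>j. k \<le> j \<Longrightarrow> fin_codim (A.V k) (A.V j)" "\<And>j. k \<le> j \<Longrightarrow> closed (A.V j)"
    unfolding A.semi_lower_iff by blast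
  have le: "k \<le> q * Suc (p * k)"
  proof -
    have "k \<le> p * k" using p by simp
    also have "\<dots> \<le> q * Suc (p * k)" using mult_le_mono[OF rev.p, of "p * k" "Suc (p * k)"] by simp
    finally show ?thesis .
  qed
  have 1: "fin_codim (A.V k) (S.V (Suc (p * k)))"
    using k(1)[OF le] fin_codim_trans fin_codim_superset[OF S.csub_V rev.range_pow] by blast
  then have 2: "fin_codim (S.V (p * k)) (S.V (Suc (p * k)))" using fin_codim_subset range_pow by blast
  have "fin_codim (A.V k) (S.V (p * k))"
    using 1 fin_codim_trans fin_codim_superset[OF S.csub_V S.V_Suc] by blast
  then obtain E where E: "csubspace E" "fin_dim E" "A.V k = S.V (p * k) + E"
    using fin_codim_complement[OF _ S.csub_V A.csub_V range_pow] by metis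
  have "closed (S.V (p * k))"
    using closed_image_if_fin_codim[OF S.pow_bounded S.csub_M S.closed_M E(1,2), of "p * k"] E(3) k(2)[of k] by simp
  then show ?thesis unfolding semi_lower_def using 2 by blast
qed

text \<open>On \<open>A.V (q * k)\<close> the operator \<open>A\<^sup>q = B' S\<close> is upper semi-Fredholm, hence so is its right factor \<open>S\<close>.
The exponent is a multiple of \<open>q\<close> because \<open>S\<close> commutes with \<open>A\<^sup>q\<close> only, and this subspace has to be
invariant under \<open>S\<close>.\<close>

lemma closed_S_pow_image_A_range:
  assumes fd: "fin_dim {x \<in> A.V (q * k). A x = 0}" and cl: "closed (A.V (q * k))" "closed (A.V (q + q * k))"
  shows "closed ((S ^^ i) ` A.V (q * k))"
proof (induction i)
  case 0
  then show ?case using cl by simp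
next
  case (Suc i)
  let ?V = "A.V (q * k)"
  let ?D = "(S ^^ i) ` ?V"
  have csD: "csubspace ?D" by (rule csubspace_image[OF S.pow_bounded A.csub_V])
  have DV: "?D \<subseteq> ?V"
  proof
    fix y assume "y \<in> ?D"
    then obtain x where x: "x \<in> M" "y = (S ^^ i) ((A ^^ (q * k)) x)" by blast
    then have "y = (A ^^ (q * k)) ((S ^^ i) x)" using rev.pow_pow_commute by simp
    then show "y \<in> ?V" using S.pow_invariant x by blast
  qed
  have fdq: "fin_dim {x \<in> ?V. (A ^^ q) x = 0}" by (rule A.fin_dim_kernel_pow[OF fd])
  have "closed ((A ^^ q) ` ?D)"
    using closed_image_closed_subspace[OF A.pow_bounded A.csub_V cl(1) _ fdq csD Suc DV] cl(2)
    unfolding A.pow_image_V by blast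
  have "closed (S ` ?D)"
  proof (rule closed_image_if_fin_dim_Int[OF S.bounded csD Suc])
    let ?K = "{x \<in> M. B' x = 0}"
    show "csubspace ?K" "closed ?K"
      using csubspace_kernel closed_kernel rev.B S.csub_M S.closed_M by blast+
    have DM: "?D \<subseteq> M" using DV A.V_sub_M by blast
    have "S ` ?D + ?K = {x \<in> M. B' x \<in> (A ^^ q) ` ?D}"
    proof (intro equalityI subsetI)
      fix x assume "x \<in> S ` ?D + ?K"
      then obtain d c where d: "d \<in> ?D" "c \<in> M" "B' c = 0" "x = S d + c" by (rule set_plusE) blast
      then have "d \<in> M" using DM by blast
      then have "B' x = (A ^^ q) d" using rev.BA[of d] d(3,4) by (simp add: bounded_ops_simps[OF rev.B])
      moreover have "x \<in> M" using d DM S.invariant complex_vector.subspace_add[OF S.csub_M] by blast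
      ultimately show "x \<in> {x \<in> M. B' x \<in> (A ^^ q) ` ?D}" using d by blast
    next
      fix x assume "x \<in> {x \<in> M. B' x \<in> (A ^^ q) ` ?D}"
      then obtain d where d: "x \<in> M" "d \<in> ?D" "B' x = (A ^^ q) d" by blast
      then have "d \<in> M" using DM by blast
      then have "B' (x - S d) = 0" using rev.BA[of d] d(3) by (simp add: bounded_ops_simps[OF rev.B])
      moreover have "x - S d \<in> M" using d DM S.invariant complex_vector.subspace_diff[OF S.csub_M] by blast
      ultimately show "x \<in> S ` ?D + ?K" using d(2) by (intro set_plusI[of _ "S d" "x - S d"]) auto
    qed
    then show "closed (S ` ?D + ?K)"
      using closed_preimage[OF rev.B S.closed_M \<open>closed ((A ^^ q) ` ?D)\<close>] by simp
    have "S ` ?D \<inter> ?K \<subseteq> S ` {x \<in> ?V. (A ^^ q) x = 0}"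
    proof
      fix y assume "y \<in> S ` ?D \<inter> ?K"
      then obtain d where d: "d \<in> ?D" "y = S d" "B' (S d) = 0" by blast
      then have "d \<in> ?V" using DV by blast
      moreover have "(A ^^ q) d = 0" using rev.BA[of d] d DM by (metis subsetD)
      ultimately show "y \<in> S ` {x \<in> ?V. (A ^^ q) x = 0}" using d(2) by blast
    qed
    then show "fin_dim (S ` ?D \<inter> ?K)" using fin_dim_image[OF S.bounded fdq] fin_dim_subset by blast
  qed
  then show ?case by (simp add: image_comp)
qed

text \<open>The previous lemma concerns the image of a range of \<open>A\<close> under powers of \<open>S\<close>. Since
\<open>P = A\<^sup>q\<^sup>k\<close> maps \<open>M\<close> onto that range and commutes with the powers of \<open>S\<close>, this controls
\<open>S\<^sup>n M + ker P\<close>. The exponent \<open>n = p q k\<close> is large enough for \<open>S\<^sup>n\<close> to vanish on \<open>ker P\<close>, which makes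
\<open>S\<^sup>n M \<inter> ker P\<close> finite-dimensional.\<close>

lemma closed_S_range:
  assumes fd: "fin_dim {x \<in> A.V (q * k). A x = 0}" and cl: "closed (A.V (q * k))" "closed (A.V (q + q * k))"
  shows "closed (S.V (p * (q * k)))"
proof (rule closed_image_if_fin_dim_Int[OF S.pow_bounded S.csub_M S.closed_M])
  let ?P = "A ^^ (q * k)" and ?n = "p * (q * k)"
  let ?K = "{x \<in> M. ?P x = 0}"
  show "csubspace ?K" "closed ?K"
    using csubspace_kernel closed_kernel A.pow_bounded A.csub_M A.closed_M by blast+
  have comm: "?P ((S ^^ i) x) = (S ^^ i) (?P x)" if "x \<in> M" for x i
    using rev.pow_pow_commute[OF that] by simp
  have "S.V ?n + ?K = {x \<in> M. ?P x \<in> (S ^^ ?n) ` A.V (q * k)}"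
  proof (intro equalityI subsetI)
    fix x assume "x \<in> S.V ?n + ?K"
    then obtain a c where a: "a \<in> M" "c \<in> M" "?P c = 0" "x = (S ^^ ?n) a + c" by (rule set_plusE) blast
    then have "?P x = (S ^^ ?n) (?P a)" using comm[OF a(1)] by (simp add: bounded_ops_simps[OF A.pow_bounded])
    moreover have "x \<in> M" using a S.pow_invariant complex_vector.subspace_add[OF S.csub_M] by blast
    ultimately show "x \<in> {x \<in> M. ?P x \<in> (S ^^ ?n) ` A.V (q * k)}" using a by blast
  next
    fix x assume "x \<in> {x \<in> M. ?P x \<in> (S ^^ ?n) ` A.V (q * k)}"
    then obtain a where a: "x \<in> M" "a \<in> M" "?P x = (S ^^ ?n) (?P a)" by blast
    then have "?P (x - (S ^^ ?n) a) = 0" using comm[OF a(2)] by (simp add: bounded_ops_simps[OF A.pow_bounded])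
    moreover have "x - (S ^^ ?n) a \<in> M" using a S.pow_invariant complex_vector.subspace_diff[OF S.csub_M] by blast
    ultimately show "x \<in> S.V ?n + ?K" using a(2) by (intro set_plusI[of _ "(S ^^ ?n) a" "x - (S ^^ ?n) a"]) auto
  qed
  then show "closed (S.V ?n + ?K)"
    using closed_preimage[OF A.pow_bounded A.closed_M closed_S_pow_image_A_range[OF assms]] by simp
  define H where "H = {x \<in> A.V (q * k). (A ^^ (q * ?n)) x = 0}"
  have H: "csubspace H" "fin_dim H"
    unfolding H_def using A.fin_dim_kernel_pow[OF fd] csubspace_kernel[OF A.pow_bounded A.csub_V] by auto
  define G where "G = {x \<in> M. ?P x \<in> H}"
  have csG: "csubspace G" unfolding G_def by (rule csubspace_preimage[OF A.pow_bounded A.csub_M H(1)])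
  have "fin_dim (?P ` G)" using H(2) by (rule fin_dim_subset) (auto simp: G_def)
  then obtain E where E: "csubspace E" "E \<subseteq> G" "fin_dim E" "G = {x \<in> G. ?P x = 0} + E"
    using kernel_complement[OF A.pow_bounded csG] by metis
  have "S.V ?n \<inter> ?K \<subseteq> (S ^^ ?n) ` E"
  proof
    fix y assume y: "y \<in> S.V ?n \<inter> ?K"
    then obtain x where x: "x \<in> M" "y = (S ^^ ?n) x" by blast
    have "(S ^^ ?n) (?P x) = 0" using y x comm[OF x(1), of ?n] by simp
    then have "?P x \<in> H" unfolding H_def using rev.kernel_pow[of "?P x" ?n] A.pow_invariant x by blast
    then have "x \<in> G" using x unfolding G_def by blast
    then have "x \<in> {x \<in> G. ?P x = 0} + E" using E(4) by (rule back_subst[where P = "\<lambda>X. x \<in> X"])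
    then obtain c e where ce: "c \<in> G" "?P c = 0" "e \<in> E" "x = c + e"
      by (rule set_plusE) blast
    have "(S ^^ ?n) c = 0" using kernel_pow ce(1,2) unfolding G_def by blast
    then have "y = (S ^^ ?n) e" using x ce by (simp add: bounded_ops_simps[OF S.pow_bounded])
    then show "y \<in> (S ^^ ?n) ` E" using ce by blast
  qed
  then show "fin_dim (S.V ?n \<inter> ?K)" using fin_dim_image[OF S.pow_bounded E(3)] fin_dim_subset by blast
qed

text \<open>The index \<open>n\<close> is one below the index of a range of \<open>S\<close> that is known to be closed, as required by the
definition of \<open>semi_upper\<close>.\<close>

lemma semi_upper_transfer: "semi_upper M A \<Longrightarrow> semi_upper M S"
proof -
  assume "semi_upper M A"
  then obtain k where k: "\<And>j. k \<le> j \<Longrightarrow> fin_dim {x \<in> A.V j. A x = 0}" "\<And>j. k \<le> j \<Longrightarrow> closed (A.V j)"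
    unfolding A.semi_upper_iff by blast
  have fd: "fin_dim {x \<in> S.V (p * k). S x = 0}"
  proof (rule fin_dim_subset[OF A.fin_dim_kernel_pow[OF k(1)[OF order_refl], of q]], rule subsetI)
    fix x assume x: "x \<in> {x \<in> S.V (p * k). S x = 0}"
    then have "(A ^^ q) x = 0" using rev.BA[of x] S.V_sub_M bounded_ops_zero[OF rev.B] by force
    moreover have "x \<in> A.V k" using x range_pow by blast
    ultimately show "x \<in> {x \<in> A.V k. (A ^^ q) x = 0}" by blast
  qed
  define n where "n = p * (q * Suc k) - 1"
  have le: "k \<le> q * Suc k" using mult_le_mono[OF rev.p, of k "Suc k"] by simp
  have "p * 1 \<le> p * q" using mult_le_mono[of p p 1 q] rev.p by simp
  then have "p * Suc k \<le> p * q * Suc k" by (metis mult.right_neutral mult_le_mono1)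
  then have "Suc (p * k) \<le> p * (q * Suc k)" using p by (simp add: algebra_simps)
  then have n: "Suc n = p * (q * Suc k)" "p * k \<le> n" unfolding n_def by simp_all
  have "closed (S.V (Suc n))" unfolding n(1)
    using k le by (intro closed_S_range) auto
  moreover have "fin_dim {x \<in> S.V n. S x = 0}" by (rule fin_dim_subset[OF fd S.kernel_antimono[OF n(2)]])
  ultimately show ?thesis unfolding semi_upper_def by blast
qed

end

theorem same_semi_type_if_divides_power:
  assumes "invariant_operator M A" "invariant_operator M S" "divides_power M A S" "divides_power M S A"
  shows "same_semi_type M A M S"
proof -
  obtain p B where p: "1 \<le> p" "B \<in> bounded_ops"
      "\<forall>x\<in>M. B x \<in> M \<and> A (B x) = (S ^^ p) x \<and> B (A x) = (S ^^ p) x"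
    using assms(3) unfolding divides_power_def by blast
  obtain q B' where q: "1 \<le> q" "B' \<in> bounded_ops"
      "\<forall>x\<in>M. B' x \<in> M \<and> S (B' x) = (A ^^ q) x \<and> B' (S x) = (A ^^ q) x"
    using assms(4) unfolding divides_power_def by blast
  have d: "dividing_pair M A S p B" "dividing_pair M S A q B'"
    using assms p q by (auto simp: dividing_pair_def dividing_pair_axioms_def)
  interpret AS: mutually_dividing M A S p B q B'
    by (simp add: mutually_dividing_def mutually_dividing_axioms_def d)
  interpret SA: mutually_dividing M S A q B' p B
    by (simp add: mutually_dividing_def mutually_dividing_axioms_def d)
  show ?thesis unfolding same_semi_type_def
    using AS.finite_ascent_transfer AS.finite_descent_transfer AS.semi_lower_transfer AS.semi_upper_transfer
      SA.finite_ascent_transfer SA.finite_descent_transfer SA.semi_lower_transfer SA.semi_upper_transfer by blast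
qed

section \<open>Passing to a closed invariant subspace\<close>

text \<open>This is the embedding of \<open>V' / (V' \<inter> U)\<close> into \<open>V / U\<close>. The part \<open>E0\<close> of a complement \<open>E\<close> that can be
reached from \<open>V'\<close> modulo \<open>U\<close> is replaced by a space \<open>G \<subseteq> V'\<close> of representatives.\<close>

lemma fin_codim_Int:
  assumes "fin_codim V U" "csubspace U" "csubspace V'" "V' \<subseteq> V"
  shows "fin_codim V' (V' \<inter> U)"
proof -
  obtain E where E: "csubspace E" "fin_dim E" "V \<subseteq> U + E" using assms(1) unfolding fin_codim_def by blast
  define E0 where "E0 = E \<inter> (V' + U)"
  have E0: "csubspace E0" "fin_dim E0" unfolding E0_def
    using complex_vector.subspace_inter[OF E(1) csubspace_plus[OF assms(3,2)]] fin_dim_subset[OF E(2)] by auto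
  obtain B where B: "finite B" "E0 = cspan B" using csubspace_fin_dim_span[OF E0] .
  have "\<exists>v\<in>V'. b - v \<in> U" if "b \<in> B" for b
  proof -
    have "b \<in> V' + U" using that B(2) complex_vector.span_base unfolding E0_def by blast
    then obtain v u where "v \<in> V'" "u \<in> U" "b = v + u" by (rule set_plusE)
    then show ?thesis by (intro bexI[of _ v]) auto
  qed
  then obtain f where f: "\<And>b. b \<in> B \<Longrightarrow> f b \<in> V' \<and> b - f b \<in> U" by metis
  define G where "G = cspan (f ` B)"
  have G: "csubspace G" "fin_dim G" unfolding G_def using fin_dim_span B(1) by auto
  have GV: "G \<subseteq> V'" unfolding G_def using f by (intro complex_vector.span_minimal assms(3)) blast
  have "B \<subseteq> U + G"
  proof
    fix b assume b: "b \<in> B"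
    then have "f b \<in> G" unfolding G_def by (intro complex_vector.span_base) blast
    then show "b \<in> U + G" using f[OF b] by (intro set_plusI[of _ "b - f b" "f b"]) auto
  qed
  then have EG: "E0 \<subseteq> U + G" unfolding B(2) by (rule complex_vector.span_minimal[OF _ csubspace_plus[OF assms(2) G(1)]])
  have "V' \<subseteq> (V' \<inter> U) + G"
  proof
    fix v assume v: "v \<in> V'"
    then have "v \<in> U + E" using assms(4) E(3) by blast
    then obtain u e where ue: "u \<in> U" "e \<in> E" "v = u + e" by (rule set_plusE)
    have "e \<in> V' + U" using ue v complex_vector.subspace_neg[OF assms(2)]
      by (intro set_plusI[of _ v "- u"]) auto
    then have "e \<in> U + G" using EG ue(2) unfolding E0_def by blast
    then obtain u' g where ug: "u' \<in> U" "g \<in> G" "e = u' + g" by (rule set_plusE)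
    have "v - g \<in> V'" using v ug(2) GV complex_vector.subspace_diff[OF assms(3)] by blast
    moreover have "v - g \<in> U" using ue ug complex_vector.subspace_add[OF assms(2)] by simp
    ultimately show "v \<in> (V' \<inter> U) + G" using ug(2) by (intro set_plusI[of _ "v - g" g]) auto
  qed
  then show ?thesis unfolding fin_codim_def using G by blast
qed

text \<open>Under these hypotheses the large ranges on \<open>M\<close> and on \<open>N\<close> have the same kernels of \<open>A\<close> and
isomorphic successive quotients, and their sums with \<open>N\<close> are closed: modulo \<open>N\<close> the operator is
eventually bijective on its ranges.\<close>

lemma same_semi_type_restrict:
  assumes "invariant_operator M A" "invariant_operator N A" "N \<subseteq> M"
    and Int: "\<And>j. (A ^^ j) ` M \<inter> N = (A ^^ j) ` N"
    and ker: "\<And>j x. k \<le> j \<Longrightarrow> x \<in> (A ^^ j) ` M \<Longrightarrow> A x = 0 \<Longrightarrow> x \<in> N"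
    and cov: "\<And>j. k \<le> j \<Longrightarrow> (A ^^ j) ` M \<subseteq> (A ^^ Suc j) ` M + N"
    and clo: "\<And>j. k \<le> j \<Longrightarrow> closed ((A ^^ j) ` M + N)"
  shows "same_semi_type M A N A"
proof -
  interpret M: invariant_operator M A by fact
  interpret N: invariant_operator N A by fact
  have kerN: "{x \<in> M.V j. A x = 0} = {x \<in> N.V j. A x = 0}" if "k \<le> j" for j
    using ker[OF that] Int[of j] by blast
  have NM: "N.V j \<subseteq> M.V j" for j using Int[of j] by blast
  have sum: "M.V j \<subseteq> M.V (Suc j) + N.V j" if "k \<le> j" for j
  proof
    fix x assume x: "x \<in> M.V j"
    then have "x \<in> M.V (Suc j) + N" using cov[OF that] by blast
    then obtain a n where an: "a \<in> M.V (Suc j)" "n \<in> N" "x = a + n" by (rule set_plusE)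
    then have "n = x - a" by simp
    then have "n \<in> M.V j" using x an(1) M.V_Suc[of j] complex_vector.subspace_diff[OF M.csub_V] by blast
    then have "n \<in> N.V j" using an(2) Int[of j] by blast
    then show "x \<in> M.V (Suc j) + N.V j" using an by (intro set_plusI[of _ a n])
  qed
  have NSuc: "N.V (Suc j) = N.V j \<inter> M.V (Suc j)" for j
    using Int[of j] Int[of "Suc j"] M.V_Suc[of j] by blast
  have clo_iff: "closed (M.V j) \<longleftrightarrow> closed (N.V j)" if "k \<le> j" for j
  proof
    assume "closed (M.V j)"
    then show "closed (N.V j)" using closed_Int[OF _ N.closed_M] Int[of j] by metis
  next
    assume "closed (N.V j)"
    then show "closed (M.V j)"
      using closed_image_if_closed_sum[OF M.pow_bounded M.csub_M M.closed_M N.csub_M N.closed_M clo[OF that]]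
        Int[of j] by simp
  qed
  have codim_iff: "fin_codim (M.V j) (M.V (Suc j)) \<longleftrightarrow> fin_codim (N.V j) (N.V (Suc j))" if "k \<le> j" for j
  proof
    assume "fin_codim (M.V j) (M.V (Suc j))"
    then show "fin_codim (N.V j) (N.V (Suc j))"
      unfolding NSuc[of j] by (rule fin_codim_Int[OF _ M.csub_V N.csub_V NM])
  next
    assume "fin_codim (N.V j) (N.V (Suc j))"
    then obtain E where E: "csubspace E" "fin_dim E" "N.V j \<subseteq> N.V (Suc j) + E" unfolding fin_codim_def by blast
    have "M.V j \<subseteq> M.V (Suc j) + E"
    proof
      fix x assume "x \<in> M.V j"
      then have "x \<in> M.V (Suc j) + N.V j" using sum[OF that] by blast
      then obtain a n where an: "a \<in> M.V (Suc j)" "n \<in> N.V j" "x = a + n" by (rule set_plusE)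
      have "n \<in> N.V (Suc j) + E" using an(2) E(3) by blast
      then obtain n' e where ne: "n' \<in> N.V (Suc j)" "e \<in> E" "n = n' + e" by (rule set_plusE)
      have "a + n' \<in> M.V (Suc j)" using an(1) ne(1) NM[of "Suc j"] complex_vector.subspace_add[OF M.csub_V] by blast
      then show "x \<in> M.V (Suc j) + E" using an ne by (intro set_plusI[of _ "a + n'" e]) (auto simp: add.assoc)
    qed
    then show "fin_codim (M.V j) (M.V (Suc j))" unfolding fin_codim_def using E by blast
  qed
  have eq_iff: "M.V j = M.V (Suc j) \<longleftrightarrow> N.V j = N.V (Suc j)" if "k \<le> j" for j
  proof
    assume "M.V j = M.V (Suc j)"
    then show "N.V j = N.V (Suc j)" using Int[of j] Int[of "Suc j"] by metis
  next
    assume eq: "N.V j = N.V (Suc j)"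
    have "M.V j \<subseteq> M.V (Suc j)"
    proof
      fix x assume "x \<in> M.V j"
      then have "x \<in> M.V (Suc j) + N.V j" using sum[OF that] by blast
      then obtain a n where an: "a \<in> M.V (Suc j)" "n \<in> N.V j" "x = a + n" by (rule set_plusE)
      then have "n \<in> M.V (Suc j)" using eq NM[of "Suc j"] by blast
      then show "x \<in> M.V (Suc j)" using an complex_vector.subspace_add[OF M.csub_V] by blast
    qed
    then show "M.V j = M.V (Suc j)" by (rule antisym[OF _ M.V_Suc])
  qed
  have ev: "(\<exists>n. \<forall>j\<ge>n. P j) \<longleftrightarrow> (\<exists>n. \<forall>j\<ge>n. Q j)" if "\<And>j. k \<le> j \<Longrightarrow> P j \<longleftrightarrow> Q j" for P Q :: "nat \<Rightarrow> bool"
    using that by (meson le_trans nat_le_linear)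
  have "semi_upper M A \<longleftrightarrow> semi_upper N A"
    unfolding M.semi_upper_iff N.semi_upper_iff by (rule ev) (simp only: kerN clo_iff)
  moreover have "semi_lower M A \<longleftrightarrow> semi_lower N A"
    unfolding M.semi_lower_iff_Suc N.semi_lower_iff_Suc by (rule ev) (simp only: codim_iff clo_iff)
  moreover have "finite_ascent M A \<longleftrightarrow> finite_ascent N A"
    unfolding M.finite_ascent_iff N.finite_ascent_iff
  proof (rule ev)
    fix j assume "k \<le> j"
    then show "(\<forall>x\<in>M.V j. A x = 0 \<longrightarrow> x = 0) \<longleftrightarrow> (\<forall>x\<in>N.V j. A x = 0 \<longrightarrow> x = 0)"
      using kerN[of j] by blast
  qed
  moreover have "finite_descent M A \<longleftrightarrow> finite_descent N A"
    unfolding M.finite_descent_iff N.finite_descent_iff by (rule ev) (rule eq_iff)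
  ultimately show ?thesis unfolding same_semi_type_def by blast
qed

text \<open>Two reductions at once. The operator \<open>P\<close> has the range \<open>R\<close>, a finite-dimensional invariant
complement of \<open>ker P\<close>; on \<open>R\<close> the ranges and kernels of the powers of \<open>A\<close> are eventually constant. The
operator \<open>D\<close> intertwines \<open>A\<close> with the scalar \<open>\<mu>\<close>; thus \<open>A\<close> acts as this nonzero scalar modulo
\<open>ker D\<close>, unless \<open>D = 0\<close> and there is nothing to reduce.\<close>

lemma same_semi_type_reduction:
  assumes A: "A \<in> bounded_ops" and P: "P \<in> bounded_ops" and D: "D \<in> bounded_ops"
    and fd: "fin_dim (range P)" and comm: "\<And>x. P (A x) = A (P x)"
    and inj: "\<And>x. P (P x) = 0 \<Longrightarrow> P x = 0" and onto: "\<And>x. \<exists>y. P x = P (P y)"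
    and DP: "\<And>x. D (P x) = 0" and DA: "\<And>x. D (A x) = \<mu> *\<^sub>C D x"
    and \<mu>: "\<mu> \<noteq> 0 \<or> (\<forall>x. D x = 0)"
  shows "same_semi_type UNIV A {x. P x = 0 \<and> D x = 0} A"
proof -
  define N where "N = {x. P x = 0 \<and> D x = 0}"
  define R where "R = range P"
  have csR: "csubspace R" unfolding R_def by (rule csubspace_image[OF P complex_vector.subspace_UNIV])
  have N_eq: "N = {x \<in> {x \<in> UNIV. P x = 0}. D x = 0}" unfolding N_def by blast
  interpret X: invariant_operator UNIV A by (rule invariant_operator_UNIV[OF A])
  interpret N: invariant_operator N A
  proof
    show "csubspace N" unfolding N_eq
      by (intro csubspace_kernel D P complex_vector.subspace_UNIV)
    show "closed N" unfolding N_eq by (intro closed_kernel D P closed_UNIV)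
    show "A x \<in> N" if "x \<in> N" for x
      using that unfolding N_def by (auto simp: comm DA bounded_ops_zero[OF A])
  qed (rule A)
  interpret R: invariant_operator R A
  proof
    show "closed R" using closed_fin_dim csR fd unfolding R_def by blast
    show "A x \<in> R" if x: "x \<in> R" for x
    proof -
      obtain y where "x = P y" using x unfolding R_def by blast
      then have "A x = P (A y)" using comm by simp
      then show ?thesis unfolding R_def by simp
    qed
  qed (use A csR in auto)
  have Ppow: "P ((A ^^ j) x) = (A ^^ j) (P x)" for j x by (induction j) (auto simp: comm)
  have Dpow: "D ((A ^^ j) x) = \<mu> ^ j *\<^sub>C D x" for j x
    by (induction j) (auto simp: DA scaleC_scaleC scaleC_one)
  have DR: "D r = 0" if "r \<in> R" for r using that DP unfolding R_def by auto
  have PR: "r = 0" if "r \<in> R" "P r = 0" for r using that inj unfolding R_def by auto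
  have Rpow: "(A ^^ j) r \<in> R" if "r \<in> R" for r j by (rule R.pow_invariant[OF that])
  have split: "\<exists>r u. r \<in> R \<and> P u = 0 \<and> x = r + u" for x
  proof -
    obtain y where "P x = P (P y)" using onto by blast
    then show ?thesis unfolding R_def
      by (intro exI[of _ "P y"] exI[of _ "x - P y"]) (auto simp: bounded_ops_simps[OF P])
  qed
  note ops = bounded_ops_simps[OF X.pow_bounded] bounded_ops_simps[OF P] bounded_ops_simps[OF D] bounded_ops_simps[OF A]
  have reg: "r \<in> R \<Longrightarrow> P u = 0 \<Longrightarrow> (A ^^ j) (r + u) \<in> N \<Longrightarrow> (A ^^ j) r = 0 \<and> u \<in> N" for r u j
  proof -
    assume r: "r \<in> R" and u: "P u = 0" and x: "(A ^^ j) (r + u) \<in> N"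
    have "P ((A ^^ j) r) = 0" using x u unfolding N_def by (simp add: ops Ppow)
    then have 1: "(A ^^ j) r = 0" using PR Rpow[OF r] by blast
    have "D ((A ^^ j) u) = 0" using x 1 unfolding N_def by (simp add: ops)
    then have "D u = 0" using \<mu> unfolding Dpow by auto
    then show ?thesis using 1 u unfolding N_def by blast
  qed
  obtain d1 where d1: "\<And>j. d1 \<le> j \<Longrightarrow> {r \<in> R. (A ^^ j) r = 0} = {r \<in> R. (A ^^ d1) r = 0}"
  proof (rule increasing_chain_stable[of R "\<lambda>j. {r \<in> R. (A ^^ j) r = 0}"])
    show "fin_dim R" using fd unfolding R_def .
    show "csubspace {r \<in> R. (A ^^ j) r = 0}" for j by (rule csubspace_kernel[OF X.pow_bounded csR])
  qed (auto simp: bounded_ops_zero[OF A])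
  have "fin_dim (R.V 0)" using fd unfolding R_def by simp
  then obtain d2 where d2: "\<And>j. d2 \<le> j \<Longrightarrow> R.V j = R.V d2"
    using decreasing_chain_stable[of R.V 0, OF _ R.csub_V R.V_Suc] by blast
  have "same_semi_type UNIV A N A"
  proof (rule same_semi_type_restrict[where k = "d1 + d2"])
    show "invariant_operator UNIV A" "invariant_operator N A" by unfold_locales
    show "N \<subseteq> UNIV" by simp
    show "X.V j \<inter> N = N.V j" for j
    proof
      show "X.V j \<inter> N \<subseteq> N.V j"
      proof
        fix y assume y: "y \<in> X.V j \<inter> N"
        then obtain x where x: "y = (A ^^ j) x" by blast
        obtain r u where ru: "r \<in> R" "P u = 0" "x = r + u" using split by blast
        then have "(A ^^ j) r = 0 \<and> u \<in> N" using reg y x by blast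
        then show "y \<in> N.V j" using x ru by (auto simp: ops)
      qed
      show "N.V j \<subseteq> X.V j \<inter> N" using N.V_sub_M by blast
    qed
    show "x \<in> N" if j: "d1 + d2 \<le> j" and x: "x \<in> X.V j" "A x = 0" for j x
    proof -
      obtain w where w: "x = (A ^^ j) w" using x by blast
      obtain r u where ru: "r \<in> R" "P u = 0" "w = r + u" using split by blast
      have "(A ^^ Suc j) (r + u) = 0" using w ru x by simp
      then have 1: "(A ^^ Suc j) r = 0 \<and> u \<in> N" using reg[OF ru(1,2), of "Suc j"] complex_vector.subspace_0[OF N.csub_M] by simp
      then have "r \<in> {r \<in> R. (A ^^ j) r = 0}"
        using d1[of "Suc j"] d1[of j] j ru(1) by auto
      then have "x = (A ^^ j) u" using w ru by (simp add: ops)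
      then show ?thesis using 1 N.pow_invariant by blast
    qed
    show "X.V j \<subseteq> X.V (Suc j) + N" if j: "d1 + d2 \<le> j" for j
    proof
      fix x assume "x \<in> X.V j"
      then obtain w where w: "x = (A ^^ j) w" by blast
      obtain r u where ru: "r \<in> R" "P u = 0" "w = r + u" using split by blast
      have "R.V j = R.V (Suc j)" using d2[of j] d2[of "Suc j"] j by simp
      then have "(A ^^ j) r \<in> R.V (Suc j)" using imageI[OF ru(1), of "A ^^ j"] by (simp only:)
      then have 1: "(A ^^ j) r \<in> X.V (Suc j)" by blast
      have xw: "x = (A ^^ j) r + (A ^^ j) u" using w ru by (simp add: ops)
      show "x \<in> X.V (Suc j) + N"
      proof (cases "\<mu> = 0")
        case True
        then have "u \<in> N" using \<mu> ru unfolding N_def by blast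
        then show ?thesis using 1 xw N.pow_invariant by (intro set_plusI[of _ "(A ^^ j) r" "(A ^^ j) u"]) auto
      next
        case False
        \<comment> \<open>Modulo \<open>ker D\<close> the operator is multiplication by \<open>\<mu>\<close>, so \<open>\<mu>\<^sup>-\<^sup>1 A\<close> changes vectors of \<open>ker P\<close>
          only by elements of \<open>N\<close>.\<close>
        let ?v = "(A ^^ j) u - inverse \<mu> *\<^sub>C (A ^^ Suc j) u"
        have Pu: "P ((A ^^ i) u) = 0" for i using ru(2) Ppow bounded_ops_zero[OF X.pow_bounded] by simp
        have "P ?v = 0" using Pu[of j] Pu[of "Suc j"] by (simp only: ops) simp
        moreover have "D ?v = 0"
          using False by (simp only: ops Dpow) (simp add: scaleC_scaleC mult.assoc[symmetric])
        ultimately have "?v \<in> N" unfolding N_def by blast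
        moreover have "(A ^^ j) r + inverse \<mu> *\<^sub>C (A ^^ Suc j) u \<in> X.V (Suc j)"
          using 1 complex_vector.subspace_add[OF X.csub_V] complex_vector.subspace_scale[OF X.csub_V] by blast
        ultimately show ?thesis using xw
          by (intro set_plusI[of _ "(A ^^ j) r + inverse \<mu> *\<^sub>C (A ^^ Suc j) u" ?v]) auto
      qed
    qed
    show "closed (X.V j + N)" for j
    proof -
      have "X.V j + N = {x \<in> UNIV. P x = 0} + R.V j"
      proof (intro equalityI subsetI)
        fix x assume "x \<in> X.V j + N"
        then obtain w n where wn: "n \<in> N" "x = (A ^^ j) w + n" by (blast elim: set_plusE)
        obtain r u where ru: "r \<in> R" "P u = 0" "w = r + u" using split by blast
        have "P ((A ^^ j) u + n) = 0" using ru wn unfolding N_def by (simp add: ops Ppow)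
        then show "x \<in> {x \<in> UNIV. P x = 0} + R.V j"
          using ru wn by (intro set_plusI[of _ "(A ^^ j) u + n" "(A ^^ j) r"]) (auto simp: ops)
      next
        fix x assume "x \<in> {x \<in> UNIV. P x = 0} + R.V j"
        then obtain u r where ru: "P u = 0" "r \<in> R" "x = u + (A ^^ j) r" by (blast elim: set_plusE)
        show "x \<in> X.V j + N"
        proof (cases "\<mu> = 0")
          case True
          then have "u \<in> N" using \<mu> ru unfolding N_def by blast
          then show ?thesis using ru by (intro set_plusI[of _ "(A ^^ j) r" u]) auto
        next
          case False
          let ?v = "u - inverse (\<mu> ^ j) *\<^sub>C (A ^^ j) u"
          have "P ?v = 0" using ru(1) by (simp add: ops Ppow)
          moreover have "D ?v = 0"
            using False by (simp only: ops Dpow) (simp add: scaleC_scaleC scaleC_one)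
          ultimately have "?v \<in> N" unfolding N_def by blast
          moreover have "(A ^^ j) r + inverse (\<mu> ^ j) *\<^sub>C (A ^^ j) u \<in> X.V j"
            by (rule complex_vector.subspace_add[OF X.csub_V _ complex_vector.subspace_scale[OF X.csub_V]]) auto
          ultimately show ?thesis using ru
            by (intro set_plusI[of _ "(A ^^ j) r + inverse (\<mu> ^ j) *\<^sub>C (A ^^ j) u" ?v]) auto
        qed
      qed
      moreover have "closed ({x \<in> UNIV. P x = 0} + R.V j)"
        using csubspace_kernel[OF P complex_vector.subspace_UNIV] closed_kernel[OF P closed_UNIV]
        by (rule closed_add_fin_dim[OF _ _ R.csub_V])
          (rule fin_dim_subset[OF fd[folded R_def] R.V_sub_M])
      ultimately show ?thesis by simp
    qed
  qed
  then show ?thesis unfolding N_def .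
qed

section \<open>Weakly commuting power finite rank perturbations\<close>

definition weakly_commute_on :: "'a::complex_banach set \<Rightarrow> ('a \<Rightarrow> 'a) \<Rightarrow> ('a \<Rightarrow> 'a) \<Rightarrow> bool" where
  "weakly_commute_on M A G \<longleftrightarrow> (\<forall>x\<in>M. A (A (G x)) = A (G (A x)) \<and> A (G (A x)) = G (A (A x))
     \<and> G (G (A x)) = G (A (G x)) \<and> G (A (G x)) = A (G (G x)))"

lemma weakly_commute_on_sym: "weakly_commute_on M A G \<Longrightarrow> weakly_commute_on M G A"
  unfolding weakly_commute_on_def by simp

text \<open>Weak commutation lets a letter pass another one only in the presence of a third; two copies of \<open>A\<close>
provide it.\<close>

lemma weakly_commute_pow:
  assumes "weakly_commute_on M A G" "\<And>x. x \<in> M \<Longrightarrow> A x \<in> M" "x \<in> M" "2 \<le> i"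
  shows "G ((A ^^ i) x) = (A ^^ i) (G x)"
  using assms(4,3)
proof (induction i arbitrary: x rule: dec_induct)
  case base
  then show ?case using assms(1) unfolding weakly_commute_on_def by (simp add: numeral_2_eq_2)
next
  case (step i)
  obtain l where l: "i = Suc l" using step(1) by (cases i) auto
  have "G ((A ^^ Suc i) x) = G ((A ^^ i) (A x))" by (simp add: funpow_swap1)
  also have "\<dots> = (A ^^ i) (G (A x))" using step assms(2) by blast
  also have "\<dots> = (A ^^ l) (A (G (A x)))" unfolding l by (simp add: funpow_swap1)
  also have "\<dots> = (A ^^ l) (A (A (G x)))" using assms(1) step.prems unfolding weakly_commute_on_def by simp
  also have "\<dots> = (A ^^ Suc i) (G x)" unfolding l by (simp add: funpow_swap1)
  finally show ?case .
qed

text \<open>The quotient is the geometric sum \<open>B = \<Sum>\<^sub>i\<^sub><\<^sub>p A\<^sup>i G\<^sup>p\<^sup>-\<^sup>1\<^sup>-\<^sup>i\<close>: \<open>(A - G) B\<close> and \<open>B (A - G)\<close> telescope to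
\<open>A\<^sup>p - G\<^sup>p = A\<^sup>p\<close>. All words that have to be permuted have length \<open>p\<close>, and for words of length at least
three weak commutation is as good as commutation.\<close>

lemma divides_power_nilpotent_perturbation:
  assumes A: "A \<in> bounded_ops" and G: "G \<in> bounded_ops" and M: "csubspace M"
    and inv: "\<And>x. x \<in> M \<Longrightarrow> A x \<in> M" "\<And>x. x \<in> M \<Longrightarrow> G x \<in> M"
    and wc: "weakly_commute_on M A G" and p: "3 \<le> p" and nil: "\<And>x. x \<in> M \<Longrightarrow> (G ^^ p) x = 0"
  shows "divides_power M (\<lambda>x. A x - G x) A"
proof -
  have inA: "(A ^^ i) x \<in> M" if "x \<in> M" for i x using that by (induction i) (auto simp: inv)
  have inG: "(G ^^ i) x \<in> M" if "x \<in> M" for i x using that by (induction i) (auto simp: inv)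
  note wc' = wc[unfolded weakly_commute_on_def, rule_format]
  have left: "G ((A ^^ i) ((G ^^ j) x)) = (A ^^ i) ((G ^^ Suc j) x)" if x: "x \<in> M" and ij: "2 \<le> i + j" for i j x
  proof -
    consider "i = 0" | "i = 1" | "2 \<le> i" by linarith
    then show ?thesis
    proof cases
      case 2
      then obtain l where "j = Suc l" using ij by (cases j) auto
      then show ?thesis using wc'[OF inG[OF x, of l]] 2 by simp
    next
      case 3
      then show ?thesis using weakly_commute_pow[OF wc inv(1) inG[OF x]] by simp
    qed simp
  qed
  have right: "(A ^^ i) ((G ^^ j) (A x)) = (A ^^ Suc i) ((G ^^ j) x)" if x: "x \<in> M" and ij: "2 \<le> i + j" for i j x
  proof -
    consider "j = 0" | "j = 1" | "2 \<le> j" by linarith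
    then show ?thesis
    proof cases
      case 1
      then show ?thesis by (simp add: funpow_swap1)
    next
      case 2
      then obtain l where l: "i = Suc l" using ij by (cases i) auto
      show ?thesis using wc'[OF x] unfolding l 2 by (simp add: funpow_swap1)
    next
      case 3
      then show ?thesis
        using weakly_commute_pow[OF weakly_commute_on_sym[OF wc] inv(2) x] by (simp add: funpow_swap1)
    qed
  qed
  define B where "B = (\<lambda>x. \<Sum>i<p. (A ^^ i) ((G ^^ (p - 1 - i)) x))"
  have Bb: "B \<in> bounded_ops" unfolding B_def
    by (rule bounded_ops_finite_sum, rule bounded_ops_compose[OF bounded_ops_funpow[OF A] bounded_ops_funpow[OF G]])
  have tele: "(\<Sum>i<p. (A ^^ Suc i) ((G ^^ (p - 1 - i)) x) - (A ^^ i) ((G ^^ Suc (p - 1 - i)) x)) = (A ^^ p) x"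
    if x: "x \<in> M" for x
  proof -
    let ?t = "\<lambda>i. (A ^^ i) ((G ^^ (p - i)) x)"
    have "(A ^^ Suc i) ((G ^^ (p - 1 - i)) x) - (A ^^ i) ((G ^^ Suc (p - 1 - i)) x) = ?t (Suc i) - ?t i"
      if "i < p" for i
    proof -
      have "Suc (p - 1 - i) = p - i" "p - 1 - i = p - Suc i" using that by auto
      then show ?thesis by metis
    qed
    then have "(\<Sum>i<p. (A ^^ Suc i) ((G ^^ (p - 1 - i)) x) - (A ^^ i) ((G ^^ Suc (p - 1 - i)) x))
        = (\<Sum>i<p. ?t (Suc i) - ?t i)" by (intro sum.cong) auto
    also have "\<dots> = ?t p - ?t 0" by (rule sum_lessThan_telescope)
    finally show ?thesis using nil[OF x] by simp
  qed
  have "B x \<in> M \<and> A (B x) - G (B x) = (A ^^ p) x \<and> B (A x - G x) = (A ^^ p) x" if x: "x \<in> M" for x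
  proof (intro conjI)
    show "B x \<in> M" unfolding B_def by (intro complex_vector.subspace_sum[OF M] inA inG x)
    have ij: "2 \<le> i + (p - 1 - i)" if "i < p" for i using p that by simp
    have "A (B x) - G (B x) = (\<Sum>i<p. A ((A ^^ i) ((G ^^ (p - 1 - i)) x)) - G ((A ^^ i) ((G ^^ (p - 1 - i)) x)))"
      unfolding B_def bounded_ops_sum[OF A] bounded_ops_sum[OF G] by (simp only: sum_subtractf)
    also have "\<dots> = (\<Sum>i<p. (A ^^ Suc i) ((G ^^ (p - 1 - i)) x) - (A ^^ i) ((G ^^ Suc (p - 1 - i)) x))"
      using left[OF x ij] by (intro sum.cong) auto
    finally show "A (B x) - G (B x) = (A ^^ p) x" using tele[OF x] by simp
    have "B (A x - G x) = (\<Sum>i<p. (A ^^ i) ((G ^^ (p - 1 - i)) (A x)) - (A ^^ i) ((G ^^ (p - 1 - i)) (G x)))"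
      unfolding B_def by (simp only: bounded_ops_diff[OF bounded_ops_funpow[OF G]] bounded_ops_diff[OF bounded_ops_funpow[OF A]])
    also have "\<dots> = (\<Sum>i<p. (A ^^ Suc i) ((G ^^ (p - 1 - i)) x) - (A ^^ i) ((G ^^ Suc (p - 1 - i)) x))"
      using right[OF x ij] by (intro sum.cong) (auto simp: funpow_swap1)
    finally show "B (A x - G x) = (A ^^ p) x" using tele[OF x] by simp
  qed
  then show ?thesis unfolding divides_power_def using Bb p by (intro exI[of _ p]) auto
qed

text \<open>The Fitting decomposition of \<open>F\<close>: once kernels and ranges of the powers on the finite-dimensional
space \<open>F\<^sup>m X\<close> are constant, \<open>X\<close> is the direct sum of the kernel and the range of \<open>F\<^sup>p\<close>. The bound
\<open>3 \<le> p\<close> provides for the weak commutation identities.\<close>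

lemma power_finite_rank_fitting:
  assumes "F \<in> power_finite_rank"
  obtains p where "3 \<le> p" "fin_dim (range (F ^^ p))" "\<And>x. (F ^^ p) ((F ^^ p) x) = 0 \<Longrightarrow> (F ^^ p) x = 0"
    "\<And>x. \<exists>y. (F ^^ p) x = (F ^^ p) ((F ^^ p) y)"
proof -
  have F: "F \<in> bounded_ops" using assms unfolding power_finite_rank_def by blast
  obtain m where m: "fin_dim (range (F ^^ m))"
    using assms unfolding power_finite_rank_def edim_finite_iff by blast
  interpret invariant_operator UNIV F by (rule invariant_operator_UNIV[OF F])
  obtain d1 where d1: "\<And>j. d1 \<le> j \<Longrightarrow> {r \<in> V m. (F ^^ j) r = 0} = {r \<in> V m. (F ^^ d1) r = 0}"
  proof (rule increasing_chain_stable[of "V m" "\<lambda>j. {r \<in> V m. (F ^^ j) r = 0}"])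
    show "csubspace {r \<in> V m. (F ^^ j) r = 0}" for j by (rule csubspace_kernel[OF pow_bounded csub_V])
  qed (use m in \<open>auto simp: bounded_ops_zero[OF F]\<close>)
  obtain d2 where d2: "m \<le> d2" "\<And>j. d2 \<le> j \<Longrightarrow> V j = V d2"
    using decreasing_chain_stable[of V m, OF m csub_V V_Suc] by blast
  define p where "p = m + d1 + d2 + 3"
  show ?thesis
  proof
    show "3 \<le> p" by (simp add: p_def)
    have "m \<le> p" by (simp add: p_def)
    then show "fin_dim (range (F ^^ p))" using fin_dim_subset[OF m V_antimono] by blast
    show "(F ^^ p) x = 0" if "(F ^^ p) ((F ^^ p) x) = 0" for x
    proof -
      have pm: "F ^^ p = F ^^ (p - m) \<circ> F ^^ m" unfolding funpow_add[symmetric] using \<open>m \<le> p\<close> by simp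
      have "(F ^^ (p + (p - m))) ((F ^^ m) x) = 0" using that unfolding pm funpow_add by simp
      then have "(F ^^ m) x \<in> {r \<in> V m. (F ^^ (p + (p - m))) r = 0}" by blast
      also have "\<dots> = {r \<in> V m. (F ^^ (p - m)) r = 0}"
        using d1[of "p + (p - m)"] d1[of "p - m"] by (simp add: p_def)
      finally show ?thesis unfolding pm by simp
    qed
    have "V p = V (p + p)" using d2(2)[of p] d2(2)[of "p + p"] by (simp add: p_def)
    then show "\<exists>y. (F ^^ p) x = (F ^^ p) ((F ^^ p) y)" for x
      using pow_image_V[of p p] by (metis imageE rangeI)
  qed
qed

lemma comm_wD:
  assumes "T \<in> comm_w F"
  shows "T \<in> bounded_ops" "weakly_commute_on UNIV T F"
proof -
  show "T \<in> bounded_ops" using assms unfolding comm_w_def comm_l_def by blast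
  show "weakly_commute_on UNIV T F"
    using assms unfolding comm_w_def comm_l_def comm_r_def comm_def weakly_commute_on_def
    by (auto simp: fun_eq_iff)
qed

lemma comm_subset_comm_w:
  assumes "F \<in> bounded_ops"
  shows "comm F \<subseteq> comm_w F"
proof
  fix T assume T: "T \<in> comm F"
  then have Tb: "T \<in> bounded_ops" and eq: "F (T x) = T (F x)" for x
    unfolding comm_def by (auto simp: fun_eq_iff)
  have "(\<lambda>x. T (F x)) \<in> bounded_ops" by (rule bounded_ops_compose[OF Tb assms])
  then show "T \<in> comm_w F" unfolding comm_w_def comm_l_def comm_r_def comm_def
    using Tb by (simp add: comp_def eq)
qed

text \<open>For \<open>c = 0\<close> the restriction to \<open>N = ker F\<^sup>p\<close> suffices, as \<open>T\<close> itself commutes weakly with \<open>F\<close>. The shift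
by \<open>c \<noteq> 0\<close> may destroy weak commutation, and \<open>N = ker F\<^sup>p \<inter> ker C\<close> has to be taken, where \<open>T\<close> and \<open>F\<close>
commute; then \<open>C (T - c) = - c C\<close> makes the reduction possible. The operator \<open>D\<close> treats both cases
uniformly.\<close>

theorem power_finite_rank_same_semi_type:
  assumes F: "F \<in> power_finite_rank" and T: "T \<in> comm_w F"
  shows "same_semi_type UNIV (op_shift T c) UNIV (op_shift (op_add T F) c)"
proof -
  have Fb: "F \<in> bounded_ops" using F unfolding power_finite_rank_def by blast
  have Tb: "T \<in> bounded_ops" and wc: "weakly_commute_on UNIV T F" using comm_wD[OF T] by auto
  note wc' = wc[unfolded weakly_commute_on_def, rule_format, OF UNIV_I]
  obtain p where p: "3 \<le> p" "fin_dim (range (F ^^ p))" "\<And>x. (F ^^ p) ((F ^^ p) x) = 0 \<Longrightarrow> (F ^^ p) x = 0"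
    "\<And>x. \<exists>y. (F ^^ p) x = (F ^^ p) ((F ^^ p) y)" using power_finite_rank_fitting[OF F] by metis
  define P where "P = F ^^ p"
  have Pb: "P \<in> bounded_ops" unfolding P_def by (rule bounded_ops_funpow[OF Fb])
  define C where "C = (\<lambda>x. T (F x) - F (T x))"
  define D where "D = (\<lambda>x. if c = 0 then 0 else C x)"
  have Cb: "C \<in> bounded_ops" unfolding C_def
    by (rule bounded_ops_sub[OF bounded_ops_compose[OF Tb Fb] bounded_ops_compose[OF Fb Tb]])
  have Db: "D \<in> bounded_ops" unfolding D_def using Cb bounded_ops_null by (cases "c = 0") auto
  have CF: "C (F x) = 0" and CT: "C (T x) = 0" for x unfolding C_def using wc'[of x] by auto
  define A where "A = op_shift T c"
  define S where "S = op_shift (op_add T F) c"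
  have Ab: "A \<in> bounded_ops" unfolding A_def by (rule bounded_ops_op_shift[OF Tb])
  have Sb: "S \<in> bounded_ops" unfolding S_def by (intro bounded_ops_op_shift bounded_ops_op_add Tb Fb)
  have S_eq: "S x = A x + F x" for x unfolding S_def A_def by (simp add: op_shift_def op_add_def)
  have A_eq: "A x = T x - c *\<^sub>C x" for x unfolding A_def by (simp add: op_shift_def)
  have PT: "P (T x) = T (P x)" for x
    unfolding P_def using weakly_commute_pow[OF weakly_commute_on_sym[OF wc] _ UNIV_I, of p x] p(1) by simp
  have PA: "P (A x) = A (P x)" for x unfolding A_eq using PT by (simp add: bounded_ops_simps[OF Pb])
  have PF: "P (F x) = F (P x)" for x unfolding P_def by (simp add: funpow_swap1)
  have PS: "P (S x) = S (P x)" for x unfolding S_eq by (simp add: bounded_ops_simps[OF Pb] PA PF)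
  have DF: "D (F x) = 0" for x unfolding D_def using CF by simp
  have DP: "D (P x) = 0" for x
  proof -
    obtain l where "p = Suc l" using p(1) by (cases p) auto
    then show ?thesis unfolding P_def using DF by simp
  qed
  have DA: "D (A x) = (- c) *\<^sub>C D x" for x
    unfolding D_def A_eq using CT[of x] by (simp add: bounded_ops_simps[OF Cb])
  have DS: "D (S x) = (- c) *\<^sub>C D x" for x unfolding S_eq using DA DF by (simp add: bounded_ops_simps[OF Db])
  have mu: "- c \<noteq> 0 \<or> (\<forall>x. D x = 0)" unfolding D_def by simp
  define N where "N = {x. P x = 0 \<and> D x = 0}"
  have inA: "A x \<in> N" if "x \<in> N" for x
    using that unfolding N_def by (auto simp: PA DA bounded_ops_zero[OF Ab])
  have inF: "F x \<in> N" if "x \<in> N" for x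
    using that unfolding N_def by (auto simp: PF DF bounded_ops_zero[OF Fb])
  have inS: "S x \<in> N" if "x \<in> N" for x
    using that unfolding N_def by (auto simp: PS DS bounded_ops_zero[OF Sb])
  have N_eq: "N = {x \<in> {x \<in> UNIV. P x = 0}. D x = 0}" unfolding N_def by blast
  have csN: "csubspace N" unfolding N_eq by (intro csubspace_kernel Db Pb complex_vector.subspace_UNIV)
  have clN: "closed N" unfolding N_eq by (intro closed_kernel Db Pb closed_UNIV)
  have wA: "weakly_commute_on N A F"
  proof (cases "c = 0")
    case True
    then have "A = T" by (simp add: fun_eq_iff A_eq)
    then show ?thesis using wc unfolding weakly_commute_on_def by blast
  next
    case False
    have "A (F x) = F (A x)" if "x \<in> N" for x
      using that False unfolding N_def D_def C_def A_eq by (auto simp: bounded_ops_simps[OF Fb])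
    then show ?thesis unfolding weakly_commute_on_def using inA inF by simp
  qed
  have wS: "weakly_commute_on N S F"
    using wA unfolding weakly_commute_on_def S_eq
    by (simp add: bounded_ops_simps[OF Ab] bounded_ops_simps[OF Fb] algebra_simps)
  have nil: "(F ^^ p) x = 0" if "x \<in> N" for x using that unfolding N_def P_def by simp
  have "divides_power N (\<lambda>x. S x - F x) S"
    by (rule divides_power_nilpotent_perturbation[OF Sb Fb csN inS inF wS p(1) nil])
  then have 1: "divides_power N A S" unfolding S_eq by simp
  have "((\<lambda>x. - F x) ^^ n) x = (- 1) ^ n *\<^sub>C (F ^^ n) x" for n x
    by (induction n) (auto simp: bounded_ops_simps[OF Fb] scaleC_one)
  then have "((\<lambda>x. - F x) ^^ p) x = 0" if "x \<in> N" for x using nil[OF that] by simp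
  moreover have "weakly_commute_on N A (\<lambda>x. - F x)"
    using wA unfolding weakly_commute_on_def by (simp add: bounded_ops_simps[OF Ab] bounded_ops_simps[OF Fb])
  ultimately have "divides_power N (\<lambda>x. A x - - F x) A"
    using divides_power_nilpotent_perturbation[OF Ab bounded_ops_uminus[OF Fb] csN inA _ _ p(1)]
      inF complex_vector.subspace_neg[OF csN] by blast
  moreover have "(\<lambda>x. A x - - F x) = S" by (simp add: fun_eq_iff S_eq)
  ultimately have 2: "divides_power N S A" by simp
  have "same_semi_type N A N S"
    using 1 2 Ab Sb csN clN inA inS by (intro same_semi_type_if_divides_power) (auto simp: invariant_operator_def)
  moreover have "same_semi_type UNIV A N A" unfolding N_def
    by (rule same_semi_type_reduction[OF Ab Pb Db p(2)[folded P_def] PA p(3,4)[folded P_def] DP DA mu])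
  moreover have "same_semi_type UNIV S N S" unfolding N_def
    by (rule same_semi_type_reduction[OF Sb Pb Db p(2)[folded P_def] PS p(3,4)[folded P_def] DP DS mu])
  ultimately show ?thesis unfolding same_semi_type_def A_def S_def by blast
qed

section \<open>The Hahn-Banach theorem\<close>

definition sublinear :: "('a::real_vector \<Rightarrow> real) \<Rightarrow> bool" where
  "sublinear q \<longleftrightarrow> (\<forall>x y. q (x + y) \<le> q x + q y) \<and> (\<forall>t\<ge>0. \<forall>x. q (t *\<^sub>R x) = t * q x)"

lemma sublinear_add: "sublinear q \<Longrightarrow> q (x + y) \<le> q x + q y"
  and sublinear_scale: "sublinear q \<Longrightarrow> 0 \<le> t \<Longrightarrow> q (t *\<^sub>R x) = t * q x"
  unfolding sublinear_def by blast+

lemma sublinear_zero: "sublinear q \<Longrightarrow> q 0 = 0"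
  using sublinear_scale[of q 0 0] by simp

lemma sublinear_minus: "sublinear q \<Longrightarrow> - q (- x) \<le> q x"
  using sublinear_add[of q x "- x"] sublinear_zero[of q] by simp

lemma sublinearI:
  assumes add: "\<And>x y. q (x + y) \<le> q x + q y" and zero: "q 0 = 0"
    and scale: "\<And>t x. 0 < t \<Longrightarrow> q (t *\<^sub>R x) \<le> t * q x"
  shows "sublinear q"
proof -
  have "q (t *\<^sub>R x) = t * q x" if "0 \<le> t" for t x
  proof (cases "t = 0")
    case False
    then have t: "0 < t" using that by simp
    have "q (inverse t *\<^sub>R (t *\<^sub>R x)) \<le> inverse t * q (t *\<^sub>R x)" using t by (intro scale) simp
    then have "t * q x \<le> q (t *\<^sub>R x)" using t by (simp add: field_simps)
    then show ?thesis using scale[OF t, of x] by simp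
  qed (simp add: zero)
  then show ?thesis unfolding sublinear_def using add by blast
qed

text \<open>The largest sublinear function below \<open>q\<close> whose value at \<open>- z\<close> is at most \<open>- q z\<close>.\<close>

definition sublinear_shift :: "('a::real_vector \<Rightarrow> real) \<Rightarrow> 'a \<Rightarrow> 'a \<Rightarrow> real" where
  "sublinear_shift q z x = (INF t\<in>{0..}. q (x + t *\<^sub>R z) - t * q z)"

context
  fixes q :: "'a::real_vector \<Rightarrow> real" and z :: 'a
  assumes q: "sublinear q"
begin

lemma sublinear_shift_bdd: "bdd_below ((\<lambda>t. q (x + t *\<^sub>R z) - t * q z) ` {0..})"
proof (rule bdd_belowI2)
  fix t :: real assume t: "t \<in> {0..}"
  have "q (t *\<^sub>R z) \<le> q (x + t *\<^sub>R z) + q (- x)" using sublinear_add[OF q, of "x + t *\<^sub>R z" "- x"] by simp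
  then show "- q (- x) \<le> q (x + t *\<^sub>R z) - t * q z" using t sublinear_scale[OF q] by simp
qed

lemma sublinear_shift_le: "0 \<le> t \<Longrightarrow> sublinear_shift q z x \<le> q (x + t *\<^sub>R z) - t * q z"
  unfolding sublinear_shift_def by (rule cINF_lower[OF sublinear_shift_bdd]) simp

lemma sublinear_shift_greatest:
  "(\<And>t. 0 \<le> t \<Longrightarrow> c \<le> q (x + t *\<^sub>R z) - t * q z) \<Longrightarrow> c \<le> sublinear_shift q z x"
  unfolding sublinear_shift_def by (rule cINF_greatest) auto

lemma sublinear_shift_le_original: "sublinear_shift q z x \<le> q x"
  using sublinear_shift_le[of 0] by simp

lemma sublinear_shift_minus: "sublinear_shift q z (- z) \<le> - q z"
  using sublinear_shift_le[of 1 "- z"] sublinear_zero[OF q] by simp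

lemma sublinear_sublinear_shift: "sublinear (sublinear_shift q z)"
proof (rule sublinearI)
  fix x y
  have "sublinear_shift q z (x + y) - (q (y + t *\<^sub>R z) - t * q z) \<le> sublinear_shift q z x" if t: "0 \<le> t" for t
  proof (rule sublinear_shift_greatest)
    fix s :: real assume s: "0 \<le> s"
    have "sublinear_shift q z (x + y) \<le> q (x + y + (s + t) *\<^sub>R z) - (s + t) * q z"
      using s t by (intro sublinear_shift_le) simp
    also have "x + y + (s + t) *\<^sub>R z = (x + s *\<^sub>R z) + (y + t *\<^sub>R z)" by (simp add: algebra_simps)
    finally show "sublinear_shift q z (x + y) - (q (y + t *\<^sub>R z) - t * q z) \<le> q (x + s *\<^sub>R z) - s * q z"
      using sublinear_add[OF q, of "x + s *\<^sub>R z" "y + t *\<^sub>R z"] by (simp add: algebra_simps)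
  qed
  then have "sublinear_shift q z (x + y) - sublinear_shift q z x \<le> sublinear_shift q z y"
    by (intro sublinear_shift_greatest) (simp add: algebra_simps)
  then show "sublinear_shift q z (x + y) \<le> sublinear_shift q z x + sublinear_shift q z y" by simp
next
  have "0 \<le> sublinear_shift q z 0"
    by (rule sublinear_shift_greatest) (simp add: sublinear_scale[OF q])
  then show "sublinear_shift q z 0 = 0"
    using sublinear_shift_le_original[of 0] sublinear_zero[OF q] by simp
next
  fix a :: real and x assume a: "0 < a"
  have "sublinear_shift q z (a *\<^sub>R x) / a \<le> sublinear_shift q z x"
  proof (rule sublinear_shift_greatest)
    fix t :: real assume t: "0 \<le> t"
    have "sublinear_shift q z (a *\<^sub>R x) \<le> q (a *\<^sub>R x + (a * t) *\<^sub>R z) - (a * t) * q z"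
      using a t by (intro sublinear_shift_le) simp
    also have "a *\<^sub>R x + (a * t) *\<^sub>R z = a *\<^sub>R (x + t *\<^sub>R z)" by (simp add: scaleR_add_right)
    also have "q (a *\<^sub>R (x + t *\<^sub>R z)) = a * q (x + t *\<^sub>R z)" using a by (intro sublinear_scale[OF q]) simp
    finally show "sublinear_shift q z (a *\<^sub>R x) / a \<le> q (x + t *\<^sub>R z) - t * q z"
      using a by (simp add: field_simps del: scaleR_add_right)
  qed
  then show "sublinear_shift q z (a *\<^sub>R x) \<le> a * sublinear_shift q z x" using a by (simp add: field_simps)
qed

end

text \<open>A minimal sublinear function equals all its shifts. Hence it is odd, and an odd sublinear function is
linear. Zorn's lemma is thus applied to sublinear functions instead of partial extensions of a functional.\<close>

lemma minimal_sublinear_linear: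
  assumes m: "sublinear m" and min: "\<And>p. sublinear p \<Longrightarrow> p \<le> m \<Longrightarrow> p = m"
  shows "linear m"
proof -
  have "sublinear_shift m y = m" for y
    using min[OF sublinear_sublinear_shift[OF m]] sublinear_shift_le_original[OF m] by (simp add: le_fun_def)
  then have "m (- y) \<le> - m y" for y using sublinear_shift_minus[OF m, of y] by simp
  then have neg: "m (- y) = - m y" for y using sublinear_minus[OF m, of "- y"] by (simp add: order_antisym)
  show ?thesis
  proof (rule linearI)
    fix x y
    have "m (- (x + y)) \<le> m (- x) + m (- y)" using sublinear_add[OF m, of "- x" "- y"] by simp
    then show "m (x + y) = m x + m y" using sublinear_add[OF m, of x y] unfolding neg by simp
  next
    fix r x
    show "m (r *\<^sub>R x) = r *\<^sub>R m x"
      using sublinear_scale[OF m, of r x] sublinear_scale[OF m, of "- r" x] neg[of "r *\<^sub>R x"]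
      by (cases "0 \<le> r") auto
  qed
qed

lemma minimal_sublinear_exists:
  assumes q: "sublinear q"
  obtains m where "sublinear m" "m \<le> q" "\<And>p. sublinear p \<Longrightarrow> p \<le> m \<Longrightarrow> p = m"
proof -
  define S where "S = {p. sublinear p \<and> p \<le> q}"
  have low: "- q (- x) \<le> p x" if "p \<in> S" for p x
    using sublinear_minus[of p x] that le_funD[of p q "- x"] unfolding S_def by force
  have "\<exists>m\<in>S. \<forall>p\<in>S. p \<le> m \<longrightarrow> p = m"
  proof (rule predicate_Zorn[of S "\<lambda>a b. b \<le> a"])
    show "partial_order_on S (relation_of (\<lambda>a b. b \<le> a) S)"
      by (rule partial_order_on_relation_ofI) auto
    show "\<exists>u\<in>S. \<forall>a\<in>C. u \<le> a" if C: "C \<in> Chains (relation_of (\<lambda>a b. b \<le> a) S)" for C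
    proof (cases "C = {}")
      case True
      then show ?thesis using q unfolding S_def by blast
    next
      case False
      have CS: "C \<subseteq> S" and tot: "\<And>a b. a \<in> C \<Longrightarrow> b \<in> C \<Longrightarrow> a \<le> b \<or> b \<le> a"
        using C unfolding Chains_def relation_of_def by auto
      define u where "u = (\<lambda>x. INF p\<in>C. p x)"
      have bdd: "bdd_below ((\<lambda>p. p x) ` C)" for x
        using low CS by (intro bdd_belowI2[where m = "- q (- x)"]) blast
      have le: "u x \<le> p x" if "p \<in> C" for p x unfolding u_def by (rule cINF_lower[OF bdd that])
      have gr: "c \<le> u x" if "\<And>p. p \<in> C \<Longrightarrow> c \<le> p x" for c x unfolding u_def
        by (rule cINF_greatest[OF False]) (rule that)
      have "sublinear u"
      proof (rule sublinearI)
        fix x y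
        have "u (x + y) - p y \<le> u x" if p: "p \<in> C" for p
        proof (rule gr)
          fix p' assume p': "p' \<in> C"
          obtain r where r: "r \<in> C" "r \<le> p" "r \<le> p'" using tot[OF p p'] p p' by blast
          have "u (x + y) \<le> r (x + y)" by (rule le[OF r(1)])
          also have "\<dots> \<le> r x + r y" using r(1) CS sublinear_add unfolding S_def by blast
          also have "\<dots> \<le> p' x + p y" using r(2,3) by (simp add: le_funD add_mono)
          finally show "u (x + y) - p y \<le> p' x" by simp
        qed
        then have "u (x + y) - u x \<le> u y" by (intro gr) (simp add: algebra_simps)
        then show "u (x + y) \<le> u x + u y" by simp
      next
        have z: "p 0 = 0" if "p \<in> C" for p using that CS sublinear_zero unfolding S_def by blast
        obtain p where "p \<in> C" using False by blast
        then show "u 0 = 0" using le[of p 0] gr[of 0 0] z by fastforce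
      next
        fix t :: real and x assume t: "0 < t"
        have "u (t *\<^sub>R x) / t \<le> u x"
        proof (rule gr)
          fix p assume p: "p \<in> C"
          have "u (t *\<^sub>R x) \<le> p (t *\<^sub>R x)" by (rule le[OF p])
          also have "\<dots> = t * p x" using p CS t sublinear_scale[of p t x] unfolding S_def by auto
          finally show "u (t *\<^sub>R x) / t \<le> p x" using t by (simp add: field_simps)
        qed
        then show "u (t *\<^sub>R x) \<le> t * u x" using t by (simp add: field_simps)
      qed
      moreover have "u \<le> q"
      proof -
        obtain p where p: "p \<in> C" using False by blast
        then have "p \<le> q" using CS unfolding S_def by blast
        then show ?thesis using le[OF p] by (metis le_fun_def order_trans)
      qed
      ultimately have "u \<in> S" unfolding S_def by blast
      moreover have "\<forall>a\<in>C. u \<le> a" using le by (simp add: le_fun_def)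
      ultimately show ?thesis by blast
    qed
  qed
  then obtain m where m: "m \<in> S" "\<forall>p\<in>S. p \<le> m \<longrightarrow> p = m" by blast
  show ?thesis
  proof
    show "sublinear m" "m \<le> q" using m(1) unfolding S_def by auto
    show "p = m" if "sublinear p" "p \<le> m" for p
      using m that \<open>m \<le> q\<close> order_trans[of p m q] unfolding S_def by blast
  qed
qed

text \<open>A minimal function below the shift of \<open>q\<close> by \<open>z\<close> is linear and attains the value \<open>q z\<close> at \<open>z\<close>.\<close>

theorem Hahn_Banach_sublinear:
  assumes q: "sublinear q"
  obtains f where "linear f" "\<And>x. f x \<le> q x" "f z = q z"
proof -
  obtain m where m: "sublinear m" "m \<le> sublinear_shift q z" "\<And>p. sublinear p \<Longrightarrow> p \<le> m \<Longrightarrow> p = m"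
    using minimal_sublinear_exists[OF sublinear_sublinear_shift[OF q]] by metis
  have lin: "linear m" using minimal_sublinear_linear[OF m(1,3)] by blast
  have le: "m x \<le> q x" for x
    using le_funD[OF m(2)] sublinear_shift_le_original[OF q] by (rule order_trans)
  have "m (- z) \<le> - q z" using le_funD[OF m(2)] sublinear_shift_minus[OF q] by (rule order_trans)
  then have "m z = q z" using le[of z] linear_neg[OF lin, of z] by simp
  then show ?thesis using that lin le by blast
qed

lemma sublinear_infdist:
  assumes W: "subspace (W :: 'a::real_normed_vector set)"
  shows "sublinear (\<lambda>x. infdist x W)"
proof -
  have ne: "W \<noteq> {}" using W subspace_0 by blast
  have approx: "\<exists>w\<in>W. dist x w < infdist x W + e" if e: "0 < e" for x e
  proof (rule ccontr)
    assume "\<not> ?thesis"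
    then have "infdist x W + e \<le> infdist x W"
      unfolding infdist_notempty[OF ne] by (intro cINF_greatest[OF ne]) force
    then show False using e by simp
  qed
  show ?thesis
  proof (rule sublinearI)
    fix x y
    show "infdist (x + y) W \<le> infdist x W + infdist y W"
    proof (rule field_le_epsilon)
      fix e :: real assume "0 < e"
      then obtain v w where vw: "v \<in> W" "w \<in> W" "dist x v < infdist x W + e/2" "dist y w < infdist y W + e/2"
        using approx[of "e/2"] by (meson half_gt_zero)
      have "infdist (x + y) W \<le> dist (x + y) (v + w)" by (rule infdist_le[OF subspace_add[OF W vw(1,2)]])
      also have "\<dots> \<le> dist x v + dist y w" by (rule dist_triangle_add)
      finally show "infdist (x + y) W \<le> infdist x W + infdist y W + e" using vw by simp
    qed
  next
    show "infdist 0 W = 0" using subspace_0[OF W] by simp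
  next
    fix t :: real and x assume t: "0 < t"
    show "infdist (t *\<^sub>R x) W \<le> t * infdist x W"
    proof (rule field_le_epsilon)
      fix e :: real assume "0 < e"
      then obtain w where w: "w \<in> W" "dist x w < infdist x W + e / t" using approx[of "e/t" x] t by auto
      have "infdist (t *\<^sub>R x) W \<le> dist (t *\<^sub>R x) (t *\<^sub>R w)" by (rule infdist_le[OF subspace_scale[OF W w(1)]])
      also have "\<dots> = t * dist x w" using t by (simp add: dist_norm scaleR_diff_right[symmetric])
      finally show "infdist (t *\<^sub>R x) W \<le> t * infdist x W + e"
        using w(2) t mult_strict_left_mono[OF w(2) t] by (simp add: field_simps)
    qed
  qed
qed

definition cfunctional :: "('a::complex_banach \<Rightarrow> complex) \<Rightarrow> bool" where
  "cfunctional h \<longleftrightarrow> bounded_linear h \<and> (\<forall>c x. h (c *\<^sub>C x) = c * h x)"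

text \<open>The distance from \<open>W\<close> is sublinear and positive at \<open>z\<close>. A real functional \<open>f\<close> below it, with the
same value at \<open>z\<close>, vanishes on \<open>W\<close>, and so does the complex functional \<open>f x - \<i> f (\<i> x)\<close> because \<open>W\<close> is a complex subspace.\<close>

theorem Hahn_Banach_separation:
  assumes W: "csubspace W" "closed W" and z: "z \<notin> W"
  obtains h where "cfunctional h" "\<And>w. w \<in> W \<Longrightarrow> h w = 0" "h z = 1"
proof -
  define q where "q = (\<lambda>x. infdist x W)"
  have sW: "subspace W" by (rule csubspace_real[OF W(1)])
  have ne: "W \<noteq> {}" using sW subspace_0 by blast
  have q: "sublinear q" unfolding q_def by (rule sublinear_infdist[OF sW])
  obtain f where f: "linear f" "\<And>x. f x \<le> q x" "f z = q z" using Hahn_Banach_sublinear[OF q] by metis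
  have fz: "f z \<noteq> 0" unfolding f(3) q_def using z W(2) in_closed_iff_infdist_zero[OF W(2) ne] by blast
  have "q x \<le> norm x" for x unfolding q_def using infdist_le[OF subspace_0[OF sW], of x] by simp
  then have fle: "f x \<le> norm x" for x using f(2) order_trans by blast
  have fabs: "\<bar>f x\<bar> \<le> norm x" for x using fle[of x] fle[of "- x"] linear_neg[OF f(1), of x] by simp
  have fW: "f w = 0" if "w \<in> W" for w
  proof -
    have "q w = 0" "q (- w) = 0" unfolding q_def using that subspace_neg[OF sW that] by simp_all
    then show ?thesis using f(2)[of w] f(2)[of "- w"] linear_neg[OF f(1), of w] by simp
  qed
  define g where "g = (\<lambda>x. Complex (f x) (- f (\<i> *\<^sub>C x)))"
  have gadd: "g (x + y) = g x + g y" for x y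
    unfolding g_def by (simp add: scaleC_add_right linear_add[OF f(1)] complex_eq_iff)
  have gR: "g (complex_of_real r *\<^sub>C x) = complex_of_real r * g x" for r x
  proof -
    have "\<i> *\<^sub>C complex_of_real r *\<^sub>C x = r *\<^sub>R (\<i> *\<^sub>C x)"
      by (simp add: scaleR_scaleC scaleC_scaleC mult.commute)
    then show ?thesis unfolding g_def
      by (simp add: linear_scale[OF f(1)] scaleR_scaleC[symmetric] complex_eq_iff)
  qed
  have gi: "g (\<i> *\<^sub>C x) = \<i> * g x" for x
  proof -
    have "\<i> *\<^sub>C \<i> *\<^sub>C x = - x" using complex_vector.scale_minus_left[of 1 x] by (simp add: scaleC_scaleC scaleC_one)
    then show ?thesis unfolding g_def by (simp add: linear_neg[OF f(1)] complex_eq_iff)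
  qed
  have gC: "g (c *\<^sub>C x) = c * g x" for c x
  proof -
    have c: "c = complex_of_real (Re c) + complex_of_real (Im c) * \<i>" by (simp add: complex_eq_iff)
    have "g (c *\<^sub>C x) = g (complex_of_real (Re c) *\<^sub>C x + complex_of_real (Im c) *\<^sub>C (\<i> *\<^sub>C x))"
      by (subst c) (simp only: scaleC_add_left scaleC_scaleC)
    also have "\<dots> = (complex_of_real (Re c) + complex_of_real (Im c) * \<i>) * g x"
      by (simp only: gadd gR gi) (simp add: algebra_simps)
    finally show ?thesis using c by simp
  qed
  have gz: "g z \<noteq> 0" using fz unfolding g_def by (simp add: complex_eq_iff)
  have gn: "norm (g x) \<le> 2 * norm x" for x
  proof -
    have "norm (g x) \<le> \<bar>f x\<bar> + \<bar>f (\<i> *\<^sub>C x)\<bar>" unfolding g_def using cmod_le[of "Complex (f x) (- f (\<i> *\<^sub>C x))"] by simp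
    also have "\<dots> \<le> norm x + norm (\<i> *\<^sub>C x)" by (intro add_mono fabs)
    finally show ?thesis by (simp add: norm_scaleC)
  qed
  define h where "h = (\<lambda>x. g x / g z)"
  have "bounded_linear h"
  proof (rule bounded_linear_intro[where K = "2 / norm (g z)"])
    show "h (x + y) = h x + h y" for x y unfolding h_def by (simp add: gadd add_divide_distrib)
    show "h (r *\<^sub>R x) = r *\<^sub>R h x" for r x unfolding h_def scaleR_scaleC gR by (simp add: scaleR_conv_of_real)
    show "norm (h x) \<le> norm x * (2 / norm (g z))" for x
      unfolding h_def using gn[of x] gz by (simp add: norm_divide field_simps)
  qed
  then have "cfunctional h" unfolding cfunctional_def h_def by (simp add: gC)
  moreover have "h w = 0" if "w \<in> W" for w
    unfolding h_def g_def using fW[OF that] fW[OF complex_vector.subspace_scale[OF W(1) that]]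
    by (simp add: zero_complex.code[symmetric])
  moreover have "h z = 1" unfolding h_def using gz by simp
  ultimately show ?thesis using that by blast
qed

section \<open>Limits of invertible operators\<close>

lemma surj_from_ex: "(\<And>y. \<exists>x. f x = y) \<Longrightarrow> surj f"
  by (metis surjI)

text \<open>The kernel of \<open>A\<close> in a range \<open>V\<^sub>d\<close> survives in all later ranges. Operators in either
semi-B-Fredholm class have this property, and it is all that the argument on limits of invertible
operators uses.\<close>

definition quasi_fredholm :: "('a::complex_banach \<Rightarrow> 'a) \<Rightarrow> bool" where
  "quasi_fredholm A \<longleftrightarrow> (\<exists>d. (\<forall>x j. x \<in> range (A ^^ d) \<longrightarrow> A x = 0 \<longrightarrow> x \<in> range (A ^^ j))
     \<and> (\<forall>j\<ge>d. closed (range (A ^^ j))))"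

context
  fixes A :: "'a::complex_banach \<Rightarrow> 'a"
  assumes A: "A \<in> bounded_ops"
begin

interpretation invariant_operator UNIV A
  by (rule invariant_operator_UNIV[OF A])

lemma semi_upper_imp_quasi_fredholm:
  assumes "semi_upper UNIV A"
  shows "quasi_fredholm A"
proof -
  obtain k where k: "\<And>j. k \<le> j \<Longrightarrow> fin_dim {x \<in> V j. A x = 0}" "\<And>j. k \<le> j \<Longrightarrow> closed (V j)"
    using assms unfolding semi_upper_iff by blast
  obtain d where d: "k \<le> d" "\<And>j. d \<le> j \<Longrightarrow> {x \<in> V j. A x = 0} = {x \<in> V d. A x = 0}"
    using decreasing_chain_stable[of "\<lambda>j. {x \<in> V j. A x = 0}" k, OF k(1)[OF order_refl]
        csubspace_kernel[OF A csub_V] kernel_antimono[OF le_SucI[OF order_refl]]] by blast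
  have "x \<in> V j" if x: "x \<in> V d" "A x = 0" for x j
  proof (cases "d \<le> j")
    case True
    then show ?thesis using d(2)[OF True] x by blast
  next
    case False
    then show ?thesis using V_antimono[of j d] x(1) by auto
  qed
  then show ?thesis unfolding quasi_fredholm_def using k(2) d(1) le_trans[OF d(1)] by blast
qed

text \<open>Let \<open>V\<^sub>k = V\<^sub>k\<^sub>+\<^sub>1 + E\<close>. The vectors of \<open>E\<close> that \<open>A\<^sup>j\<close> maps into \<open>V\<^sub>k\<^sub>+\<^sub>j\<^sub>+\<^sub>1\<close> form an increasing chain of
subspaces \<open>W j\<close>. A vector of \<open>ker A \<inter> V\<^sub>k\<^sub>+\<^sub>j\<close> is, modulo the next range, the image under \<open>A\<^sup>j\<close> of a
vector of \<open>W (Suc j)\<close>. Where the chain has become constant, this is a vector of \<open>W j\<close>, and the image lies in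
the next range, too.\<close>

lemma semi_lower_imp_quasi_fredholm:
  assumes "semi_lower UNIV A"
  shows "quasi_fredholm A"
proof -
  obtain k where k: "\<And>j. k \<le> j \<Longrightarrow> fin_codim (V j) (V (Suc j))" "\<And>j. k \<le> j \<Longrightarrow> closed (V j)"
    using assms unfolding semi_lower_iff_Suc by blast
  obtain E where E: "csubspace E" "fin_dim E" "V k = V (Suc k) + E"
    using fin_codim_complement[OF k(1)[OF order_refl] csub_V csub_V V_Suc] by metis
  define W where "W = (\<lambda>j. {e \<in> E. (A ^^ j) e \<in> V (Suc (k + j))})"
  obtain d where d: "\<And>j. d \<le> j \<Longrightarrow> W j = W d"
  proof (rule increasing_chain_stable[of E W])
    show "csubspace (W j)" for j unfolding W_def by (rule csubspace_preimage[OF pow_bounded E(1) csub_V])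
    show "W j \<subseteq> W (Suc j)" for j unfolding W_def using image_V[of "Suc (k + j)"] by auto
  qed (use E in \<open>auto simp: W_def\<close>)
  have step: "x \<in> V (Suc (k + j))" if j: "d \<le> j" and x: "x \<in> V (k + j)" "A x = 0" for x j
  proof -
    obtain v where v: "v \<in> V k" "x = (A ^^ j) v" using x(1) pow_image_V[of j k] by (auto simp: add.commute)
    obtain w e where we: "w \<in> V (Suc k)" "e \<in> E" "v = w + e" using v(1) unfolding E(3) by (rule set_plusE)
    have w: "(A ^^ i) w \<in> V (Suc (k + i))" for i
      using we(1) pow_image_V[of i "Suc k"] by (metis add.commute add_Suc_right imageI)
    have xe: "x = (A ^^ j) w + (A ^^ j) e" using v we by (simp add: bounded_ops_simps[OF pow_bounded])
    then have "(A ^^ Suc j) e = - (A ^^ Suc j) w"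
      using x(2) by (simp add: bounded_ops_simps[OF A] add_eq_0_iff)
    then have "(A ^^ Suc j) e \<in> V (Suc (k + Suc j))"
      using w[of "Suc j"] complex_vector.subspace_neg[OF csub_V] by metis
    then have "e \<in> W (Suc j)" using we(2) unfolding W_def by blast
    then have "e \<in> W j" using d[of j] d[of "Suc j"] j by simp
    then show ?thesis using xe w[of j] complex_vector.subspace_add[OF csub_V] unfolding W_def by blast
  qed
  have up: "x \<in> V (k + d + i)" if x: "x \<in> V (k + d)" "A x = 0" for x i
  proof (induction i)
    case (Suc i)
    then show ?case using step[of "d + i" x] x(2) by (simp add: add.assoc)
  qed (use x in simp)
  have "x \<in> V j" if x: "x \<in> V (k + d)" "A x = 0" for x j
    using up[OF x, of j] V_antimono[of j "k + d + j"] by auto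
  then show ?thesis unfolding quasi_fredholm_def using k(2) by (intro exI[of _ "k + d"]) auto
qed

text \<open>On the intersection \<open>R\<close> of all ranges \<open>A\<close> is surjective. A nonzero kernel vector in \<open>R\<close> would therefore
give rise to eigenvectors for all small \<open>\<mu>\<close>, contrary to the hypothesis; this bounds the ascent. Then \<open>A\<close>
is bounded below on \<open>V d\<close>, and the solutions \<open>x \<in> V d\<close> of \<open>(A - \<mu>) x = y\<close> remain bounded as \<open>\<mu>\<close> tends
to \<open>0\<close>. So \<open>A x\<close> tends to \<open>y\<close>, and the range \<open>V (Suc d)\<close>, being closed, contains all of \<open>V d\<close>.\<close>

lemma quasi_fredholm_limit_of_invertible:
  assumes qf: "quasi_fredholm A"
    and inv: "\<And>e. 0 < e \<Longrightarrow> \<exists>\<mu>. \<mu> \<noteq> 0 \<and> cmod \<mu> < e \<and> bij (op_shift A \<mu>)"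
  shows "finite_ascent UNIV A" "finite_descent UNIV A"
proof -
  obtain d where d: "\<And>x j. x \<in> V d \<Longrightarrow> A x = 0 \<Longrightarrow> x \<in> V j" "\<And>j. d \<le> j \<Longrightarrow> closed (V j)"
    using qf unfolding quasi_fredholm_def by blast
  define R where "R = (\<Inter>j. V j)"
  have csR: "csubspace R" unfolding R_def using csub_V by (intro complex_vector.subspace_Inter) auto
  have "R = (\<Inter>j\<in>{d..}. V j)"
  proof
    show "(\<Inter>j\<in>{d..}. V j) \<subseteq> R"
    proof
      fix x assume x: "x \<in> (\<Inter>j\<in>{d..}. V j)"
      have "x \<in> V j" for j using INT_D[OF x, of "d + j"] V_antimono[of j "d + j"] by auto
      then show "x \<in> R" unfolding R_def by blast
    qed
  qed (auto simp: R_def)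
  then have clR: "closed R" using d(2) by auto
  have AR: "A ` R = R"
  proof
    show "A ` R \<subseteq> R"
    proof
      fix y assume "y \<in> A ` R"
      then obtain x where x: "y = A x" "\<And>j. x \<in> V j" unfolding R_def by blast
      have "y \<in> V j" for j using x image_V[of j] V_Suc[of j] by blast
      then show "y \<in> R" unfolding R_def by blast
    qed
    show "R \<subseteq> A ` R"
    proof
      fix x assume x: "x \<in> R"
      then have xV: "x \<in> A ` V j" for j unfolding R_def image_V by blast
      then obtain y where y: "y \<in> V d" "x = A y" by blast
      have "y \<in> V j" for j
      proof -
        obtain z where z: "z \<in> V (d + j)" "x = A z" using xV by blast
        have zd: "z \<in> V d" "z \<in> V j" using z(1) V_antimono[of d "d + j"] V_antimono[of j "d + j"] by auto
        have "y - z \<in> V d" using y zd complex_vector.subspace_diff[OF csub_V] by blast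
        moreover have "A (y - z) = 0" using y z by (simp add: bounded_ops_simps[OF A])
        ultimately have "y - z \<in> V j" by (rule d(1))
        then show ?thesis using zd complex_vector.subspace_add[OF csub_V, of "y - z" j z] by simp
      qed
      then show "x \<in> A ` R" using y unfolding R_def by blast
    qed
  qed
  have inj: "x0 = 0" if x0: "x0 \<in> V d" "A x0 = 0" for x0
  proof (rule ccontr)
    assume ne: "x0 \<noteq> 0"
    have x0R: "x0 \<in> R" unfolding R_def using d(1)[OF x0] by blast
    obtain C where C: "C > 0" "\<And>y. y \<in> A ` R \<Longrightarrow> \<exists>x\<in>R. A x = y \<and> norm x \<le> C * norm y"
      using open_mapping_bound[OF bounded_ops_bounded_linear[OF A] csubspace_real[OF csR] clR] clR AR by metis
    then obtain g where g: "\<And>y. y \<in> R \<Longrightarrow> g y \<in> R \<and> A (g y) = y \<and> norm (g y) \<le> C * norm y"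
      unfolding AR by metis
    \<comment> \<open>Iterated preimages of \<open>x0\<close>; \<open>u = \<Sum> \<mu>\<^sup>k x\<^sub>k\<close> is an eigenvector for \<open>\<mu>\<close>, and the ratio \<open>1/3\<close> of the
      majorant guarantees that the first term dominates the rest.\<close>
    define x where "x = (\<lambda>k. (g ^^ k) x0)"
    have xR: "x k \<in> R \<and> norm (x k) \<le> C ^ k * norm x0" for k
    proof (induction k)
      case (Suc k)
      have "norm (x (Suc k)) \<le> C * norm (x k)" using g Suc unfolding x_def by simp
      also have "\<dots> \<le> C * (C ^ k * norm x0)" using Suc C by simp
      finally show ?case using g Suc unfolding x_def by (simp add: mult.assoc)
    qed (simp add: x_def x0R)
    have xS: "A (x (Suc k)) = x k" for k using g xR[of k] unfolding x_def by simp
    obtain \<mu> where \<mu>: "\<mu> \<noteq> 0" "cmod \<mu> < 1 / (3 * C)" "bij (op_shift A \<mu>)"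
      using inv[of "1 / (3 * C)"] C by auto
    define t where "t = (\<lambda>k. \<mu> ^ k *\<^sub>C x k)"
    have tn: "norm (t k) \<le> (1/3) ^ k * norm x0" for k
    proof -
      have "norm (t k) \<le> cmod \<mu> ^ k * (C ^ k * norm x0)"
        unfolding t_def norm_scaleC norm_power using xR[of k] by (intro mult_left_mono) auto
      also have "\<dots> = (cmod \<mu> * C) ^ k * norm x0" by (simp add: power_mult_distrib)
      also have "\<dots> \<le> (1/3) ^ k * norm x0"
        using \<mu>(2) C(1) by (intro mult_right_mono power_mono) (auto simp: field_simps)
      finally show ?thesis .
    qed
    have gs: "summable (\<lambda>k. (1/3::real) ^ k * norm x0)" by (intro summable_mult2 summable_geometric) simp
    have ts: "summable t" by (rule summable_comparison_test[OF _ gs]) (use tn in auto)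
    define u where "u = suminf t"
    have At: "A (t 0) = 0" "A (t (Suc k)) = \<mu> *\<^sub>C t k" for k
      unfolding t_def using x0(2) xS by (simp_all add: bounded_ops_simps[OF A] x_def scaleC_scaleC)
    interpret A: bounded_linear A by (rule bounded_ops_bounded_linear[OF A])
    interpret mu: bounded_linear "\<lambda>x. \<mu> *\<^sub>C x" by (rule bounded_linear_scaleC)
    have "A u = (\<Sum>k. A (t k))" unfolding u_def by (rule A.suminf[OF ts])
    also have "\<dots> = (\<Sum>k. A (t (Suc k)))"
      using suminf_split_head[OF A.summable[OF ts]] At(1) by simp
    also have "\<dots> = \<mu> *\<^sub>C u" unfolding At u_def by (rule mu.suminf[OF ts, symmetric])
    finally have "op_shift A \<mu> u = op_shift A \<mu> 0" by (simp add: op_shift_def bounded_ops_zero[OF A])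
    then have "u = 0" using \<mu>(3) by (metis bij_is_inj injD)
    moreover have "u = x0 + (\<Sum>k. t (Suc k))"
      unfolding u_def using suminf_split_head[OF ts] by (simp add: t_def x_def scaleC_one)
    ultimately have "norm x0 = norm (\<Sum>k. t (Suc k))" by (metis add_eq_0_iff norm_minus_cancel)
    also have "\<dots> \<le> (\<Sum>k. (1/3) ^ Suc k * norm x0)"
    proof (rule norm_suminf_le)
      show "norm (t (Suc k)) \<le> (1/3) ^ Suc k * norm x0" for k by (rule tn)
      show "summable (\<lambda>k. (1/3::real) ^ Suc k * norm x0)" using gs by (subst summable_Suc_iff)
    qed
    also have "\<dots> = norm x0 / 2"
    proof -
      have "(\<lambda>k. (1/3::real) ^ Suc k * norm x0) sums (1/3 * (1 / (1 - 1/3)) * norm x0)"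
        using sums_mult2[OF sums_mult[OF geometric_sums[of "1/3::real"], of "1/3"]] by simp
      then show ?thesis by (simp add: sums_iff)
    qed
    finally show False using ne by simp
  qed
  then show "finite_ascent UNIV A" unfolding finite_ascent_def by blast
  have clS: "closed (A ` V d)" unfolding image_V by (rule d(2)) simp
  obtain C where C: "C > 0" "\<And>y. y \<in> A ` V d \<Longrightarrow> \<exists>x\<in>V d. A x = y \<and> norm x \<le> C * norm y"
    using open_mapping_bound[OF bounded_ops_bounded_linear[OF A] csubspace_real[OF csub_V] d(2)[OF order_refl] clS]
    by metis
  have low: "norm x \<le> C * norm (A x)" if x: "x \<in> V d" for x
  proof -
    obtain x' where x': "x' \<in> V d" "A x' = A x" "norm x' \<le> C * norm (A x)" using C(2) x by blast
    have "x - x' = 0"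
    proof (rule inj)
      show "x - x' \<in> V d" by (rule complex_vector.subspace_diff[OF csub_V x x'(1)])
      show "A (x - x') = 0" using x'(2) by (simp add: bounded_ops_simps[OF A])
    qed
    then show ?thesis using x'(3) by simp
  qed
  have "V d \<subseteq> V (Suc d)"
  proof
    fix y assume y: "y \<in> V d"
    have "\<exists>z\<in>V (Suc d). dist z y < e" if e: "0 < e" for e
    proof -
      \<comment> \<open>The first bound makes \<open>A - \<mu>\<close> bounded below on \<open>V d\<close>, the second one controls \<open>\<mu> x\<close>.\<close>
      define \<delta> where "\<delta> = min (1 / (2 * C)) (e / (2 * C * (norm y + 1)))"
      have pos: "0 < 2 * C * (norm y + 1)" using C by (simp add: add_nonneg_pos)
      have "\<delta> > 0" unfolding \<delta>_def using C e pos by simp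
      then obtain \<mu> where \<mu>: "\<mu> \<noteq> 0" "cmod \<mu> < \<delta>" "bij (op_shift A \<mu>)" using inv by blast
      obtain w where w: "y = (A ^^ d) w" using y by blast
      obtain v where v: "w = op_shift A \<mu> v" using \<mu>(3) by (metis bij_pointE)
      define x where "x = (A ^^ d) v"
      have xV: "x \<in> V d" unfolding x_def by blast
      have yx: "y = A x - \<mu> *\<^sub>C x"
        unfolding w v x_def op_shift_def by (simp add: bounded_ops_simps[OF pow_bounded] funpow_swap1)
      have "norm (A x) \<le> norm y + cmod \<mu> * norm x"
        using norm_triangle_ineq[of y "\<mu> *\<^sub>C x"] yx by (simp add: norm_scaleC)
      then have "norm x \<le> C * (norm y + cmod \<mu> * norm x)"
        using low[OF xV] C(1) by (meson mult_le_cancel_left_pos order_trans)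
      moreover have "C * cmod \<mu> \<le> 1 / 2" using \<mu>(2) C unfolding \<delta>_def by (simp add: field_simps)
      then have "C * cmod \<mu> * norm x \<le> 1 / 2 * norm x" by (rule mult_right_mono) simp
      ultimately have xn: "norm x \<le> 2 * C * norm y" by (simp add: algebra_simps)
      have "dist (A x) y = cmod \<mu> * norm x" using yx by (simp add: dist_norm norm_scaleC)
      also have "\<dots> \<le> cmod \<mu> * (2 * C * (norm y + 1))"
        using xn C by (intro mult_left_mono) (auto simp: algebra_simps)
      also have "\<dots> < e" using \<mu>(2) pos unfolding \<delta>_def by (simp add: pos_less_divide_eq)
      finally show ?thesis using xV image_V[of d] by blast
    qed
    then have "y \<in> closure (V (Suc d))" unfolding closure_approachable by blast
    then show "y \<in> V (Suc d)" using clS unfolding image_V by simp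
  qed
  then show "finite_descent UNIV A" unfolding finite_descent_def using V_Suc[of d] by blast
qed

lemma inj_op_shift:
  assumes "\<And>x. A x = \<mu> *\<^sub>C x \<Longrightarrow> x = 0"
  shows "inj (op_shift A \<mu>)"
proof (rule injI)
  fix x y assume "op_shift A \<mu> x = op_shift A \<mu> y"
  then have "A (x - y) = \<mu> *\<^sub>C (x - y)"
    by (simp add: op_shift_def bounded_ops_simps[OF A] complex_vector.scale_right_diff_distrib algebra_simps)
  then show "x = y" using assms[of "x - y"] by simp
qed

text \<open>The space is the direct sum of \<open>V k\<close>, on which \<open>A\<close> is invertible and stays so under small
perturbations, and \<open>ker A\<^sup>k\<close>, on which \<open>A\<close> is nilpotent and \<open>A - \<mu>\<close> is inverted by a finite geometric sum.\<close>

lemma invertible_near_pole: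
  assumes "finite_ascent UNIV A" "finite_descent UNIV A"
  obtains e where "0 < e" "\<And>\<mu>. \<mu> \<noteq> 0 \<Longrightarrow> cmod \<mu> < e \<Longrightarrow> bij (op_shift A \<mu>)"
proof -
  obtain k where k: "\<And>j. k \<le> j \<Longrightarrow> V j = V k" "\<forall>x \<in> V k. A x = 0 \<longrightarrow> x = 0"
    using ascent_descent_common[OF assms] by metis
  have eq: "V k = V (Suc k)" using k(1)[of "Suc k"] by simp
  have cl: "closed (V k)" using closed_V_ascent_descent[OF k(2) eq] .
  have AV: "A ` V k = V k" unfolding image_V by (rule eq[symmetric])
  obtain C where C: "C > 0" "\<And>y. y \<in> A ` V k \<Longrightarrow> \<exists>x\<in>V k. A x = y \<and> norm x \<le> C * norm y"
    using open_mapping_bound[OF bounded_ops_bounded_linear[OF A] csubspace_real[OF csub_V] cl] cl AV by metis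
  have injV: "x = y" if "x \<in> V k" "y \<in> V k" "A x = A y" for x y
    using k(2) that complex_vector.subspace_diff[OF csub_V that(1,2)]
    by (metis bounded_ops_diff[OF A] right_minus_eq)
  have "\<forall>y\<in>V k. \<exists>x. x \<in> V k \<and> A x = y \<and> norm x \<le> C * norm y" using C(2) unfolding AV by blast
  then obtain g where g: "\<And>y. y \<in> V k \<Longrightarrow> g y \<in> V k \<and> A (g y) = y \<and> norm (g y) \<le> C * norm y"
    by metis
  have gdiff: "norm (g y - g z) \<le> C * norm (y - z)" if "y \<in> V k" "z \<in> V k" for y z
  proof -
    have yz: "y - z \<in> V k" by (rule complex_vector.subspace_diff[OF csub_V that])
    have "g y - g z = g (y - z)"
    proof (rule injV)
      show "g y - g z \<in> V k"
        by (rule complex_vector.subspace_diff[OF csub_V conjunct1[OF g[OF that(1)]] conjunct1[OF g[OF that(2)]]])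
      show "g (y - z) \<in> V k" using g[OF yz] by blast
      show "A (g y - g z) = A (g (y - z))" 
        using g[OF that(1)] g[OF that(2)] g[OF yz] by (simp only: bounded_ops_diff[OF A])
    qed
    then show ?thesis using g[OF yz] by simp
  qed
  have bij: "bij (op_shift A \<mu>)" if \<mu>: "\<mu> \<noteq> 0" "cmod \<mu> < 1 / C" for \<mu>
  proof (rule bijI)
    have muC: "C * cmod \<mu> < 1" using \<mu>(2) C(1) by (simp add: field_simps)
    have kerz: "x = 0" if x: "A x = \<mu> *\<^sub>C x" for x
    proof -
      have pw: "(A ^^ j) x = \<mu> ^ j *\<^sub>C x" for j
        by (induction j) (auto simp: x bounded_ops_simps[OF A] scaleC_scaleC scaleC_one mult.commute)
      have "x = inverse (\<mu> ^ k) *\<^sub>C (A ^^ k) x" using \<mu>(1) by (simp add: pw scaleC_scaleC scaleC_one)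
      then have xV: "x \<in> V k" using complex_vector.subspace_scale[OF csub_V rangeI] by metis
      then have AxV: "A x \<in> V k" using imageI[of x "V k" A] unfolding AV by blast
      then have "x = g (A x)" using g[OF AxV] injV[OF xV] by metis
      then have "norm x \<le> C * norm (A x)" using g[OF AxV] by metis
      also have "\<dots> = C * cmod \<mu> * norm x" unfolding x by (simp add: norm_scaleC)
      finally have "norm x * (1 - C * cmod \<mu>) \<le> 0" by (simp add: algebra_simps)
      then show ?thesis using muC by (simp add: mult_le_0_iff)
    qed
    show "inj (op_shift A \<mu>)" using kerz by (rule inj_op_shift)
    show "surj (op_shift A \<mu>)"
    proof (rule surj_from_ex)
      fix y
      have "y \<in> V k + {x \<in> UNIV. (A ^^ k) x = 0}"
        using ascent_descent_decomposition(1)[OF k(2) eq] by (metis UNIV_I)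
      then obtain v u where vu: "v \<in> V k" "(A ^^ k) u = 0" "y = v + u" by (blast elim: set_plusE)
      \<comment> \<open>The geometric sum inverts \<open>A - \<mu>\<close> on the component \<open>u\<close> in \<open>ker A\<^sup>k\<close>.\<close>
      define b where "b = - (\<Sum>i<k. inverse (\<mu> ^ Suc i) *\<^sub>C (A ^^ i) u)"
      let ?t = "\<lambda>i. inverse (\<mu> ^ i) *\<^sub>C (A ^^ i) u"
      have "op_shift A \<mu> b = - (\<Sum>i<k. inverse (\<mu> ^ Suc i) *\<^sub>C A ((A ^^ i) u) - \<mu> *\<^sub>C inverse (\<mu> ^ Suc i) *\<^sub>C (A ^^ i) u)"
        unfolding b_def op_shift_def
        by (simp only: bounded_ops_simps[OF A] sum_subtractf complex_vector.scale_minus_right complex_vector.scale_sum_right) simp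
      also have "\<dots> = - (\<Sum>i<k. ?t (Suc i) - ?t i)"
        using \<mu>(1) by (simp add: scaleC_scaleC field_simps)
      also have "\<dots> = - (?t k - ?t 0)" by (subst sum_lessThan_telescope) (rule refl)
      finally have b: "op_shift A \<mu> b = u" using vu(2) by (simp add: scaleC_one)
      \<comment> \<open>On \<open>V k\<close> the equation \<open>(A - \<mu>) a = v\<close> is a fixed point equation for the inverse \<open>g\<close> of \<open>A\<close>.\<close>
      have "\<exists>!a\<in>V k. g (v + \<mu> *\<^sub>C a) = a"
      proof (rule Banach_fix[of _ "C * cmod \<mu>"])
        show "complete (V k)" using cl complete_eq_closed by blast
        show "V k \<noteq> {}" by blast
        have in_V: "v + \<mu> *\<^sub>C a \<in> V k" if "a \<in> V k" for a
          using that vu(1) complex_vector.subspace_add[OF csub_V] complex_vector.subspace_scale[OF csub_V] by blast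
        then show "(\<lambda>a. g (v + \<mu> *\<^sub>C a)) ` V k \<subseteq> V k" using g by blast
        show "dist (g (v + \<mu> *\<^sub>C a)) (g (v + \<mu> *\<^sub>C b)) \<le> C * cmod \<mu> * dist a b" if "a \<in> V k" "b \<in> V k" for a b
          using gdiff[OF in_V[OF that(1)] in_V[OF that(2)]]
          by (simp add: dist_norm norm_scaleC complex_vector.scale_right_diff_distrib[symmetric] mult.assoc)
      qed (use C muC in auto)
      then obtain a where a: "a \<in> V k" "g (v + \<mu> *\<^sub>C a) = a" by blast
      have "v + \<mu> *\<^sub>C a \<in> V k"
        using a(1) vu(1) complex_vector.subspace_add[OF csub_V] complex_vector.subspace_scale[OF csub_V] by blast
      then have "A a = v + \<mu> *\<^sub>C a" using g a(2) by metis
      then have "op_shift A \<mu> a = v" by (simp add: op_shift_def)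
      then have "op_shift A \<mu> (a + b) = y"
        using b vu(3) bounded_ops_add[OF bounded_ops_op_shift[OF A]] by metis
      then show "\<exists>x. op_shift A \<mu> x = y" by blast
    qed
  qed
  show ?thesis by (rule that[of "1 / C"]) (use C bij in auto)
qed

lemma bij_imp_finite_ascent_descent:
  assumes "bij A"
  shows "finite_ascent UNIV A" "finite_descent UNIV A"
proof -
  have "x = 0" if "A x = 0" for x using that assms bounded_ops_zero[OF A] by (metis bij_is_inj injD)
  then show "finite_ascent UNIV A" unfolding finite_ascent_def by blast
  show "finite_descent UNIV A" unfolding finite_descent_def
    by (rule exI[of _ 0]) (use assms in \<open>simp add: bij_is_surj\<close>)
qed

lemma bij_shift_large:
  assumes K: "\<And>x. norm (A x) \<le> K * norm x" and \<mu>: "K < cmod \<mu>" "0 \<le> K"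
  shows "bij (op_shift A \<mu>)"
proof (rule bijI)
  have \<mu>0: "\<mu> \<noteq> 0" using \<mu> by auto
  have kerz: "x = 0" if x: "A x = \<mu> *\<^sub>C x" for x
  proof -
    have "(cmod \<mu> - K) * norm x \<le> 0" using K[of x] unfolding x norm_scaleC by (simp add: algebra_simps)
    then show ?thesis using \<mu> by (simp add: mult_le_0_iff)
  qed
  show "inj (op_shift A \<mu>)" using kerz by (rule inj_op_shift)
  show "surj (op_shift A \<mu>)"
  proof (rule surj_from_ex)
    fix y
    have "\<exists>!x\<in>UNIV. inverse \<mu> *\<^sub>C (A x - y) = x"
    proof (rule Banach_fix[of _ "K / cmod \<mu>"])
      show "dist (inverse \<mu> *\<^sub>C (A a - y)) (inverse \<mu> *\<^sub>C (A b - y)) \<le> K / cmod \<mu> * dist a b" for a b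
      proof -
        have "dist (inverse \<mu> *\<^sub>C (A a - y)) (inverse \<mu> *\<^sub>C (A b - y)) = norm (A (a - b)) / cmod \<mu>"
          by (simp add: dist_norm complex_vector.scale_right_diff_distrib[symmetric] norm_scaleC
              bounded_ops_diff[OF A] norm_inverse divide_inverse mult.commute)
        also have "\<dots> \<le> K * norm (a - b) / cmod \<mu>" by (intro divide_right_mono K) simp
        finally show ?thesis by (simp add: dist_norm)
      qed
    qed (use \<mu> \<mu>0 complete_UNIV in \<open>auto simp: divide_less_eq\<close>)
    then obtain x where x: "inverse \<mu> *\<^sub>C (A x - y) = x" by blast
    have "\<mu> *\<^sub>C x = A x - y" using \<mu>0 by (subst x[symmetric]) (simp add: scaleC_scaleC scaleC_one)
    then show "\<exists>x. op_shift A \<mu> x = y" by (intro exI[of _ x]) (simp add: op_shift_def)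
  qed
qed

end

section \<open>Operators all of whose shifts are quasi-Fredholm\<close>

lemma commute_funpow: "(\<And>x. f (g x) = g (f x)) \<Longrightarrow> f ((g ^^ n) x) = (g ^^ n) (f x)"
  by (induction n) auto

lemma op_shift_op_shift: "op_shift (op_shift F c) \<mu> = op_shift F (c + \<mu>)"
  by (simp add: fun_eq_iff op_shift_def scaleC_add_left algebra_simps)

lemma op_shift_commute: "F \<in> bounded_ops \<Longrightarrow> op_shift F a (op_shift F b x) = op_shift F b (op_shift F a x)"
  by (simp add: op_shift_def bounded_ops_simps complex_vector.scale_right_diff_distrib scaleC_scaleC mult.commute algebra_simps)

lemma bounded_ops_bound:
  assumes "F \<in> bounded_ops"
  obtains K where "0 < K" "\<And>x. norm (F x) \<le> K * norm x"
  using bounded_linear.pos_bounded[OF bounded_ops_bounded_linear[OF assms]] by (metis mult.commute)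

text \<open>The closure of the resolvent set \<open>\<rho>\<close> consists of poles and regular points, and a punctured
neighbourhood of each of them lies in \<open>\<rho>\<close>. So the closure is open, hence the whole plane. Points outside
\<open>\<rho>\<close> are isolated from each other and bounded in modulus by a bound of \<open>F\<close>.\<close>

theorem quasi_fredholm_everywhere:
  assumes F: "F \<in> bounded_ops" and qf: "\<And>c. quasi_fredholm (op_shift F c)"
  shows "finite_ascent UNIV (op_shift F c)" "finite_descent UNIV (op_shift F c)"
    and "finite {c. \<not> bij (op_shift F c)}"
proof -
  note Fs = bounded_ops_op_shift[OF F]
  define \<rho> where "\<rho> = {c. bij (op_shift F c)}"
  obtain K where K: "0 < K" "\<And>x. norm (F x) \<le> K * norm x" using bounded_ops_bound[OF F] by metis
  have large: "c \<in> \<rho>" if "K < cmod c" for c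
    unfolding \<rho>_def using bij_shift_large[OF F K(2) that] K(1) by simp
  have pole: "finite_ascent UNIV (op_shift F c) \<and> finite_descent UNIV (op_shift F c)" if c: "c \<in> closure \<rho>" for c
  proof (cases "c \<in> \<rho>")
    case True
    then show ?thesis using bij_imp_finite_ascent_descent[OF Fs] unfolding \<rho>_def by blast
  next
    case False
    have "\<exists>\<mu>. \<mu> \<noteq> 0 \<and> cmod \<mu> < e \<and> bij (op_shift (op_shift F c) \<mu>)" if e: "0 < e" for e
    proof -
      obtain c' where c': "c' \<in> \<rho>" "dist c' c < e" using c e unfolding closure_approachable by blast
      then have "c' - c \<noteq> 0" using False by auto
      then show ?thesis using c' unfolding \<rho>_def
        by (intro exI[of _ "c' - c"]) (simp add: op_shift_op_shift dist_norm)
    qed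
    then show ?thesis using quasi_fredholm_limit_of_invertible[OF Fs qf] by blast
  qed
  have punct: "\<exists>e>0. \<forall>c'. c' \<noteq> c \<longrightarrow> dist c' c < e \<longrightarrow> c' \<in> \<rho>" if c: "c \<in> closure \<rho>" for c
  proof -
    obtain e where e: "0 < e" "\<And>\<mu>. \<mu> \<noteq> 0 \<Longrightarrow> cmod \<mu> < e \<Longrightarrow> bij (op_shift (op_shift F c) \<mu>)"
      using invertible_near_pole[OF Fs conjunct1[OF pole[OF c]] conjunct2[OF pole[OF c]]] by metis
    have "c' \<in> \<rho>" if "c' \<noteq> c" "dist c' c < e" for c'
      using e(2)[of "c' - c"] that unfolding \<rho>_def by (simp add: op_shift_op_shift dist_norm)
    then show ?thesis using e(1) by blast
  qed
  have "open (closure \<rho>)"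
  proof (subst open_dist, intro ballI)
    fix c assume c: "c \<in> closure \<rho>"
    obtain e where e: "e > 0" "\<And>c'. c' \<noteq> c \<Longrightarrow> dist c' c < e \<Longrightarrow> c' \<in> \<rho>" using punct[OF c] by blast
    have "c' \<in> closure \<rho>" if "dist c' c < e" for c'
      using e(2)[OF _ that] c closure_subset[of \<rho>] by (cases "c' = c") auto
    then show "\<exists>e>0. \<forall>y. dist y c < e \<longrightarrow> y \<in> closure \<rho>" using e(1) by blast
  qed
  moreover have "closure \<rho> \<noteq> {}"
  proof -
    have "K < cmod (complex_of_real (K + 1))" using K(1) by simp
    then show ?thesis using large closure_subset[of \<rho>] by blast
  qed
  ultimately have all: "closure \<rho> = UNIV" using clopen[of "closure \<rho>"] closed_closure by blast
  then show "finite_ascent UNIV (op_shift F c)" "finite_descent UNIV (op_shift F c)" using pole by auto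
  show "finite {c. \<not> bij (op_shift F c)}"
  proof (rule ccontr)
    let ?S = "{c. \<not> bij (op_shift F c)}"
    assume inf: "infinite ?S"
    have "?S \<subseteq> cball 0 K" using large unfolding \<rho>_def by (auto simp: not_less[symmetric])
    then obtain c where c: "c islimpt ?S"
      using Heine_Borel_imp_Bolzano_Weierstrass[OF compact_cball inf] by blast
    obtain e where e: "e > 0" "\<And>c'. c' \<noteq> c \<Longrightarrow> dist c' c < e \<Longrightarrow> c' \<in> \<rho>" using punct[of c] all by blast
    obtain c' where "c' \<in> ?S" "c' \<noteq> c" "dist c' c < e" using c e(1) unfolding islimpt_approachable by blast
    then show False using e(2)[of c'] unfolding \<rho>_def by blast
  qed
qed

text \<open>The nonemptiness of the spectrum, for the restriction of \<open>F\<close> to \<open>Y\<close>: for a functional \<open>h\<close> the function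
\<open>h (R c y)\<close> of \<open>c\<close>, with \<open>R c\<close> the inverse of \<open>F - c\<close>, is entire and vanishes at infinity. By
Liouville's theorem it is zero.\<close>

lemma everywhere_invertible_trivial:
  assumes F: "F \<in> bounded_ops" and Y: "csubspace Y" "closed Y"
    and inv: "\<And>c x. x \<in> Y \<Longrightarrow> op_shift F c x \<in> Y"
    and inj: "\<And>c x. x \<in> Y \<Longrightarrow> op_shift F c x = 0 \<Longrightarrow> x = 0"
    and onto: "\<And>c y. y \<in> Y \<Longrightarrow> \<exists>x\<in>Y. op_shift F c x = y"
  shows "Y = {0}"
proof (rule ccontr)
  assume "Y \<noteq> {0}"
  then obtain y where y: "y \<in> Y" "y \<noteq> 0" using complex_vector.subspace_0[OF Y(1)] by blast
  note Fs = bounded_ops_op_shift[OF F]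
  have eqY: "x = x'" if "x \<in> Y" "x' \<in> Y" "op_shift F c x = op_shift F c x'" for x x' c
  proof -
    have "x - x' = 0"
    proof (rule inj)
      show "x - x' \<in> Y" by (rule complex_vector.subspace_diff[OF Y(1) that(1,2)])
      show "op_shift F c (x - x') = 0" using that(3) by (simp add: bounded_ops_diff[OF Fs])
    qed
    then show ?thesis by simp
  qed
  have "\<forall>c y. \<exists>x. y \<in> Y \<longrightarrow> x \<in> Y \<and> op_shift F c x = y" using onto by blast
  then obtain R where R: "\<And>c y. y \<in> Y \<Longrightarrow> R c y \<in> Y \<and> op_shift F c (R c y) = y" by metis
  have im: "op_shift F c ` Y = Y" for c
  proof
    show "op_shift F c ` Y \<subseteq> Y" using inv by blast
    show "Y \<subseteq> op_shift F c ` Y"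
    proof
      fix y assume "y \<in> Y"
      then show "y \<in> op_shift F c ` Y" using R[of y c] by (metis imageI)
    qed
  qed
  have low: "\<exists>C>0. \<forall>x\<in>Y. norm x \<le> C * norm (op_shift F c x)" for c
  proof -
    have cl: "closed (op_shift F c ` Y)" unfolding im by (rule Y(2))
    obtain C where C: "C > 0" "\<And>y. y \<in> op_shift F c ` Y \<Longrightarrow> \<exists>x\<in>Y. op_shift F c x = y \<and> norm x \<le> C * norm y"
      using open_mapping_bound[OF bounded_ops_bounded_linear[OF Fs] csubspace_real[OF Y(1)] Y(2) cl] by metis
    have "norm x \<le> C * norm (op_shift F c x)" if "x \<in> Y" for x
      using C(2)[OF imageI[OF that]] eqY[OF that] by metis
    then show ?thesis using C(1) by blast
  qed
  have resolvent: "R \<mu> z - R c z = (\<mu> - c) *\<^sub>C R \<mu> (R c z)" if z: "z \<in> Y" for \<mu> c z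
  proof (rule eqY)
    have Rz: "R c z \<in> Y" "R \<mu> z \<in> Y" "R \<mu> (R c z) \<in> Y" using R z by blast+
    show "R \<mu> z - R c z \<in> Y" by (rule complex_vector.subspace_diff[OF Y(1) Rz(2,1)])
    show "(\<mu> - c) *\<^sub>C R \<mu> (R c z) \<in> Y" by (rule complex_vector.subspace_scale[OF Y(1) Rz(3)])
    have "op_shift F \<mu> (R c z) = z - (\<mu> - c) *\<^sub>C R c z"
      using R[OF z, of c] by (simp add: op_shift_def complex_vector.scale_left_diff_distrib algebra_simps)
    then show "op_shift F \<mu> (R \<mu> z - R c z) = op_shift F \<mu> ((\<mu> - c) *\<^sub>C R \<mu> (R c z))"
      using R[OF z, of \<mu>] R[OF Rz(1), of \<mu>] by (simp add: bounded_ops_diff[OF Fs] bounded_ops_scaleC[OF Fs])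
  qed
  have cont: "((\<lambda>\<mu>. R \<mu> z) \<longlongrightarrow> R c z) (at c)" if z: "z \<in> Y" for z c
  proof -
    obtain C where C: "C > 0" "\<And>x. x \<in> Y \<Longrightarrow> norm x \<le> C * norm (op_shift F c x)" using low by blast
    have bound: "norm (R \<mu> w) \<le> 2 * C * norm w" if w: "w \<in> Y" and \<mu>: "cmod (\<mu> - c) < 1 / (2 * C)" for w \<mu>
    proof -
      have Rw: "R \<mu> w \<in> Y" "op_shift F \<mu> (R \<mu> w) = w" using R[OF w] by auto
      have "op_shift F c (R \<mu> w) = w + (\<mu> - c) *\<^sub>C R \<mu> w"
        using Rw(2) by (simp add: op_shift_def complex_vector.scale_left_diff_distrib algebra_simps)
      then have "norm (op_shift F c (R \<mu> w)) \<le> norm w + cmod (\<mu> - c) * norm (R \<mu> w)"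
        using norm_triangle_ineq[of w "(\<mu> - c) *\<^sub>C R \<mu> w"] by (simp add: norm_scaleC)
      then have "norm (R \<mu> w) \<le> C * (norm w + cmod (\<mu> - c) * norm (R \<mu> w))"
        using C(2)[OF Rw(1)] C(1) by (meson mult_le_cancel_left_pos order_trans)
      moreover have "C * cmod (\<mu> - c) \<le> 1 / 2" using \<mu> C(1) by (simp add: field_simps)
      then have "C * cmod (\<mu> - c) * norm (R \<mu> w) \<le> 1 / 2 * norm (R \<mu> w)" by (rule mult_right_mono) simp
      ultimately show ?thesis by (simp add: algebra_simps)
    qed
    have Rz: "R c z \<in> Y" using R[OF z] by blast
    have "((\<lambda>\<mu>. R \<mu> z - R c z) \<longlongrightarrow> 0) (at c)"
    proof (rule Lim_null_comparison)
      have "\<forall>\<^sub>F \<mu> in at c. cmod (\<mu> - c) < 1 / (2 * C)"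
        unfolding eventually_at using C(1) by (intro exI[of _ "1 / (2 * C)"]) (auto simp: dist_norm)
      then show "\<forall>\<^sub>F \<mu> in at c. norm (R \<mu> z - R c z) \<le> cmod (\<mu> - c) * (2 * C * norm (R c z))"
      proof (rule eventually_mono)
        fix \<mu> assume "cmod (\<mu> - c) < 1 / (2 * C)"
        then show "norm (R \<mu> z - R c z) \<le> cmod (\<mu> - c) * (2 * C * norm (R c z))"
          unfolding resolvent[OF z] norm_scaleC using bound[OF Rz] by (intro mult_left_mono) auto
      qed
      have "((\<lambda>\<mu>. \<mu> - c) \<longlongrightarrow> 0) (at c)" using tendsto_diff[OF tendsto_ident_at tendsto_const, of c c UNIV] by simp
      then show "((\<lambda>\<mu>. cmod (\<mu> - c) * (2 * C * norm (R c z))) \<longlongrightarrow> 0) (at c)"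
        by (intro tendsto_mult_left_zero tendsto_norm_zero)
    qed
    then show ?thesis by (simp add: LIM_zero_cancel)
  qed
  have "R 0 y \<noteq> 0" using R[OF y(1), of 0] y(2) bounded_ops_zero[OF Fs] by metis
  then have "R 0 y \<notin> {0}" by blast
  then obtain h where h: "cfunctional h" "h (R 0 y) = 1"
    using Hahn_Banach_separation[of "{0}" "R 0 y"] complex_vector.subspace_single_0 closed_singleton by metis
  have hb: "bounded_linear h" and hC: "\<And>c x. h (c *\<^sub>C x) = c * h x" using h(1) unfolding cfunctional_def by auto
  define g where "g = (\<lambda>\<mu>. h (R \<mu> y))"
  have der: "(g has_field_derivative h (R c (R c y))) (at c)" for c
    unfolding has_field_derivative_iff
  proof (rule Lim_transform_eventually)
    have Ry: "R c y \<in> Y" using R[OF y(1)] by blast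
    show "((\<lambda>\<mu>. h (R \<mu> (R c y))) \<longlongrightarrow> h (R c (R c y))) (at c)"
      by (rule bounded_linear.tendsto[OF hb cont[OF Ry]])
    show "\<forall>\<^sub>F \<mu> in at c. h (R \<mu> (R c y)) = (g \<mu> - g c) / (\<mu> - c)"
      unfolding eventually_at
    proof (intro exI[of _ 1] conjI ballI impI)
      fix \<mu> :: complex assume "\<mu> \<noteq> c \<and> dist \<mu> c < 1"
      moreover have "g \<mu> - g c = (\<mu> - c) * h (R \<mu> (R c y))"
        unfolding g_def using resolvent[OF y(1), of \<mu> c] linear_diff[OF bounded_linear.linear[OF hb]] hC by metis
      ultimately show "h (R \<mu> (R c y)) = (g \<mu> - g c) / (\<mu> - c)" by simp
    qed simp
  qed
  then have hol: "g holomorphic_on UNIV" by (meson holomorphic_onI field_differentiable_at_within field_differentiable_def)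
  obtain K where K: "0 < K" "\<And>x. norm (F x) \<le> K * norm x" using bounded_ops_bound[OF F] by metis
  obtain H where H: "0 < H" "\<And>x. norm (h x) \<le> norm x * H" using bounded_linear.pos_bounded[OF hb] by blast
  have "(g \<longlongrightarrow> 0) at_infinity"
    unfolding Lim_at_infinity
  proof (intro allI impI)
    fix e :: real assume e: "0 < e"
    define b where "b = K + norm y * H / e + 1"
    have "dist (g \<mu>) 0 < e" if \<mu>: "b \<le> norm \<mu>" for \<mu>
    proof -
      have "op_shift F \<mu> (R \<mu> y) = y" using R[OF y(1)] by blast
      then have "\<mu> *\<^sub>C R \<mu> y = F (R \<mu> y) - y" by (simp add: op_shift_def algebra_simps)
      then have "cmod \<mu> * norm (R \<mu> y) = norm (F (R \<mu> y) - y)" by (metis norm_scaleC)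
      also have "\<dots> \<le> K * norm (R \<mu> y) + norm y" using norm_triangle_ineq4[of "F (R \<mu> y)" y] K(2)[of "R \<mu> y"] by linarith
      finally have 1: "(cmod \<mu> - K) * norm (R \<mu> y) \<le> norm y" by (simp add: algebra_simps)
      have pos: "norm y * H / e < cmod \<mu> - K" using \<mu> unfolding b_def by simp
      have nn: "0 \<le> norm y * H / e" using e H(1) by simp
      then have p2: "0 < cmod \<mu> - K" using pos by linarith
      have "norm (g \<mu>) \<le> norm (R \<mu> y) * H" unfolding g_def by (rule H(2))
      then have "(cmod \<mu> - K) * norm (g \<mu>) \<le> (cmod \<mu> - K) * (norm (R \<mu> y) * H)" using p2 by (intro mult_left_mono) auto
      also have "\<dots> \<le> norm y * H" using mult_right_mono[OF 1, of H] H(1) by (simp add: mult_ac)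
      also have "\<dots> < (cmod \<mu> - K) * e" using pos e by (simp add: field_simps)
      finally show ?thesis using p2 by (simp add: mult_less_cancel_left_pos)
    qed
    then show "\<exists>b. \<forall>x. b \<le> norm x \<longrightarrow> dist (g x) 0 < e" by blast
  qed
  then have "g 0 = 0" by (rule Liouville_weak_0[OF hol])
  then show False using h(2) unfolding g_def by simp
qed

text \<open>On the intersection \<open>Y\<close> of the spaces \<open>V c\<close>, over the finite ordinary spectrum, every \<open>F - c\<close> is
bijective, so \<open>Y = {0}\<close>. If all generalized eigenspaces \<open>N c\<close> with \<open>c \<noteq> 0\<close> were finite-dimensional, the
intersection \<open>Z\<close> of the \<open>V c\<close> with \<open>c \<noteq> 0\<close> would have finite codimension, while a power of \<open>F\<close> maps \<open>Z\<close> into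
\<open>Y = {0}\<close>; then \<open>F\<close> would be power finite rank.\<close>

theorem infinite_dimensional_pole:
  assumes F: "F \<in> bounded_ops" and qf: "\<And>c. quasi_fredholm (op_shift F c)"
    and npfr: "F \<notin> power_finite_rank"
  obtains l k where "l \<noteq> 0" "\<forall>x \<in> range (op_shift F l ^^ k). op_shift F l x = 0 \<longrightarrow> x = 0"
    "range (op_shift F l ^^ k) = range (op_shift F l ^^ Suc k)"
    "\<not> fin_dim {x. (op_shift F l ^^ k) x = 0}"
proof -
  note Fs = bounded_ops_op_shift[OF F]
  define Q where "Q = op_shift F"
  have Qb: "Q c \<in> bounded_ops" for c unfolding Q_def by (rule Fs)
  have io: "invariant_operator UNIV (Q c)" for c by (rule invariant_operator_UNIV[OF Qb])
  have "\<exists>k. (\<forall>j\<ge>k. range (Q c ^^ j) = range (Q c ^^ k)) \<and> (\<forall>x\<in>range (Q c ^^ k). Q c x = 0 \<longrightarrow> x = 0)" for c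
    using invariant_operator.ascent_descent_common[OF io quasi_fredholm_everywhere(1,2)[OF F qf, folded Q_def]]
    by metis
  then obtain k where k: "\<And>c j. k c \<le> j \<Longrightarrow> range (Q c ^^ j) = range (Q c ^^ k c)"
      "\<And>c. \<forall>x\<in>range (Q c ^^ k c). Q c x = 0 \<longrightarrow> x = 0" by metis
  define V where "V = (\<lambda>c. range (Q c ^^ k c))"
  define N where "N = (\<lambda>c. {x. (Q c ^^ k c) x = 0})"
  have N_eq: "N c = {x \<in> UNIV. (Q c ^^ k c) x = 0}" for c unfolding N_def by simp
  have eq: "range (Q c ^^ k c) = range (Q c ^^ Suc (k c))" for c by (rule k(1)[symmetric]) simp
  have csV: "csubspace (V c)" for c unfolding V_def by (rule invariant_operator.csub_V[OF io])
  have clV: "closed (V c)" for c unfolding V_def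
    by (rule invariant_operator.closed_V_ascent_descent[OF io k(2) eq])
  have sum: "V c + N c = UNIV" and int: "V c \<inter> N c = {0}" for c
    unfolding V_def N_eq by (rule invariant_operator.ascent_descent_decomposition[OF io k(2) eq])+
  have comm: "Q a ((Q b ^^ n) x) = (Q b ^^ n) (Q a x)" for a b n x
    unfolding Q_def by (rule commute_funpow) (rule op_shift_commute[OF F])
  have QV: "Q a x \<in> V c" if "x \<in> V c" for a c x
    using that comm unfolding V_def by (metis (mono_tags, lifting) imageE rangeI)
  have QN: "Q a x \<in> N c" if "x \<in> N c" for a c x
    using that comm[where a = a and b = c and n = "k c" and x = x, symmetric] bounded_ops_zero[OF Qb] unfolding N_def by simp
  define spec where "spec = {c. \<not> bij (Q c)}"
  have fS: "finite spec" unfolding spec_def Q_def by (rule quasi_fredholm_everywhere(3)[OF F qf])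
  define Y where "Y = (\<Inter>c\<in>spec. V c)"
  have "Y = {0}"
  proof (rule everywhere_invertible_trivial[OF F])
    show "csubspace Y" unfolding Y_def using csV by (intro complex_vector.subspace_Inter) auto
    show "closed Y" unfolding Y_def using clV by auto
    show "op_shift F c x \<in> Y" if "x \<in> Y" for c x
      using that QV unfolding Y_def Q_def by blast
    show "x = 0" if x: "x \<in> Y" "op_shift F c x = 0" for c x
    proof (cases "c \<in> spec")
      case True
      then have "x \<in> V c" using x(1) unfolding Y_def by blast
      then show ?thesis using k(2)[of c] x(2) unfolding V_def Q_def by blast
    next
      case False
      then have "inj (Q c)" unfolding spec_def by (simp add: bij_is_inj)
      moreover have "Q c x = Q c 0" using x(2) bounded_ops_zero[OF Qb] unfolding Q_def by metis
      ultimately show ?thesis by (rule injD)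
    qed
    show "\<exists>x\<in>Y. op_shift F c x = y" if y: "y \<in> Y" for c y
    proof -
      have "\<exists>x. Q c x = y \<and> (c \<in> spec \<longrightarrow> x \<in> V c)"
      proof (cases "c \<in> spec")
        case True
        then have "y \<in> V c" using y unfolding Y_def by blast
        also have "V c = Q c ` V c" unfolding V_def invariant_operator.image_V[OF io] by (rule eq)
        finally show ?thesis by blast
      next
        case False
        then show ?thesis unfolding spec_def by (metis (mono_tags) bij_pointE mem_Collect_eq)
      qed
      then obtain x where x: "Q c x = y" "c \<in> spec \<Longrightarrow> x \<in> V c" by blast
      have "x \<in> V \<nu>" if \<nu>: "\<nu> \<in> spec" for \<nu>
      proof (cases "\<nu> = c")
        case True
        then show ?thesis using x(2) \<nu> by blast
      next
        case False
        \<comment> \<open>The component of \<open>x\<close> in \<open>N \<nu>\<close> is annihilated by \<open>F - c\<close> and by a power of \<open>F - \<nu>\<close>, hence is zero.\<close>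
        have "x \<in> V \<nu> + N \<nu>" using sum by blast
        then obtain a b where ab: "a \<in> V \<nu>" "b \<in> N \<nu>" "x = a + b" by (rule set_plusE)
        have "Q c b = y - Q c a" using x(1) ab(3) bounded_ops_add[OF Qb, of c a b] by (simp add: eq_diff_eq add.commute)
        moreover have "y \<in> V \<nu>" using y \<nu> unfolding Y_def by blast
        ultimately have "Q c b \<in> V \<nu>" using complex_vector.subspace_diff[OF csV _ QV[OF ab(1)]] by metis
        then have "Q c b = 0" using int[of \<nu>] QN[OF ab(2), of c] by blast
        then have Fb: "Q \<nu> b = (c - \<nu>) *\<^sub>C b"
          unfolding Q_def op_shift_def by (simp add: complex_vector.scale_left_diff_distrib algebra_simps)
        have "(Q \<nu> ^^ n) b = (c - \<nu>) ^ n *\<^sub>C b" for n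
          by (induction n) (auto simp: Fb bounded_ops_simps[OF Qb] scaleC_scaleC scaleC_one mult.commute)
        then have "(c - \<nu>) ^ k \<nu> *\<^sub>C b = 0" using ab(2) unfolding N_def by simp
        then have "b = 0" using False by simp
        then show ?thesis using ab by simp
      qed
      then have "x \<in> Y" unfolding Y_def by blast
      then show ?thesis using x(1) unfolding Q_def by blast
    qed
  qed
  have "\<exists>l. l \<noteq> 0 \<and> \<not> fin_dim (N l)"
  proof (rule ccontr)
    assume "\<not> ?thesis"
    then have fdN: "\<And>c. c \<noteq> 0 \<Longrightarrow> fin_dim (N c)" by blast
    have "fin_codim UNIV (\<Inter>c\<in>L. V c) \<and> csubspace (\<Inter>c\<in>L. V c)" if "finite L" "0 \<notin> L" for L
      using that
    proof (induction L)
      case empty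
      then show ?case using fin_codim_superset[OF complex_vector.subspace_UNIV] complex_vector.subspace_UNIV by simp
    next
      case (insert c L)
      have IH: "fin_codim UNIV (\<Inter>c\<in>L. V c)" "csubspace (\<Inter>c\<in>L. V c)" using insert by auto
      have "csubspace (N c)" unfolding N_eq
        by (rule csubspace_kernel[OF bounded_ops_funpow[OF Qb] complex_vector.subspace_UNIV])
      then have "fin_codim UNIV (V c)" unfolding fin_codim_def
        using fdN[of c] insert.prems sum[of c] by (intro exI[of _ "N c"]) auto
      then have "fin_codim (\<Inter>c\<in>L. V c) ((\<Inter>c\<in>L. V c) \<inter> V c)"
        by (rule fin_codim_Int[OF _ csV IH(2)]) simp
      then have "fin_codim UNIV (\<Inter>c\<in>insert c L. V c)"
        using fin_codim_trans[OF IH(1)] by (simp add: Int_commute)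
      moreover have "csubspace (\<Inter>c\<in>insert c L. V c)" using csV by (intro complex_vector.subspace_Inter) auto
      ultimately show ?case by blast
    qed
    note fc = this[of "spec - {0}"]
    define Z where "Z = (\<Inter>c\<in>spec - {0}. V c)"
    have Z: "fin_codim UNIV Z" "csubspace Z" unfolding Z_def using fc fS by auto
    have Q0: "Q 0 = F" unfolding Q_def op_shift_def by (simp add: fun_eq_iff)
    define n where "n = Suc (k 0)"
    have Fn: "range (F ^^ n) = V 0" unfolding V_def n_def using eq[of 0] Q0 by simp
    have FZ: "(F ^^ n) ` Z \<subseteq> {0}"
    proof
      fix y assume "y \<in> (F ^^ n) ` Z"
      then obtain z where z: "z \<in> Z" "y = (F ^^ n) z" by blast
      have "(F ^^ i) z \<in> Z" for i
      proof (induction i)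
        case (Suc i)
        then show ?case using QV[of _ _ 0] unfolding Z_def Q0 by simp
      qed (simp add: z)
      then have "y \<in> Z" using z by blast
      moreover have "y \<in> V 0" using z Fn by blast
      ultimately have "y \<in> Y" unfolding Y_def Z_def by blast
      then show "y \<in> {0}" using \<open>Y = {0}\<close> by blast
    qed
    obtain E where E: "csubspace E" "fin_dim E" "UNIV = Z + E"
      using fin_codim_complement[OF Z complex_vector.subspace_UNIV subset_UNIV] by metis
    have Fnb: "F ^^ n \<in> bounded_ops" by (rule bounded_ops_funpow[OF F])
    have "range (F ^^ n) \<subseteq> (F ^^ n) ` E"
    proof
      fix y assume "y \<in> range (F ^^ n)"
      then obtain x where x: "y = (F ^^ n) x" by blast
      have "x \<in> Z + E" using E(3) by blast
      then obtain z e where ze: "z \<in> Z" "e \<in> E" "x = z + e" by (rule set_plusE)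
      have "(F ^^ n) z = 0" using FZ ze(1) by blast
      then have "y = (F ^^ n) e" using x ze by (simp add: bounded_ops_simps[OF Fnb])
      then show "y \<in> (F ^^ n) ` E" using ze by blast
    qed
    then have "fin_dim (range (F ^^ n))" using fin_dim_image[OF Fnb E(2)] fin_dim_subset by blast
    then have "F \<in> power_finite_rank" unfolding power_finite_rank_def edim_finite_iff
      using F by (auto intro!: exI[of _ n] simp: n_def)
    then show False using npfr by blast
  qed
  then obtain l where "l \<noteq> 0" "\<not> fin_dim (N l)" by blast
  then show ?thesis using that[of l "k l"] k(2)[of l] eq[of l] unfolding N_def Q_def by blast
qed

section \<open>Orthogonal projections at an infinite-dimensional pole\<close>

text \<open>The Riesz projection at a pole, obtained algebraically from \<open>X = Q\<^sup>k X \<oplus> ker Q\<^sup>k\<close>; uniqueness of the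
decomposition makes it commute with all bounded operators that commute with \<open>Q\<close>.\<close>

lemma pole_projection:
  assumes Q: "Q \<in> bounded_ops" and inj: "\<forall>x \<in> range (Q ^^ k). Q x = 0 \<longrightarrow> x = 0"
    and eq: "range (Q ^^ k) = range (Q ^^ Suc k)"
  obtains P where "P \<in> bounded_ops" "\<And>x. (Q ^^ k) (P x) = 0" "\<And>x. (Q ^^ k) x = 0 \<Longrightarrow> P x = x"
    "\<forall>S\<in>bounded_ops. (\<forall>x. S (Q x) = Q (S x)) \<longrightarrow> (\<forall>x. S (P x) = P (S x))"
proof -
  interpret invariant_operator UNIV Q by (rule invariant_operator_UNIV[OF Q])
  define N where "N = {x \<in> UNIV. (Q ^^ k) x = 0}"
  have csN: "csubspace N" unfolding N_def by (rule csubspace_kernel[OF pow_bounded csub_M])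
  have clN: "closed N" unfolding N_def by (rule closed_kernel[OF pow_bounded closed_UNIV])
  have sum: "V k + N = UNIV" and int: "V k \<inter> N = {0}"
    unfolding N_def by (rule ascent_descent_decomposition[OF inj eq])+
  obtain C where C: "C > 0"
    "\<And>y. y \<in> V k + N \<Longrightarrow> \<exists>u\<in>UNIV. \<exists>w\<in>N. y = (Q ^^ k) u + w \<and> norm u \<le> C * norm y \<and> norm w \<le> C * norm y"
    using sum_decomposition_bound[OF pow_bounded csub_M closed_UNIV csN clN, of k] sum closed_UNIV by metis
  have "\<forall>x. \<exists>w. w \<in> N \<and> x - w \<in> V k \<and> norm w \<le> C * norm x"
  proof
    fix x
    obtain u w where "w \<in> N" "x = (Q ^^ k) u + w" "norm w \<le> C * norm x" using C(2) sum by blast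
    then show "\<exists>w. w \<in> N \<and> x - w \<in> V k \<and> norm w \<le> C * norm x" by (intro exI[of _ w]) auto
  qed
  then obtain P where P: "\<And>x. P x \<in> N" "\<And>x. x - P x \<in> V k" "\<And>x. norm (P x) \<le> C * norm x" by metis
  have uniq: "P x = w" if "w \<in> N" "x - w \<in> V k" for x w
  proof -
    have "P x - w \<in> N" by (rule complex_vector.subspace_diff[OF csN P(1) that(1)])
    moreover have "(x - w) - (x - P x) \<in> V k" by (rule complex_vector.subspace_diff[OF csub_V that(2) P(2)])
    ultimately have "P x - w \<in> V k \<inter> N" by simp
    then show ?thesis using int by simp
  qed
  have add: "P (x + y) = P x + P y" for x y
  proof (rule uniq)
    show "P x + P y \<in> N" by (rule complex_vector.subspace_add[OF csN P(1) P(1)])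
    have "(x - P x) + (y - P y) \<in> V k" by (rule complex_vector.subspace_add[OF csub_V P(2) P(2)])
    then show "x + y - (P x + P y) \<in> V k" by (simp add: algebra_simps)
  qed
  have scale: "P (c *\<^sub>C x) = c *\<^sub>C P x" for c x
  proof (rule uniq)
    show "c *\<^sub>C P x \<in> N" by (rule complex_vector.subspace_scale[OF csN P(1)])
    show "c *\<^sub>C x - c *\<^sub>C P x \<in> V k"
      using complex_vector.subspace_scale[OF csub_V P(2)] by (simp add: complex_vector.scale_right_diff_distrib)
  qed
  have "bounded_linear P"
    by (rule bounded_linear_intro[where K = C]) (simp_all add: add scaleR_scaleC scale P(3) mult.commute[of _ C])
  then have "P \<in> bounded_ops" unfolding bounded_ops_def using scale by simp
  moreover have "S (P x) = P (S x)" if S: "S \<in> bounded_ops" "\<And>x. S (Q x) = Q (S x)" for S x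
  proof (rule uniq[symmetric])
    have comm: "S ((Q ^^ k) y) = (Q ^^ k) (S y)" for y by (rule commute_funpow) (rule S(2))
    show "S (P x) \<in> N" using P(1)[of x] comm[of "P x"] bounded_ops_zero[OF S(1)] unfolding N_def by simp
    obtain z where "x - P x = (Q ^^ k) z" using P(2)[of x] by blast
    then have "S x - S (P x) = (Q ^^ k) (S z)" using comm[of z] by (metis bounded_ops_diff[OF S(1)])
    then show "S x - S (P x) \<in> V k" by blast
  qed
  moreover have "P x = x" if "(Q ^^ k) x = 0" for x
    using that complex_vector.subspace_0[OF csub_V] by (intro uniq) (auto simp: N_def)
  ultimately show ?thesis using that[of P] P(1) unfolding N_def by blast
qed

lemma bounded_ops_rank_one:
  assumes h: "cfunctional h"
  shows "(\<lambda>x. h x *\<^sub>C v) \<in> bounded_ops"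
proof -
  have hb: "bounded_linear h" and hC: "\<And>c x. h (c *\<^sub>C x) = c * h x" using h unfolding cfunctional_def by auto
  interpret h: bounded_linear h by (rule hb)
  obtain H where H: "\<And>x. norm (h x) \<le> norm x * H" using h.bounded by blast
  have "bounded_linear (\<lambda>x. h x *\<^sub>C v)"
  proof (rule bounded_linear_intro[where K = "H * norm v"])
    show "norm (h x *\<^sub>C v) \<le> norm x * (H * norm v)" for x
      using mult_right_mono[OF H, of "norm v" x] by (simp add: norm_scaleC mult.assoc)
  qed (simp_all add: h.add scaleC_add_left hC scaleR_scaleC scaleC_scaleC)
  then show ?thesis unfolding bounded_ops_def by (simp add: hC scaleC_scaleC)
qed

text \<open>In a linear relation expressing the top of the chain by lower terms, apply the power of \<open>Q\<close> that moves
the lowest term to the top: all others vanish, so its coefficient is zero.\<close>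

lemma jordan_chain_top_independent:
  assumes Q: "Q \<in> bounded_ops" and top: "(Q ^^ n) y \<noteq> 0" "(Q ^^ Suc n) y = 0"
  shows "(Q ^^ n) y \<notin> cspan ((\<lambda>i. (Q ^^ i) y) ` {..<n})"
proof
  assume "(Q ^^ n) y \<in> cspan ((\<lambda>i. (Q ^^ i) y) ` {..<n})"
  have zero: "(Q ^^ j) y = 0" if j: "n < j" for j
  proof -
    have "(Q ^^ j) y = (Q ^^ (j - Suc n)) ((Q ^^ Suc n) y)"
      using j by (metis Suc_leI comp_apply funpow_add le_add_diff_inverse2)
    then show ?thesis using top(2) bounded_ops_zero[OF bounded_ops_funpow[OF Q]] by metis
  qed
  let ?S = "\<lambda>m. (\<lambda>i. (Q ^^ i) y) ` {m..<n}"
  have "(Q ^^ n) y \<in> cspan (?S m)" if "m \<le> n" for m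
    using that
  proof (induction m)
    case 0
    then show ?case using \<open>(Q ^^ n) y \<in> _\<close> by (simp add: lessThan_atLeast0)
  next
    case (Suc m)
    then have m: "m < n" by simp
    have "{m..<n} = insert m {Suc m..<n}" using m by auto
    then have "?S m = insert ((Q ^^ m) y) (?S (Suc m))" by simp
    then have "(Q ^^ n) y \<in> cspan (insert ((Q ^^ m) y) (?S (Suc m)))" using Suc.IH m by simp
    then obtain c where c: "(Q ^^ n) y - c *\<^sub>C (Q ^^ m) y \<in> cspan (?S (Suc m))"
      using complex_vector.span_breakdown_eq by blast
    let ?L = "Q ^^ (n - m)"
    have Lb: "?L \<in> bounded_ops" by (rule bounded_ops_funpow[OF Q])
    have Lp: "?L ((Q ^^ i) y) = (Q ^^ (n - m + i)) y" for i by (simp add: funpow_add)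
    have "cspan (?S (Suc m)) \<subseteq> {x \<in> UNIV. ?L x = 0}"
      by (rule complex_vector.span_minimal[OF _ csubspace_kernel[OF Lb complex_vector.subspace_UNIV]])
        (auto simp: Lp intro!: zero)
    then have "?L ((Q ^^ n) y - c *\<^sub>C (Q ^^ m) y) = 0" using c by blast
    then have "c *\<^sub>C (Q ^^ n) y = 0"
      using m zero[of "n - m + n"] by (simp add: bounded_ops_simps[OF Lb] Lp)
    then have "c = 0" using top(1) by simp
    then show ?case using c by simp
  qed
  from this[of n] show False using top(1) by simp
qed

text \<open>Let \<open>J\<close> be the projection onto \<open>Y = ker Q\<^sup>k \<inter> ker E\<close>, which is nonzero for reasons of dimension, and
let \<open>n + 1\<close> be the order of nilpotency of \<open>Q\<close> on \<open>Y\<close>. For \<open>y \<in> Y\<close> with \<open>Q\<^sup>n y \<noteq> 0\<close> and a functional \<open>f\<close>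
that factors through \<open>J\<close>, the operator \<open>P x = \<Sum>\<^sub>i f (Q\<^sup>n\<^sup>-\<^sup>i x) Q\<^sup>i y\<close> commutes with \<open>Q\<close>, since \<open>f\<close>
vanishes on the range of \<open>Q\<^sup>n\<^sup>+\<^sup>1\<close> and \<open>Q\<^sup>n\<^sup>+\<^sup>1 y = 0\<close>. It is the projection onto the Jordan chain of \<open>y\<close> if
\<open>f\<close> takes the value \<open>1\<close> at the top of the chain and \<open>0\<close> at its other vectors.\<close>

lemma commuting_projection_step:
  assumes Q: "Q \<in> bounded_ops" and inj: "\<forall>x \<in> range (Q ^^ k). Q x = 0 \<longrightarrow> x = 0"
    and eq: "range (Q ^^ k) = range (Q ^^ Suc k)" and inf: "\<not> fin_dim {x. (Q ^^ k) x = 0}"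
    and E: "E \<in> bounded_ops" "fin_dim (range E)" "\<And>x. E (E x) = E x" "\<And>x. E (Q x) = Q (E x)"
  obtains P where "P \<in> bounded_ops" "fin_dim (range P)" "\<And>x. P (P x) = P x" "\<And>x. P (Q x) = Q (P x)"
    "\<And>x. P (E x) = 0" "\<And>x. E (P x) = 0" "\<And>x. (Q ^^ k) (P x) = 0" "\<exists>x. P x \<noteq> 0"
proof -
  obtain H where H: "H \<in> bounded_ops" "\<And>x. (Q ^^ k) (H x) = 0" "\<And>x. (Q ^^ k) x = 0 \<Longrightarrow> H x = x"
    "\<forall>S\<in>bounded_ops. (\<forall>x. S (Q x) = Q (S x)) \<longrightarrow> (\<forall>x. S (H x) = H (S x))"
    by (rule pole_projection[OF Q inj eq], rule that) assumption+
  have Qb: "Q ^^ i \<in> bounded_ops" for i by (rule bounded_ops_funpow[OF Q])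
  have EQ: "E ((Q ^^ i) x) = (Q ^^ i) (E x)" for i x by (rule commute_funpow) (rule E(4))
  define Y where "Y = {x. (Q ^^ k) x = 0 \<and> E x = 0}"
  have QY: "(Q ^^ i) x \<in> Y" if "x \<in> Y" for i x
  proof -
    have "(Q ^^ k) ((Q ^^ i) x) = (Q ^^ i) ((Q ^^ k) x)"
      by (metis comp_apply funpow_add add.commute)
    then show ?thesis using that EQ[of i x] bounded_ops_zero[OF Qb] unfolding Y_def by simp
  qed
  have "\<exists>y0\<in>Y. y0 \<noteq> 0"
  proof (rule ccontr)
    assume "\<not> ?thesis"
    then have Y0: "Y \<subseteq> {0}" by blast
    let ?N = "{x \<in> UNIV. (Q ^^ k) x = 0}"
    have "fin_dim ?N"
    proof (rule fin_dim_from_kernel_image[OF E(1)])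
      show "csubspace ?N" by (rule csubspace_kernel[OF Qb complex_vector.subspace_UNIV])
      show "fin_dim (E ` ?N)" by (rule fin_dim_subset[OF E(2)]) blast
      show "fin_dim {x \<in> ?N. E x = 0}" by (rule fin_dim_subset[OF fin_dim_zero]) (use Y0 in \<open>auto simp: Y_def\<close>)
    qed
    then show False using inf by simp
  qed
  then obtain y0 where y0: "y0 \<in> Y" "y0 \<noteq> 0" by blast
  define m where "m = (LEAST m. \<forall>y\<in>Y. (Q ^^ m) y = 0)"
  have mY: "\<forall>y\<in>Y. (Q ^^ m) y = 0"
    unfolding m_def by (rule LeastI[of _ k]) (simp add: Y_def)
  have "m \<noteq> 0" using mY y0 by (metis funpow_0)
  then obtain n where n: "m = Suc n" by (cases m) auto
  have "\<not> (\<forall>y\<in>Y. (Q ^^ n) y = 0)" using not_less_Least[of n "\<lambda>m. \<forall>y\<in>Y. (Q ^^ m) y = 0"] n unfolding m_def by simp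
  then obtain y where y: "y \<in> Y" "(Q ^^ n) y \<noteq> 0" by blast
  have ySuc: "(Q ^^ Suc n) y = 0" using mY y n by blast
  let ?W = "cspan ((\<lambda>i. (Q ^^ i) y) ` {..<n})"
  have "closed ?W" by (intro closed_fin_dim fin_dim_span complex_vector.subspace_span) simp
  then obtain h where h: "cfunctional h" "\<And>w. w \<in> ?W \<Longrightarrow> h w = 0" "h ((Q ^^ n) y) = 1"
    using Hahn_Banach_separation[OF complex_vector.subspace_span _ jordan_chain_top_independent[OF Q y(2) ySuc]]
    by metis
  define J where "J = (\<lambda>x. H x - E (H x))"
  have EH: "E (H x) = H (E x)" for x using H(4) E(1,4) by blast
  have QH: "(Q ^^ i) (H x) = H ((Q ^^ i) x)" for i x
  proof -
    have "\<forall>x. (Q ^^ i) (Q x) = Q ((Q ^^ i) x)" by (simp add: funpow_swap1)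
    then show ?thesis using H(4) Qb by blast
  qed
  have Jb: "J \<in> bounded_ops" unfolding J_def
    by (rule bounded_ops_sub[OF H(1) bounded_ops_compose[OF E(1) H(1)]])
  have JY: "J x \<in> Y" for x
    unfolding J_def Y_def using H(2)[of x] EQ[of k "H x"]
    by (simp add: bounded_ops_simps[OF Qb] bounded_ops_simps[OF E(1)] E(3) bounded_ops_zero[OF E(1)])
  have Jid: "J x = x" if "x \<in> Y" for x
    using that H(3)[of x] unfolding J_def Y_def by simp
  have JQ: "J ((Q ^^ i) x) = (Q ^^ i) (J x)" for i x
    unfolding J_def using QH[of i x] EQ[of i "H x"] by (simp add: bounded_ops_simps[OF Qb])
  have JE: "J (E x) = 0" for x
    unfolding J_def using EH[of x] EH[of "E x"] E(3) by simp
  define f where "f = (\<lambda>x. h (J x))"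
  have f: "cfunctional f"
    using h(1) bounded_linear_compose[of h J] bounded_ops_bounded_linear[OF Jb] bounded_ops_scaleC[OF Jb]
    unfolding f_def cfunctional_def by simp
  have f0: "f 0 = 0" using f linear_0[of f] bounded_linear.linear unfolding cfunctional_def by blast
  have fSuc: "f ((Q ^^ Suc n) x) = 0" for x
  proof -
    have "J ((Q ^^ Suc n) x) = 0" unfolding JQ using mY JY[of x] n by metis
    then have "f ((Q ^^ Suc n) x) = h 0" unfolding f_def by metis
    also have "h 0 = 0" by (rule h(2)[OF complex_vector.span_zero])
    finally show ?thesis .
  qed
  have fy: "f ((Q ^^ i) y) = (if i = n then 1 else 0)" if "i \<le> n" for i
  proof -
    have "f ((Q ^^ i) y) = h ((Q ^^ i) y)" unfolding f_def by (simp add: Jid[OF QY[OF y(1)]])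
    moreover have "h ((Q ^^ i) y) = 0" if "i < n"
      using that by (intro h(2) complex_vector.span_base) auto
    ultimately show ?thesis using h(3) that by auto
  qed
  define P where "P = (\<lambda>x. \<Sum>i\<le>n. f ((Q ^^ (n - i)) x) *\<^sub>C (Q ^^ i) y)"
  have Pb: "P \<in> bounded_ops" unfolding P_def
    by (rule bounded_ops_finite_sum) (rule bounded_ops_compose[OF bounded_ops_rank_one[OF f] Qb])
  have PQ: "P (Q x) = Q (P x)" for x
  proof -
    let ?g = "\<lambda>i. f ((Q ^^ (Suc n - i)) x) *\<^sub>C (Q ^^ i) y"
    have "P (Q x) = (\<Sum>i\<le>n. ?g i)"
      unfolding P_def by (intro sum.cong refl) (simp add: Suc_diff_le funpow_swap1)
    also have "\<dots> = (\<Sum>i\<le>Suc n. ?g i)" using ySuc by simp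
    also have "\<dots> = ?g 0 + (\<Sum>i\<le>n. ?g (Suc i))" by (rule sum.atMost_Suc_shift)
    also have "?g 0 = 0" using fSuc[of x] by simp
    also have "0 + (\<Sum>i\<le>n. ?g (Suc i)) = Q (P x)"
      unfolding P_def by (simp add: bounded_ops_simps[OF Q])
    finally show ?thesis .
  qed
  have PQi: "P ((Q ^^ i) x) = (Q ^^ i) (P x)" for i x by (rule commute_funpow) (rule PQ)
  have Py: "P y = y"
  proof -
    have "P y = (\<Sum>i\<le>n. if i = 0 then y else 0)"
      unfolding P_def by (intro sum.cong refl) (auto simp: fy scaleC_one)
    then show ?thesis by simp
  qed
  have PP: "P (P x) = P x" for x
  proof -
    have "P (P x) = (\<Sum>i\<le>n. f ((Q ^^ (n - i)) x) *\<^sub>C P ((Q ^^ i) y))"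
      by (subst (2) P_def) (simp add: bounded_ops_simps[OF Pb])
    also have "\<dots> = P x" unfolding PQi Py by (simp add: P_def)
    finally show ?thesis .
  qed
  have "P x \<in> cspan ((\<lambda>i. (Q ^^ i) y) ` {..n})" for x
    unfolding P_def
    by (intro complex_vector.span_sum complex_vector.span_scale complex_vector.span_base) auto
  then have "range P \<subseteq> cspan ((\<lambda>i. (Q ^^ i) y) ` {..n})" by blast
  then have fdP: "fin_dim (range P)" by (rule fin_dim_subset[OF fin_dim_span, rotated]) simp
  have PE: "P (E x) = 0" for x
  proof -
    have "f ((Q ^^ i) (E x)) = 0" for i
      unfolding f_def EQ[symmetric] JE by (rule h(2)[OF complex_vector.span_zero])
    then show ?thesis unfolding P_def by simp
  qed
  have EP: "E (P x) = 0" for x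
    using QY[OF y(1)] unfolding P_def Y_def by (simp add: bounded_ops_simps[OF E(1)])
  have QkP: "(Q ^^ k) (P x) = 0" for x
    using QY[OF y(1)] unfolding P_def Y_def by (simp add: bounded_ops_simps[OF Qb])
  have "P y \<noteq> 0" using y(2) bounded_ops_zero[OF Qb] unfolding Py by metis
  then show ?thesis using that[OF Pb fdP PP PQ PE EP QkP] by blast
qed

text \<open>Each new projection is chosen orthogonal to the sum \<open>E l\<close> of the earlier ones, which is again a
projection of finite rank commuting with \<open>Q\<close>.\<close>

theorem orthogonal_projection_sequence:
  assumes Q: "Q \<in> bounded_ops" and inj: "\<forall>x \<in> range (Q ^^ k). Q x = 0 \<longrightarrow> x = 0"
    and eq: "range (Q ^^ k) = range (Q ^^ Suc k)" and inf: "\<not> fin_dim {x. (Q ^^ k) x = 0}"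
  obtains P :: "nat \<Rightarrow> 'a::complex_banach \<Rightarrow> 'a" where "\<And>l. P l \<in> bounded_ops" "\<And>l x. P l (P l x) = P l x"
    "\<And>l m x. l \<noteq> m \<Longrightarrow> P l (P m x) = 0" "\<And>l x. P l (Q x) = Q (P l x)"
    "\<And>l x. (Q ^^ k) (P l x) = 0" "\<And>l. \<exists>x. P l x \<noteq> 0"
proof -
  define good :: "('a \<Rightarrow> 'a) \<Rightarrow> bool" where
    "good = (\<lambda>E. E \<in> bounded_ops \<and> fin_dim (range E) \<and> (\<forall>x. E (E x) = E x) \<and> (\<forall>x. E (Q x) = Q (E x)))"
  have "\<exists>P. good E \<longrightarrow> good P \<and> (\<forall>x. P (E x) = 0) \<and> (\<forall>x. E (P x) = 0)
      \<and> (\<forall>x. (Q ^^ k) (P x) = 0) \<and> (\<exists>x. P x \<noteq> 0)" for E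
  proof (cases "good E")
    case True
    then have E: "E \<in> bounded_ops" "fin_dim (range E)" "\<And>x. E (E x) = E x" "\<And>x. E (Q x) = Q (E x)"
      unfolding good_def by auto
    obtain P where "P \<in> bounded_ops" "fin_dim (range P)" "\<And>x. P (P x) = P x" "\<And>x. P (Q x) = Q (P x)"
      "\<And>x. P (E x) = 0" "\<And>x. E (P x) = 0" "\<And>x. (Q ^^ k) (P x) = 0" "\<exists>x. P x \<noteq> 0"
      by (rule commuting_projection_step[OF Q inj eq inf E], rule that) assumption+
    then show ?thesis unfolding good_def by (intro exI[of _ P]) simp
  qed blast
  then obtain g where g: "\<And>E. good E \<Longrightarrow> good (g E) \<and> (\<forall>x. g E (E x) = 0) \<and> (\<forall>x. E (g E x) = 0)
      \<and> (\<forall>x. (Q ^^ k) (g E x) = 0) \<and> (\<exists>x. g E x \<noteq> 0)" by metis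
  define E where "E = rec_nat (\<lambda>x. 0) (\<lambda>_ E. op_add E (g E))"
  define P where "P = (\<lambda>l. g (E l))"
  have P_eq: "P l = g (E l)" for l by (simp add: P_def)
  have E0: "E 0 = (\<lambda>x. 0)" and ES: "E (Suc l) = op_add (E l) (P l)" for l unfolding E_def P_def by simp_all
  have goodE: "good (E l)" for l
  proof (induction l)
    case 0
    have "range (\<lambda>x::'a. 0::'a) = {0}" by auto
    then show ?case unfolding good_def E0 using fin_dim_zero bounded_ops_null bounded_ops_zero[OF Q] by simp
  next
    case (Suc l)
    note G = g[OF Suc, folded P_eq]
    have b: "E l \<in> bounded_ops" "P l \<in> bounded_ops" using Suc G unfolding good_def by auto
    have "op_add (E l) (P l) \<in> bounded_ops" by (rule bounded_ops_op_add[OF b])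
    moreover have "range (op_add (E l) (P l)) \<subseteq> range (E l) + range (P l)"
      unfolding op_add_def by (auto intro!: set_plusI)
    then have "fin_dim (range (op_add (E l) (P l)))"
      by (rule fin_dim_subset[OF fin_dim_plus, rotated 2]) (use Suc G in \<open>auto simp: good_def\<close>)
    ultimately show ?case unfolding ES good_def
      using Suc G by (simp add: good_def op_add_def bounded_ops_simps[OF b(1)] bounded_ops_simps[OF b(2)] bounded_ops_simps[OF Q])
  qed
  note G = g[OF goodE, folded P_eq]
  have Pb: "P l \<in> bounded_ops" for l using G[of l] unfolding good_def by blast
  have PP: "P l (P l x) = P l x" for l x using G[of l] unfolding good_def by blast
  have EP: "E m (P l x) = P l x" if "l < m" for l m x
    using that
  proof (induction m)
    case (Suc m)
    show ?case
    proof (cases "l = m")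
      case True
      then show ?thesis unfolding ES op_add_def using G[of m] PP by simp
    next
      case False
      then have IH: "E m (P l x) = P l x" using Suc by simp
      then have "P m (P l x) = P m (E m (P l x))" by simp
      also have "\<dots> = 0" using G[of m] by blast
      finally show ?thesis unfolding ES op_add_def using IH by simp
    qed
  qed simp
  have PE: "P l (E m x) = P l x" if "l < m" for l m x
    using that
  proof (induction m arbitrary: x)
    case (Suc m)
    show ?case
    proof (cases "l = m")
      case True
      then show ?thesis unfolding ES op_add_def using G[of m] PP by (simp add: bounded_ops_simps[OF Pb])
    next
      case False
      then have IH: "P l (E m x) = P l x" for x using Suc by simp
      have "P l (P m x) = P l (E m (P m x))" using IH by simp
      also have "\<dots> = P l 0" using G[of m] by metis
      finally show ?thesis unfolding ES op_add_def using IH bounded_ops_zero[OF Pb] by (simp add: bounded_ops_simps[OF Pb])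
    qed
  qed simp
  have orth: "P l (P m x) = 0" if "l \<noteq> m" for l m x
  proof (cases "l < m")
    case True
    have "P l (P m x) = P l (E m (P m x))" using PE[OF True] by simp
    also have "\<dots> = P l 0" using G[of m] by metis
    finally show ?thesis using bounded_ops_zero[OF Pb] by simp
  next
    case False
    then have "m < l" using that by simp
    then have "P l (P m x) = P l (E l (P m x))" using EP by simp
    also have "\<dots> = 0" using G[of l] by blast
    finally show ?thesis .
  qed
  show ?thesis
  proof (rule that[of P])
    show "P l (Q x) = Q (P l x)" for l x using G[of l] unfolding good_def by blast
    show "(Q ^^ k) (P l x) = 0" for l x using G[of l] by blast
    show "\<exists>x. P l x \<noteq> 0" for l using G[of l] by blast
  qed (use Pb PP orth in auto)
qed

text \<open>Take \<open>T = \<Sum> \<epsilon>\<^sub>l P\<^sub>l\<close> and \<open>S = T + Q\<close>. The range of \<open>P\<^sub>l\<close> contains a vector \<open>w \<noteq> 0\<close> with \<open>Q w = 0\<close>, for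
which \<open>S w = \<epsilon>\<^sub>l w\<close>. If \<open>S\<^sup>j\<close> had closed range, \<open>w\<close> would have a preimage of norm at most \<open>C\<close> times that
of \<open>w\<close>; its image under \<open>P\<^sub>l\<close> can only be \<open>\<epsilon>\<^sub>l\<^sup>-\<^sup>j w\<close>, since \<open>S\<close> is injective on the range of \<open>P\<^sub>l\<close>. This
bounds \<open>\<epsilon>\<^sub>l\<^sup>-\<^sup>j\<close> by \<open>C\<close> times the norm of \<open>P\<^sub>l\<close>, and the \<open>\<epsilon>\<^sub>l\<close> are chosen so small that this fails for large \<open>l\<close>.\<close>

theorem nonclosed_perturbation:
  fixes Q :: "'a::complex_banach \<Rightarrow> 'a"
  assumes Q: "Q \<in> bounded_ops" and inj: "\<forall>x \<in> range (Q ^^ k). Q x = 0 \<longrightarrow> x = 0"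
    and eq: "range (Q ^^ k) = range (Q ^^ Suc k)" and inf: "\<not> fin_dim {x. (Q ^^ k) x = 0}"
    and r: "0 < r"
  obtains T where "T \<in> bounded_ops" "\<And>x. T (Q x) = Q (T x)" "\<And>x. norm (T x) \<le> r * norm x"
    "\<And>j. 1 \<le> j \<Longrightarrow> \<not> closed (range ((\<lambda>x. T x + Q x) ^^ j))"
proof -
  obtain P :: "nat \<Rightarrow> 'a \<Rightarrow> 'a" where P: "\<And>l. P l \<in> bounded_ops" "\<And>l x. P l (P l x) = P l x"
    "\<And>l m x. l \<noteq> m \<Longrightarrow> P l (P m x) = 0" "\<And>l x. P l (Q x) = Q (P l x)"
    "\<And>l x. (Q ^^ k) (P l x) = 0" "\<And>l. \<exists>x. P l x \<noteq> 0"
    by (rule orthogonal_projection_sequence[OF Q inj eq inf], rule that) assumption+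
  have "\<exists>b\<ge>1. \<forall>x. norm (P l x) \<le> b * norm x" for l
  proof -
    obtain K where K: "0 < K" "\<And>x. norm (P l x) \<le> K * norm x" using bounded_ops_bound[OF P(1)] by metis
    have "norm (P l x) \<le> max 1 K * norm x" for x
      by (rule order_trans[OF K(2)]) (simp add: mult_right_mono)
    then show ?thesis by (intro exI[of _ "max 1 K"]) simp
  qed
  then obtain b where b: "\<And>l. 1 \<le> b l" "\<And>l x. norm (P l x) \<le> b l * norm x" by metis
  \<comment> \<open>The bounds \<open>\<epsilon> l * b l\<close> of the summands add up to \<open>r\<close>; \<open>b l \<ge> 1\<close> ensures \<open>\<epsilon> l \<le> r\<close>.\<close>
  define \<epsilon> where "\<epsilon> = (\<lambda>l. r * (1/2) ^ Suc l / b l)"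
  have bpos: "0 < b l" for l using b(1)[of l] by simp
  have epos: "0 < \<epsilon> l" for l unfolding \<epsilon>_def using r bpos by simp
  have eb: "\<epsilon> l * b l = r * (1/2) ^ Suc l" for l unfolding \<epsilon>_def using bpos[of l] by simp
  have ele: "\<epsilon> l \<le> r" for l
  proof -
    have "\<epsilon> l * 1 \<le> \<epsilon> l * b l" using epos[of l] b(1)[of l] by (intro mult_left_mono) auto
    also have "\<dots> \<le> r * 1" unfolding eb using r by (intro mult_left_mono power_le_one) auto
    finally show ?thesis by simp
  qed
  define t where "t = (\<lambda>x l. complex_of_real (\<epsilon> l) *\<^sub>C P l x)"
  have tn: "norm (t x l) \<le> r * norm x * (1/2) ^ Suc l" for x l
  proof -
    have "norm (t x l) \<le> \<epsilon> l * (b l * norm x)"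
      unfolding t_def norm_scaleC using epos[of l] b(2)[of l x] by (simp add: mult_left_mono)
    also have "\<dots> = r * norm x * (1/2) ^ Suc l" using eb[of l] by (metis mult.assoc mult.commute)
    finally show ?thesis .
  qed
  have gs: "(\<lambda>l. r * norm x * (1/2::real) ^ Suc l) sums (r * norm x)" for x :: 'a
    using sums_mult[OF power_half_series, of "r * norm x"] by simp
  have ts: "summable (t x)" for x
    by (rule summable_comparison_test[OF _ sums_summable[OF gs[of x]]]) (use tn in auto)
  define T where "T = (\<lambda>x. \<Sum>l. t x l)"
  have Tn: "norm (T x) \<le> r * norm x" for x
  proof -
    have "norm (T x) \<le> (\<Sum>l. r * norm x * (1/2) ^ Suc l)"
      unfolding T_def by (rule norm_suminf_le[OF tn sums_summable[OF gs[of x]]])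
    then show ?thesis using sums_unique[OF gs[of x]] by linarith
  qed
  have Tadd: "T (x + y) = T x + T y" for x y
    unfolding T_def suminf_add[OF ts ts] by (simp add: t_def bounded_ops_simps[OF P(1)] scaleC_add_right)
  have Tscale: "T (c *\<^sub>C x) = c *\<^sub>C T x" for c x
    unfolding T_def bounded_linear.suminf[OF bounded_linear_scaleC ts]
    by (simp add: t_def bounded_ops_simps[OF P(1)] scaleC_scaleC mult.commute)
  have "bounded_linear T"
    by (rule bounded_linear_intro[where K = r]) (simp_all add: Tadd scaleR_scaleC Tscale Tn mult.commute[of _ r])
  then have Tb: "T \<in> bounded_ops" unfolding bounded_ops_def using Tscale by simp
  have TQ: "T (Q x) = Q (T x)" for x
    unfolding T_def bounded_linear.suminf[OF bounded_ops_bounded_linear[OF Q] ts]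
    by (simp add: t_def bounded_ops_simps[OF Q] P(4))
  have TP: "T (P l x) = complex_of_real (\<epsilon> l) *\<^sub>C P l x" for l x
  proof -
    have "T (P l x) = (\<Sum>m. if m = l then complex_of_real (\<epsilon> l) *\<^sub>C P l x else 0)"
      unfolding T_def by (rule suminf_cong) (auto simp: t_def P(2) P(3))
    also have "\<dots> = complex_of_real (\<epsilon> l) *\<^sub>C P l x"
      using suminf_finite[of "{l}" "\<lambda>m. if m = l then complex_of_real (\<epsilon> l) *\<^sub>C P l x else 0"] by simp
    finally show ?thesis .
  qed
  have PT: "P l (T x) = complex_of_real (\<epsilon> l) *\<^sub>C P l x" for l x
  proof -
    have "P l (T x) = (\<Sum>m. P l (t x m))"
      unfolding T_def by (rule bounded_linear.suminf[OF bounded_ops_bounded_linear[OF P(1)] ts])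
    also have "\<dots> = (\<Sum>m. if m = l then complex_of_real (\<epsilon> l) *\<^sub>C P l x else 0)"
      by (rule suminf_cong) (auto simp: t_def P(2) P(3) bounded_ops_simps[OF P(1)])
    also have "\<dots> = complex_of_real (\<epsilon> l) *\<^sub>C P l x"
      using suminf_finite[of "{l}" "\<lambda>m. if m = l then complex_of_real (\<epsilon> l) *\<^sub>C P l x else 0"] by simp
    finally show ?thesis .
  qed
  define S where "S = (\<lambda>x. T x + Q x)"
  have Sb: "S \<in> bounded_ops" unfolding S_def using bounded_ops_op_add[OF Tb Q] by (simp add: op_add_def)
  have PS: "P l (S x) = S (P l x)" for l x
    unfolding S_def by (simp add: bounded_ops_simps[OF P(1)] PT TP P(4))
  have PSj: "P l ((S ^^ j) x) = (S ^^ j) (P l x)" for l j x by (rule commute_funpow) (rule PS)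
  have Sinj: "v = 0" if v: "P l v = v" "(S ^^ j) v = 0" for l j v
    using v
  proof (induction j arbitrary: v)
    case (Suc j)
    have Sv: "P l (S v) = S v" using PS Suc.prems(1) by simp
    have "(S ^^ j) (S v) = 0" using Suc.prems(2) by (simp add: funpow_swap1)
    then have "S v = 0" using Suc.IH[OF Sv] by blast
    then have Qv: "Q v = (- complex_of_real (\<epsilon> l)) *\<^sub>C v"
      using TP[of l v] Suc.prems(1) unfolding S_def by (simp add: add_eq_0_iff)
    have "(Q ^^ i) v = (- complex_of_real (\<epsilon> l)) ^ i *\<^sub>C v" for i
      by (induction i) (auto simp: Qv bounded_ops_simps[OF Q] scaleC_scaleC scaleC_one mult.commute)
    then have "(- complex_of_real (\<epsilon> l)) ^ k *\<^sub>C v = 0" using P(5)[of l v] Suc.prems(1) by metis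
    then show ?case using epos[of l] by simp
  qed simp
  have "\<not> closed (range (S ^^ j))" if j: "1 \<le> j" for j
  proof
    assume cl: "closed (range (S ^^ j))"
    have Sjb: "S ^^ j \<in> bounded_ops" by (rule bounded_ops_funpow[OF Sb])
    obtain C where C: "C > 0" "\<And>y. y \<in> range (S ^^ j) \<Longrightarrow> \<exists>x\<in>UNIV. (S ^^ j) x = y \<and> norm x \<le> C * norm y"
      using open_mapping_bound[OF bounded_ops_bounded_linear[OF Sjb] subspace_UNIV closed_UNIV cl] by metis
    have key: "1 \<le> r ^ (j - 1) * (r * (1/2) ^ Suc l) * C" for l
    proof -
      obtain z where z: "P l z \<noteq> 0" using P(6) by blast
      define n where "n = (LEAST n. (Q ^^ n) (P l z) = 0)"
      have n: "(Q ^^ n) (P l z) = 0" unfolding n_def using P(5) by (rule LeastI)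
      have "n \<noteq> 0" using n z by (metis funpow_0)
      then obtain i where i: "n = Suc i" by (cases n) auto
      define w where "w = (Q ^^ i) (P l z)"
      have w0: "w \<noteq> 0" unfolding w_def using not_less_Least[of i "\<lambda>n. (Q ^^ n) (P l z) = 0"] i unfolding n_def by simp
      have Qw: "Q w = 0" using n unfolding w_def i by simp
      have "P l ((Q ^^ i) (P l z)) = (Q ^^ i) (P l (P l z))" by (rule commute_funpow) (rule P(4))
      then have Pw: "P l w = w" unfolding w_def using P(2) by simp
      define \<epsilon>' where "\<epsilon>' = complex_of_real (\<epsilon> l)"
      have e0: "\<epsilon>' \<noteq> 0" unfolding \<epsilon>'_def using epos[of l] by simp
      have Sw: "S w = \<epsilon>' *\<^sub>C w" unfolding S_def using TP[of l w] Pw Qw unfolding \<epsilon>'_def by simp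
      have Sjw: "(S ^^ i) w = \<epsilon>' ^ i *\<^sub>C w" for i
        by (induction i) (auto simp: Sw bounded_ops_simps[OF Sb] scaleC_scaleC scaleC_one mult.commute)
      define u where "u = inverse (\<epsilon>' ^ j) *\<^sub>C w"
      have Su: "(S ^^ j) u = w" unfolding u_def using e0 by (simp add: bounded_ops_simps[OF Sjb] Sjw scaleC_scaleC scaleC_one)
      then have "w \<in> range (S ^^ j)" by blast
      then obtain x where x: "(S ^^ j) x = w" "norm x \<le> C * norm w" using C(2) by blast
      have "P l x - u = 0"
      proof (rule Sinj)
        show "P l (P l x - u) = P l x - u" unfolding u_def by (simp add: bounded_ops_simps[OF P(1)] P(2) Pw)
        show "(S ^^ j) (P l x - u) = 0" using Su x(1) Pw by (simp add: bounded_ops_simps[OF Sjb] PSj[symmetric])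
      qed
      then have "norm u = norm (P l x)" by simp
      also have "\<dots> \<le> b l * (C * norm w)" by (rule order_trans[OF b(2)]) (use x(2) bpos[of l] in simp)
      finally have 1: "inverse (\<epsilon> l ^ j) * norm w \<le> b l * C * norm w"
        unfolding u_def \<epsilon>'_def using epos[of l] by (simp add: norm_scaleC norm_inverse norm_power mult.assoc)
      then have "inverse (\<epsilon> l ^ j) \<le> b l * C" using w0 by simp
      then have "\<epsilon> l ^ j * inverse (\<epsilon> l ^ j) \<le> \<epsilon> l ^ j * (b l * C)"
        using epos[of l] by (intro mult_left_mono) auto
      then have "1 \<le> \<epsilon> l ^ j * (b l * C)" using epos[of l] by simp
      also have "\<epsilon> l ^ j = \<epsilon> l ^ (j - 1) * \<epsilon> l" using j by (metis le_add_diff_inverse2 power_add power_one_right)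
      also have "\<epsilon> l ^ (j - 1) * \<epsilon> l * (b l * C) = \<epsilon> l ^ (j - 1) * (r * (1/2) ^ Suc l * C)"
        unfolding eb[symmetric] by (simp add: mult_ac)
      also have "\<dots> \<le> r ^ (j - 1) * (r * (1/2) ^ Suc l * C)"
        using ele[of l] epos[of l] r C(1) by (intro mult_right_mono power_mono) auto
      finally show ?thesis by (simp add: mult.assoc)
    qed
    have "(\<lambda>l. r ^ (j - 1) * (r * (1/2) ^ Suc l) * C) \<longlonglongrightarrow> 0"
      by (intro tendsto_mult_left_zero tendsto_mult_right_zero LIMSEQ_Suc LIMSEQ_power_zero) simp
    then have "\<forall>\<^sub>F l in sequentially. r ^ (j - 1) * (r * (1/2) ^ Suc l) * C < 1"
      by (rule order_tendstoD) simp
    then show False using key by (auto simp: eventually_sequentially not_less[symmetric])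
  qed
  then show ?thesis using that[OF Tb TQ Tn] unfolding S_def by blast
qed

section \<open>The six spectra\<close>

text \<open>The decomposition with \<open>M = UNIV\<close> and \<open>N = {0}\<close>; the inverse is bounded by the open mapping theorem.\<close>

lemma bij_imp_gen_drazin_riesz:
  assumes T: "T \<in> bounded_ops" and bij: "bij T"
  shows "gen_drazin_riesz T"
proof -
  have ran: "range T = UNIV" using bij by (rule bij_is_surj)
  obtain C where C: "C > 0" "\<And>y. y \<in> range T \<Longrightarrow> \<exists>x\<in>UNIV. T x = y \<and> norm x \<le> C * norm y"
    using open_mapping_bound[OF bounded_ops_bounded_linear[OF T] subspace_UNIV closed_UNIV] ran closed_UNIV by metis
  have inv: "inv T (T x) = x" "T (inv T x) = x" for x
    using bij by (simp_all add: bij_is_inj bij_is_surj surj_f_inv_f)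
  have inj: "T a = T b \<Longrightarrow> a = b" for a b using bij by (metis bij_is_inj injD)
  have "bounded_op_on UNIV (inv T)"
    unfolding bounded_op_on_def
  proof (intro conjI ballI allI exI[of _ C])
    show "inv T (x + y) = inv T x + inv T y" for x y by (rule inj) (simp add: inv bounded_ops_simps[OF T])
    show "inv T (c *\<^sub>C x) = c *\<^sub>C inv T x" for c x by (rule inj) (simp add: inv bounded_ops_simps[OF T])
    show "norm (inv T x) \<le> C * norm x" for x
      using C(2)[of x] ran inv by (metis UNIV_I)
  qed simp
  then have 1: "invertible_on UNIV T" unfolding invertible_on_def using inv by blast
  have "fredholm_on {0} (op_shift T c)" for c
  proof -
    have im: "op_shift T c ` {0} = {0}" using bounded_ops_zero[OF bounded_ops_op_shift[OF T]] by simp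
    show ?thesis unfolding fredholm_on_def alpha_on_def beta_on_def im edim_finite_iff
      using fin_dim_subset[OF fin_dim_zero, of "{x \<in> {0}. op_shift T c x = 0}"]
        ecodim_finite_iff[OF complex_vector.subspace_single_0 complex_vector.subspace_single_0 order_refl]
        fin_codim_superset[OF complex_vector.subspace_single_0 order_refl] by blast
  qed
  then have 2: "riesz_on {0} T" unfolding riesz_on_def by blast
  show ?thesis unfolding gen_drazin_riesz_def
    by (intro exI[of _ UNIV] exI[of _ "{0}"])
      (use 1 2 bounded_ops_zero[OF T] in \<open>auto simp: complex_vector.subspace_UNIV complex_vector.subspace_single_0\<close>)
qed

lemmas sigma_simps = b_fredholm_iff upper_semi_b_fredholm_iff lower_semi_b_fredholm_iff
  drazin_invertible_iff left_drazin_invertible_iff right_drazin_invertible_iff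
  sigma_bf_def sigma_ubf_def sigma_lbf_def sigma_d_def sigma_ld_def sigma_rd_def

lemma sigma_cong:
  assumes "\<sigma> \<in> {sigma_bf, sigma_ubf, sigma_lbf, sigma_d, sigma_ld, sigma_rd}"
    and "T \<in> bounded_ops" "S \<in> bounded_ops"
    and "\<And>c. same_semi_type UNIV (op_shift T c) UNIV (op_shift S c)"
  shows "\<sigma> T = \<sigma> S"
proof -
  show ?thesis
    using assms(1,4) unfolding same_semi_type_def
    by (auto simp: sigma_simps bounded_ops_op_shift assms(2,3))
qed

lemma not_in_sigma_if_pole:
  assumes "\<sigma> \<in> {sigma_bf, sigma_ubf, sigma_lbf, sigma_d, sigma_ld, sigma_rd}"
    and T: "T \<in> bounded_ops"
    and "finite_ascent UNIV (op_shift T c)" "finite_descent UNIV (op_shift T c)"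
  shows "c \<notin> \<sigma> T"
proof -
  have "semi_upper UNIV (op_shift T c)" "semi_lower UNIV (op_shift T c)"
    using invariant_operator.ascent_descent_imp_semi[OF invariant_operator_UNIV[OF bounded_ops_op_shift[OF T]] assms(3,4)]
    by auto
  then show ?thesis
    using assms(1,3,4) by (auto simp: sigma_simps bounded_ops_op_shift T)
qed

text \<open>The Drazin case is covered as well, because finite ascent and descent together imply both
semi-Fredholm conditions.\<close>

lemma not_in_sigma_imp_semi:
  assumes "\<sigma> \<in> {sigma_bf, sigma_ubf, sigma_lbf, sigma_d, sigma_ld, sigma_rd}"
    and T: "T \<in> bounded_ops" and "c \<notin> \<sigma> T"
  shows "semi_upper UNIV (op_shift T c) \<or> semi_lower UNIV (op_shift T c)"
proof -
  show ?thesis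
    using assms(1,3) invariant_operator.ascent_descent_imp_semi[OF invariant_operator_UNIV[OF bounded_ops_op_shift[OF T]]]
    by (auto simp: sigma_simps bounded_ops_op_shift T)
qed

text \<open>Stability is used for two operators only: for the identity, whose six spectra are empty, and for
\<open>T - l\<close> with \<open>T\<close> from \<open>nonclosed_perturbation\<close>, which is invertible since \<open>T\<close> has norm less than
\<open>\<bar>l\<bar>\<close>.\<close>

lemma power_finite_rank_if_sigma_stable:
  assumes \<sigma>: "\<sigma> \<in> {sigma_bf, sigma_ubf, sigma_lbf, sigma_d, sigma_ld, sigma_rd}"
    and F: "F \<in> bounded_ops"
    and stable: "\<And>T. T \<in> comm F \<Longrightarrow> bij T \<Longrightarrow> \<sigma> T = \<sigma> (op_add T F)"
  shows "F \<in> power_finite_rank"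
proof (rule ccontr)
  assume npfr: "F \<notin> power_finite_rank"
  have "quasi_fredholm (op_shift F c)" for c
  proof -
    let ?I = "\<lambda>x::'a. x"
    have I: "?I \<in> comm F" unfolding comm_def using bounded_ops_ident by (simp add: comp_def)
    have Fs: "op_shift F c \<in> bounded_ops" by (rule bounded_ops_op_shift[OF F])
    have shiftI: "op_shift ?I (c + 1) x = (- c) *\<^sub>C x" for x
      by (simp add: op_shift_def scaleC_add_left scaleC_one)
    have "finite_ascent UNIV (op_shift ?I (c + 1)) \<and> finite_descent UNIV (op_shift ?I (c + 1))"
    proof (cases "c = 0")
      case True
      then have "op_shift ?I (c + 1) = (\<lambda>x. 0)" using shiftI by (simp add: fun_eq_iff)
      then show ?thesis unfolding finite_ascent_def finite_descent_def
        by (intro conjI exI[of _ 1]) auto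
    next
      case False
      have "bij (op_shift ?I (c + 1))"
      proof (rule o_bij)
        show "(\<lambda>x. inverse (- c) *\<^sub>C x) \<circ> op_shift ?I (c + 1) = id"
          and "op_shift ?I (c + 1) \<circ> (\<lambda>x. inverse (- c) *\<^sub>C x) = id"
          using False by (auto simp: fun_eq_iff shiftI scaleC_scaleC scaleC_one)
      qed
      then show ?thesis using bij_imp_finite_ascent_descent[OF bounded_ops_op_shift[OF bounded_ops_ident]] by blast
    qed
    then have "c + 1 \<notin> \<sigma> ?I" using not_in_sigma_if_pole[OF \<sigma> bounded_ops_ident] by blast
    then have "c + 1 \<notin> \<sigma> (op_add ?I F)" using stable[OF I] bij_id unfolding id_def by blast
    moreover have "op_shift (op_add ?I F) (c + 1) = op_shift F c"
      by (simp add: fun_eq_iff op_shift_def op_add_def scaleC_add_left scaleC_one)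
    ultimately have "semi_upper UNIV (op_shift F c) \<or> semi_lower UNIV (op_shift F c)"
      using not_in_sigma_imp_semi[OF \<sigma> bounded_ops_op_add[OF bounded_ops_ident F], of "c + 1"] by simp
    then show ?thesis using semi_upper_imp_quasi_fredholm[OF Fs] semi_lower_imp_quasi_fredholm[OF Fs] by blast
  qed
  then obtain l k where l: "l \<noteq> 0" "\<forall>x \<in> range (op_shift F l ^^ k). op_shift F l x = 0 \<longrightarrow> x = 0"
    "range (op_shift F l ^^ k) = range (op_shift F l ^^ Suc k)" "\<not> fin_dim {x. (op_shift F l ^^ k) x = 0}"
    using infinite_dimensional_pole[OF F _ npfr] by metis
  have Qb: "op_shift F l \<in> bounded_ops" by (rule bounded_ops_op_shift[OF F])
  obtain T where T: "T \<in> bounded_ops" "\<And>x. T (op_shift F l x) = op_shift F l (T x)" "\<And>x. norm (T x) \<le> cmod l / 2 * norm x"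
    "\<And>j. 1 \<le> j \<Longrightarrow> \<not> closed (range ((\<lambda>x. T x + op_shift F l x) ^^ j))"
    using nonclosed_perturbation[OF Qb l(2-4), of "cmod l / 2"] l(1) by auto
  define T' where "T' = op_shift T l"
  have T'b: "T' \<in> bounded_ops" unfolding T'_def by (rule bounded_ops_op_shift[OF T(1)])
  have bij: "bij T'" unfolding T'_def by (rule bij_shift_large[OF T(1) T(3)]) (use l(1) in auto)
  have TF: "T (F x) = F (T x)" for x
    using T(2)[of x] by (simp add: op_shift_def bounded_ops_simps[OF T(1)])
  have "T' \<in> comm F" unfolding comm_def using T'b TF
    by (simp add: fun_eq_iff T'_def op_shift_def bounded_ops_simps[OF F])
  then have eq: "\<sigma> T' = \<sigma> (op_add T' F)" using stable bij by blast
  have shift0: "op_shift S 0 = S" for S :: "'a \<Rightarrow> 'a" by (simp add: fun_eq_iff op_shift_def)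
  have "0 \<notin> \<sigma> T'"
    using not_in_sigma_if_pole[OF \<sigma> T'b, of 0] bij_imp_finite_ascent_descent[OF T'b bij] unfolding shift0 by blast
  then have "0 \<notin> \<sigma> (op_add T' F)" using eq by simp
  moreover define S where "S = op_add T' F"
  ultimately have semi: "semi_upper UNIV S \<or> semi_lower UNIV S"
    using not_in_sigma_imp_semi[OF \<sigma>, of S 0] bounded_ops_op_add[OF T'b F] unfolding S_def shift0 by blast
  have Sb: "S \<in> bounded_ops" unfolding S_def by (rule bounded_ops_op_add[OF T'b F])
  have "\<exists>n. \<forall>j\<ge>n. closed (range (S ^^ j))"
    using semi unfolding invariant_operator.semi_upper_iff[OF invariant_operator_UNIV[OF Sb]]
      invariant_operator.semi_lower_iff_Suc[OF invariant_operator_UNIV[OF Sb]] by blast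
  then obtain n where n: "\<And>j. n \<le> j \<Longrightarrow> closed (range (S ^^ j))" by blast
  have "closed (range (S ^^ Suc n))" by (rule n[OF le_SucI[OF order_refl]])
  moreover have "S = (\<lambda>x. T x + op_shift F l x)"
    unfolding S_def T'_def by (simp add: fun_eq_iff op_add_def op_shift_def)
  ultimately show False using T(4)[of "Suc n"] by simp
qed

theorem proposition4p6:
  fixes F :: "'a::complex_banach \<Rightarrow> 'a"
    and \<sigma> :: "('a \<Rightarrow> 'a) \<Rightarrow> complex set"
  assumes "edim (UNIV :: 'a set) = \<infinity>"
    and "F \<in> bounded_ops"
    and "\<sigma> \<in> {sigma_bf, sigma_ubf, sigma_lbf, sigma_d, sigma_ld, sigma_rd}"
  shows "(F \<in> power_finite_rank
            \<longleftrightarrow> (\<forall>T \<in> comm_w F. gen_drazin_riesz T \<longrightarrow> \<sigma> T = \<sigma> (op_add T F)))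
       \<and> (F \<in> power_finite_rank
            \<longleftrightarrow> (\<forall>T \<in> comm F. \<sigma> T = \<sigma> (op_add T F)))"
proof -
  have forward: "\<sigma> T = \<sigma> (op_add T F)" if "F \<in> power_finite_rank" "T \<in> comm_w F" for T
    using sigma_cong[OF assms(3) comm_wD(1)[OF that(2)] bounded_ops_op_add[OF comm_wD(1)[OF that(2)] assms(2)]
        power_finite_rank_same_semi_type[OF that]] .
  have sub: "comm F \<subseteq> comm_w F" by (rule comm_subset_comm_w[OF assms(2)])
  have backward: "F \<in> power_finite_rank"
    if "\<And>T. T \<in> comm F \<Longrightarrow> gen_drazin_riesz T \<Longrightarrow> \<sigma> T = \<sigma> (op_add T F)"
  proof (rule power_finite_rank_if_sigma_stable[OF assms(3,2)])
    fix T assume T: "T \<in> comm F" "bij T"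
    then have "T \<in> bounded_ops" unfolding comm_def by blast
    then show "\<sigma> T = \<sigma> (op_add T F)" using that[OF T(1)] bij_imp_gen_drazin_riesz T(2) by blast
  qed
  show ?thesis using forward backward sub by blast
qed

end
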